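(* Let $r\ge 0$ be an integer, let $\mathcal{K}$ be the integral operator with a Green's kernel $\kappa$ (with respect to $r$), let $\lambda\neq 0$ be a simple eigenvalue of $\mathcal{K}$ with spectral projection $E$, let $P_n$ be the orthogonal projection onto $\mathcal{X}_n$, $h=1/n$, and let $\mathcal{K}_n^M=P_n\mathcal{K}+\mathcal{K}P_n-P_n\mathcal{K}P_n$. Let $\lambda_n^M$ be the corresponding modified Galerkin eigenvalue, i.e. the eigenvalue of $\mathcal{K}_n^M$ inside $\Gamma$. Let $\varphi_n^M\in\mathcal{R}(E_n^M)$, $\|\varphi_n^M\|_\infty=1$, be a modified Galerkin eigenvector ($\mathcal{K}_n^M\varphi_n^M=\lambda_n^M\varphi_n^M$), and let $\widetilde{\varphi}_n^M=\frac{1}{\lambda_n^M}\mathcal{K}\varphi_n^M$ be the associated iterated modified Galerkin eigenvector. Then, for sufficiently large $n$, $$\|\varphi_n^M-E\varphi_n^M\|_\infty=\begin{cases}O(h^{2r+3}) & \text{for } r\ge1,\\ O(h^3) & \text{for } r=0,\end{cases}\qquad \|\widetilde{\varphi}_n^M-E\widetilde{\varphi}_n^M\|_\infty=\begin{cases}O(h^{2r+5}) & \text{for } r\ge1,\\ O(h^4) & \text{for } r=0,\end{cases}$$ and $$|\lambda-\lambda_n^M|=\begin{cases}O(h^{2r+5}) & \text{for } r\ge1,\\ O(h^4) & \text{for } r=0.\end{cases}$$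
   Context: Green's kernel (for an integer $r\ge 0$): let $\Omega_1=\{(s,t):0\le t\le s\le 1\}$ and $\Omega_2=\{(s,t):0\le s\le t\le 1\}$. A real-valued continuous function $\kappa$ on $[0,1]^2$ is a Green's kernel if $\kappa=\kappa_1$ on $\Omega_1$ and $\kappa=\kappa_2$ on $\Omega_2$, with $\kappa_1(s,s)=\kappa_2(s,s)$ for all $s\in[0,1]$, $\kappa_i\in C^\alpha(\Omega_i)$, $\alpha>r$, and with $\alpha$ large enough that all partial derivatives $\partial^{j+k}\kappa_i/\partial s^j\partial t^k$, $0\le j,k\le 2r+2$, exist, are continuous and bounded on $\Omega_i$ ($i=1,2$). Operator: $(\mathcal{K}x)(s)=\int_0^1\kappa(s,t)x(t)\,dt$, $s\in[0,1]$, a compact operator; for comparison with its discretizations all operators may be regarded as acting on (complex-valued) $L^\infty[0,1]$. Spectral projections: $\Gamma$ is a simple closed rectifiable positively oriented curve in the resolvent set of $\mathcal{K}$ separating $\lambda$ from the rest of the spectrum (including $0$), and $E=-\frac{1}{2\pi i}\int_\Gamma(\mathcal{K}-zI)^{-1}dz$; $\lambda$ is simple if its range $\mathcal{R}(E)$ has dimension one (algebraic multiplicity one). For $n$ large, $\Gamma$ lies in the resolvent set of $\mathcal{K}_n^M$, $E_n^M=-\frac{1}{2\pi i}\int_\Gamma(\mathcal{K}_n^M-zI)^{-1}dz$ has rank one, and $\mathcal{K}_n^M$ has exactly one eigenvalue (which is simple) inside $\Gamma$. Approximating space: for $n\ge1$ let $h=1/n$, $t_j=j/n$, $\Delta_j=[t_{j-1},t_j]$.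 $\mathcal{X}_n$ is the space of $x\in L^\infty[0,1]$ whose restriction to each $\Delta_j$, $j=1,\dots,n$, is a polynomial of degree at most $2r$ (no continuity imposed at the partition points). $P_n$ is the restriction to $L^\infty[0,1]$ of the $L^2[0,1]$-orthogonal projection onto $\mathcal{X}_n$. $\|\cdot\|_\infty$ is the (essential) supremum norm on $[0,1]$. Constants in $O(\cdot)$ are independent of $n$. *)

theory Defs
  imports "HOL-Complex_Analysis.Complex_Analysis" "HOL-Probability.Essential_Supremum"
    "HOL-Library.Landau_Symbols"
begin

section \<open>The complex Banach space of essentially bounded functions on [0,1]\<close>

abbreviation unit_lebesgue :: "real measure" where
  "unit_lebesgue \<equiv> lebesgue_on {0..1}"

definition ess_bounded :: "(real \<Rightarrow> complex) \<Rightarrow> bool" where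
  "ess_bounded f \<longleftrightarrow> f \<in> borel_measurable unit_lebesgue \<and>
     (\<exists>C. AE t in unit_lebesgue. norm (f t) \<le> C)"

definition linf_rel :: "(real \<Rightarrow> complex) \<Rightarrow> (real \<Rightarrow> complex) \<Rightarrow> bool" where
  "linf_rel f g \<longleftrightarrow> ess_bounded f \<and> ess_bounded g \<and> (AE t in unit_lebesgue. f t = g t)"

lemma part_equivp_linf_rel: "part_equivp linf_rel"
proof (rule part_equivpI)
  show "\<exists>f. linf_rel f f"
    by (rule exI[of _ "\<lambda>_. 0"]) (auto simp: linf_rel_def ess_bounded_def intro!: exI[of _ 0])
  show "symp linf_rel"
    unfolding linf_rel_def by (rule sympI) (auto elim: eventually_mono)
  show "transp linf_rel"
    unfolding linf_rel_def by (rule transpI) (auto elim: eventually_elim2)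
qed

quotient_type linf = "real \<Rightarrow> complex" / partial: linf_rel
  by (rule part_equivp_linf_rel)

definition linf_norm :: "(real \<Rightarrow> complex) \<Rightarrow> real" where
  "linf_norm f = real_of_ereal (esssup unit_lebesgue (\<lambda>t. ereal (norm (f t))))"

lemma unit_lebesgue_nontrivial: "ae_filter unit_lebesgue \<noteq> bot"
  by (simp add: ae_filter_eq_bot_iff emeasure_restrict_space)

lemma esssup_linf_norm:
  assumes "ess_bounded f"
  shows "esssup unit_lebesgue (\<lambda>t. ereal (norm (f t))) = ereal (linf_norm f)"
    and "0 \<le> linf_norm f"
proof -
  let ?e = "esssup unit_lebesgue (\<lambda>t. ereal (norm (f t)))"
  from assms obtain C where C: "AE t in unit_lebesgue. norm (f t) \<le> C"
    and [measurable]: "f \<in> borel_measurable unit_lebesgue"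
    by (auto simp: ess_bounded_def)
  have "?e \<le> ereal C"
    using C by (intro esssup_I) auto
  moreover have "esssup unit_lebesgue (\<lambda>t. 0::ereal) \<le> ?e"
    by (rule esssup_mono) auto
  hence "0 \<le> ?e"
    using unit_lebesgue_nontrivial
    by (subst (asm) esssup_const) (auto simp: ae_filter_eq_bot_iff)
  ultimately show "?e = ereal (linf_norm f)" "0 \<le> linf_norm f"
    unfolding linf_norm_def by (cases ?e; auto)+
qed

lemma linf_norm_AE:
  assumes "ess_bounded f"
  shows "AE t in unit_lebesgue. norm (f t) \<le> linf_norm f"
  using esssup_AE[of "\<lambda>t. ereal (norm (f t))" unit_lebesgue] esssup_linf_norm(1)[OF assms] by simp

lemma linf_norm_le:
  assumes "ess_bounded f" "AE t in unit_lebesgue. norm (f t) \<le> C"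
  shows "linf_norm f \<le> C"
proof -
  have "esssup unit_lebesgue (\<lambda>t. ereal (norm (f t))) \<le> ereal C"
    using assms by (intro esssup_I) (auto simp: ess_bounded_def)
  thus ?thesis using esssup_linf_norm(1)[OF assms(1)] by simp
qed

lemma ess_bounded_zero: "ess_bounded (\<lambda>_. 0)"
  by (auto simp: ess_bounded_def intro!: exI[of _ 0])

lemma ess_bounded_add:
  assumes "ess_bounded f" "ess_bounded g"
  shows "ess_bounded (\<lambda>t. f t + g t)"
proof -
  have "AE t in unit_lebesgue. norm (f t + g t) \<le> linf_norm f + linf_norm g"
    using linf_norm_AE[OF assms(1)] linf_norm_AE[OF assms(2)]
    by eventually_elim (meson add_mono norm_triangle_le)
  thus ?thesis using assms by (auto simp: ess_bounded_def)
qed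

lemma ess_bounded_cmult:
  assumes "ess_bounded f"
  shows "ess_bounded (\<lambda>t. c * f t)"
proof -
  have "AE t in unit_lebesgue. norm (c * f t) \<le> norm c * linf_norm f"
    using linf_norm_AE[OF assms] by eventually_elim (simp add: norm_mult mult_left_mono)
  thus ?thesis using assms by (auto simp: ess_bounded_def)
qed

lemma ess_bounded_uminus: "ess_bounded f \<Longrightarrow> ess_bounded (\<lambda>t. - f t)"
  using ess_bounded_cmult[of f "-1"] by simp

lemma ess_bounded_diff: "ess_bounded f \<Longrightarrow> ess_bounded g \<Longrightarrow> ess_bounded (\<lambda>t. f t - g t)"
  using ess_bounded_add[of f "\<lambda>t. - g t"] ess_bounded_uminus[of g] by simp

lift_definition cscale :: "complex \<Rightarrow> linf \<Rightarrow> linf" is "\<lambda>c f t. c * f t"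
  by (auto simp: linf_rel_def ess_bounded_cmult)

instantiation linf :: real_normed_vector
begin

lift_definition zero_linf :: linf is "\<lambda>_. 0"
  by (simp add: linf_rel_def ess_bounded_zero)

lift_definition plus_linf :: "linf \<Rightarrow> linf \<Rightarrow> linf" is "\<lambda>f g t. f t + g t"
  by (auto simp: linf_rel_def ess_bounded_add elim!: eventually_elim2)

lift_definition minus_linf :: "linf \<Rightarrow> linf \<Rightarrow> linf" is "\<lambda>f g t. f t - g t"
  by (auto simp: linf_rel_def ess_bounded_diff elim!: eventually_elim2)

lift_definition uminus_linf :: "linf \<Rightarrow> linf" is "\<lambda>f t. - f t"
  by (auto simp: linf_rel_def ess_bounded_uminus)

definition scaleR_linf :: "real \<Rightarrow> linf \<Rightarrow> linf" where
  "scaleR_linf a = cscale (complex_of_real a)"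

lift_definition norm_linf :: "linf \<Rightarrow> real" is linf_norm
proof -
  fix f g assume *: "linf_rel f g"
  hence "esssup unit_lebesgue (\<lambda>t. ereal (norm (f t))) = esssup unit_lebesgue (\<lambda>t. ereal (norm (g t)))"
    by (intro esssup_AE_cong) (auto simp: linf_rel_def ess_bounded_def)
  thus "linf_norm f = linf_norm g" by (simp add: linf_norm_def)
qed

definition dist_linf :: "linf \<Rightarrow> linf \<Rightarrow> real" where
  "dist_linf x y = norm (x - y)"

definition sgn_linf :: "linf \<Rightarrow> linf" where
  "sgn_linf x = cscale (complex_of_real (inverse (norm x))) x"

definition uniformity_linf :: "(linf \<times> linf) filter" where
  "uniformity_linf = (INF e\<in>{0<..}. principal {(x, y). dist x y < e})"

definition open_linf :: "linf set \<Rightarrow> bool" where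
  "open_linf U \<longleftrightarrow> (\<forall>x\<in>U. eventually (\<lambda>(x', y). x' = x \<longrightarrow> y \<in> U) uniformity)"

lemma linf_norm_cmult:
  assumes "ess_bounded f"
  shows "linf_norm (\<lambda>t. c * f t) = norm c * linf_norm f"
proof (rule antisym)
  show "linf_norm (\<lambda>t. c * f t) \<le> norm c * linf_norm f"
    by (rule linf_norm_le[OF ess_bounded_cmult[OF assms]])
      (use linf_norm_AE[OF assms] in eventually_elim, simp add: norm_mult mult_left_mono)
  show "norm c * linf_norm f \<le> linf_norm (\<lambda>t. c * f t)"
  proof (cases "c = 0")
    case True
    thus ?thesis using esssup_linf_norm(2)[OF ess_bounded_zero] by simp
  next
    case False
    have "linf_norm f \<le> linf_norm (\<lambda>t. c * f t) / norm c"
      by (rule linf_norm_le[OF assms])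
        (use linf_norm_AE[OF ess_bounded_cmult[OF assms, of c]] in eventually_elim,
          use False in \<open>simp add: norm_mult field_simps\<close>)
    thus ?thesis using False by (simp add: field_simps)
  qed
qed

lemma norm_cscale: "norm (cscale c x) = norm c * norm x"
  by transfer (simp add: linf_norm_cmult linf_rel_def)

instance
proof
  fix x y z :: linf and a b :: real
  show "x + y + z = x + (y + z)"
    by transfer (simp add: linf_rel_def ess_bounded_add algebra_simps)
  show "x + y = y + x"
    by transfer (simp add: linf_rel_def ess_bounded_add algebra_simps)
  show "0 + x = x" by transfer (simp add: linf_rel_def)
  show "- x + x = 0" by transfer (simp add: linf_rel_def ess_bounded_zero)
  show "x - y = x + - y"
    by transfer (simp add: linf_rel_def ess_bounded_add ess_bounded_diff ess_bounded_uminus)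
  show "a *\<^sub>R (x + y) = a *\<^sub>R x + a *\<^sub>R y" unfolding scaleR_linf_def
    by transfer (simp add: linf_rel_def ess_bounded_add ess_bounded_cmult ring_distribs)
  show "(a + b) *\<^sub>R x = a *\<^sub>R x + b *\<^sub>R x" unfolding scaleR_linf_def
    by transfer (simp add: linf_rel_def ess_bounded_add ess_bounded_cmult ring_distribs)
  show "a *\<^sub>R b *\<^sub>R x = (a * b) *\<^sub>R x" unfolding scaleR_linf_def
    by transfer (simp add: linf_rel_def ess_bounded_cmult mult.assoc)
  show "1 *\<^sub>R x = x" unfolding scaleR_linf_def by transfer (simp add: linf_rel_def)
  show "dist x y = norm (x - y)" by (rule dist_linf_def)
  show "sgn x = inverse (norm x) *\<^sub>R x" by (simp add: sgn_linf_def scaleR_linf_def)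
  show "(uniformity :: (linf \<times> linf) filter) = (INF e\<in>{0<..}. principal {(x, y). dist x y < e})"
    by (rule uniformity_linf_def)
  show "open U \<longleftrightarrow> (\<forall>x\<in>U. eventually (\<lambda>(x', y). x' = x \<longrightarrow> y \<in> U) uniformity)" for U :: "linf set"
    by (rule open_linf_def)
  show "norm x = 0 \<longleftrightarrow> x = 0"
  proof transfer
    fix f assume "linf_rel f f"
    hence f: "ess_bounded f" by (simp add: linf_rel_def)
    have "linf_norm f = 0 \<longleftrightarrow> (AE t in unit_lebesgue. f t = 0)"
    proof
      assume "linf_norm f = 0"
      with linf_norm_AE[OF f] show "AE t in unit_lebesgue. f t = 0" by simp
    next
      assume "AE t in unit_lebesgue. f t = 0"
      hence "linf_norm f \<le> 0"
        by (intro linf_norm_le f) (auto elim: eventually_mono)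
      thus "linf_norm f = 0" using esssup_linf_norm(2)[OF f] by simp
    qed
    thus "(linf_norm f = 0) = linf_rel f (\<lambda>_. 0)"
      by (simp add: linf_rel_def f ess_bounded_zero)
  qed
  show "norm (x + y) \<le> norm x + norm y"
  proof transfer
    fix f g assume "linf_rel f f" "linf_rel g g"
    hence fg: "ess_bounded f" "ess_bounded g" by (simp_all add: linf_rel_def)
    show "linf_norm (\<lambda>t. f t + g t) \<le> linf_norm f + linf_norm g"
      by (rule linf_norm_le[OF ess_bounded_add[OF fg]])
        (use linf_norm_AE[OF fg(1)] linf_norm_AE[OF fg(2)] in eventually_elim,
          meson add_mono norm_triangle_le)
  qed
  show "norm (a *\<^sub>R x) = \<bar>a\<bar> * norm x"
    by (simp add: scaleR_linf_def norm_cscale)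
qed

end

global_interpretation linf: vector_space cscale
proof
  fix a b :: complex and x y :: linf
  show "cscale a (x + y) = cscale a x + cscale a y"
    by transfer (simp add: linf_rel_def ess_bounded_add ess_bounded_cmult ring_distribs)
  show "cscale (a + b) x = cscale a x + cscale b x"
    by transfer (simp add: linf_rel_def ess_bounded_add ess_bounded_cmult ring_distribs)
  show "cscale a (cscale b x) = cscale (a * b) x"
    by transfer (simp add: linf_rel_def ess_bounded_cmult mult.assoc)
  show "cscale 1 x = x" by transfer (simp add: linf_rel_def)
qed

lemma bounded_linear_cscale: "bounded_linear (cscale c)"
proof (rule bounded_linear_intro)
  show "cscale c (x + y) = cscale c x + cscale c y" for x y
    by (rule linf.scale_right_distrib)
  show "cscale c (a *\<^sub>R x) = a *\<^sub>R cscale c x" for a x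
    by (simp add: scaleR_linf_def mult.commute)
  show "norm (cscale c x) \<le> norm x * norm c" for x
    by (simp add: norm_cscale)
qed

lift_definition cmul :: "complex \<Rightarrow> linf \<Rightarrow>\<^sub>L linf" is cscale
  by (rule bounded_linear_cscale)


section \<open>Spectral theory\<close>

text \<open>
  The library has bounded operators over the reals only. All operators considered below are
  complex linear, and the inverse of a complex linear map is again complex linear, so nothing is
  lost by looking for the resolvent among the real-linear bounded operators.
\<close>

definition is_inverse_op :: "linf \<Rightarrow>\<^sub>L linf \<Rightarrow> linf \<Rightarrow>\<^sub>L linf \<Rightarrow> bool" where
  "is_inverse_op T S \<longleftrightarrow> T o\<^sub>L S = id_blinfun \<and> S o\<^sub>L T = id_blinfun"

definition resolvent_set :: "linf \<Rightarrow>\<^sub>L linf \<Rightarrow> complex set" where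
  "resolvent_set T = {z. \<exists>S. is_inverse_op (T - cmul z) S}"

definition resolvent :: "linf \<Rightarrow>\<^sub>L linf \<Rightarrow> complex \<Rightarrow> linf \<Rightarrow>\<^sub>L linf" where
  "resolvent T z = (THE S. is_inverse_op (T - cmul z) S)"

definition spectrum :: "linf \<Rightarrow>\<^sub>L linf \<Rightarrow> complex set" where
  "spectrum T = - resolvent_set T"

definition is_eigenvalue :: "linf \<Rightarrow>\<^sub>L linf \<Rightarrow> complex \<Rightarrow> bool" where
  "is_eigenvalue T z \<longleftrightarrow> (\<exists>x. x \<noteq> 0 \<and> blinfun_apply T x = cscale z x)"

definition rectifiable_path :: "(real \<Rightarrow> complex) \<Rightarrow> bool" where
  "rectifiable_path \<gamma> \<longleftrightarrow> path \<gamma> \<and>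
     (\<exists>B. \<forall>d. d division_of {0..1} \<longrightarrow> (\<Sum>k\<in>d. norm (\<gamma> (Sup k) - \<gamma> (Inf k))) \<le> B)"

text \<open>
  A rectifiable path need not be piecewise differentiable, so the integral of an operator-valued
  function along it is the limit of its Riemann--Stieltjes sums (in operator norm), as the mesh
  of the partition tends to 0.
\<close>

definition has_op_path_integral ::
    "(complex \<Rightarrow> linf \<Rightarrow>\<^sub>L linf) \<Rightarrow> linf \<Rightarrow>\<^sub>L linf \<Rightarrow> (real \<Rightarrow> complex) \<Rightarrow> bool" where
  "has_op_path_integral F I \<gamma> \<longleftrightarrow>
     (\<forall>\<epsilon>>0. \<exists>\<delta>>0. \<forall>p. p tagged_division_of {0..1} \<and> (\<forall>(x, k)\<in>p. diameter k < \<delta>) \<longrightarrow>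
        norm ((\<Sum>(x, k)\<in>p. cmul (\<gamma> (Sup k) - \<gamma> (Inf k)) o\<^sub>L F (\<gamma> x)) - I) < \<epsilon>)"

definition op_path_integral ::
    "(real \<Rightarrow> complex) \<Rightarrow> (complex \<Rightarrow> linf \<Rightarrow>\<^sub>L linf) \<Rightarrow> linf \<Rightarrow>\<^sub>L linf" where
  "op_path_integral \<gamma> F = (THE I. has_op_path_integral F I \<gamma>)"

definition spectral_projection :: "linf \<Rightarrow>\<^sub>L linf \<Rightarrow> (real \<Rightarrow> complex) \<Rightarrow> linf \<Rightarrow>\<^sub>L linf" where
  "spectral_projection T \<gamma> =
     cmul (- 1 / (2 * complex_of_real pi * \<i>)) o\<^sub>L op_path_integral \<gamma> (resolvent T)"

definition positively_oriented_jordan_curve :: "(real \<Rightarrow> complex) \<Rightarrow> bool" where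
  "positively_oriented_jordan_curve \<gamma> \<longleftrightarrow>
     simple_path \<gamma> \<and> pathfinish \<gamma> = pathstart \<gamma> \<and>
     (\<forall>z\<in>inside (path_image \<gamma>). winding_number \<gamma> z = 1)"

definition separates_spectrum :: "(real \<Rightarrow> complex) \<Rightarrow> linf \<Rightarrow>\<^sub>L linf \<Rightarrow> complex \<Rightarrow> bool" where
  "separates_spectrum \<gamma> T z \<longleftrightarrow>
     path_image \<gamma> \<subseteq> resolvent_set T \<and> z \<in> inside (path_image \<gamma>) \<and>
     insert 0 (spectrum T) - {z} \<subseteq> outside (path_image \<gamma>)"


section \<open>Green's kernels\<close>

text \<open>
  Partial derivatives up to the boundary of a closed region: \<open>D j k\<close> is the mixed derivative of
  order \<open>j\<close> in the first and \<open>k\<close> in the second variable, taken in the interior and extended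
  continuously to the whole region. This is needed at the corners (0,0) and (1,1) of the triangles,
  where one of the two coordinate slices is a single point. By Schwarz's theorem the order of
  differentiation does not matter.
\<close>

definition has_continuous_partials ::
    "(nat \<times> nat) set \<Rightarrow> (real \<times> real) set \<Rightarrow> (real \<times> real \<Rightarrow> real) \<Rightarrow> bool" where
  "has_continuous_partials J \<Omega> f \<longleftrightarrow>
     (\<exists>D :: nat \<Rightarrow> nat \<Rightarrow> real \<times> real \<Rightarrow> real.
        (\<forall>x\<in>\<Omega>. D 0 0 x = f x) \<and>
        (\<forall>(j, k)\<in>J. continuous_on \<Omega> (D j k) \<and> bounded (D j k ` \<Omega>)) \<and>
        (\<forall>j k s t. (s, t) \<in> interior \<Omega> \<longrightarrow>
           ((Suc j, k) \<in> J \<longrightarrow>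
              ((\<lambda>u. D j k (u, t)) has_real_derivative D (Suc j) k (s, t)) (at s)) \<and>
           ((j, Suc k) \<in> J \<longrightarrow>
              ((\<lambda>u. D j k (s, u)) has_real_derivative D j (Suc k) (s, t)) (at t))))"

definition C_class :: "nat \<Rightarrow> (real \<times> real) set \<Rightarrow> (real \<times> real \<Rightarrow> real) \<Rightarrow> bool" where
  "C_class \<alpha> = has_continuous_partials {(j, k). j + k \<le> \<alpha>}"

definition lower_triangle :: "(real \<times> real) set" where
  "lower_triangle = {(s, t). 0 \<le> t \<and> t \<le> s \<and> s \<le> 1}"

definition upper_triangle :: "(real \<times> real) set" where
  "upper_triangle = {(s, t). 0 \<le> s \<and> s \<le> t \<and> t \<le> 1}"

definition green_kernel :: "nat \<Rightarrow> (real \<times> real \<Rightarrow> real) \<Rightarrow> bool" where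
  "green_kernel r \<kappa> \<longleftrightarrow>
     continuous_on ({0..1} \<times> {0..1}) \<kappa> \<and>
     (\<exists>\<kappa>\<^sub>1 \<kappa>\<^sub>2.
        (\<forall>x\<in>lower_triangle. \<kappa> x = \<kappa>\<^sub>1 x) \<and> (\<forall>x\<in>upper_triangle. \<kappa> x = \<kappa>\<^sub>2 x) \<and>
        (\<forall>s\<in>{0..1}. \<kappa>\<^sub>1 (s, s) = \<kappa>\<^sub>2 (s, s)) \<and>
        (\<exists>\<alpha>>r. C_class \<alpha> lower_triangle \<kappa>\<^sub>1 \<and> C_class \<alpha> upper_triangle \<kappa>\<^sub>2) \<and>
        has_continuous_partials ({0..2*r+2} \<times> {0..2*r+2}) lower_triangle \<kappa>\<^sub>1 \<and>
        has_continuous_partials ({0..2*r+2} \<times> {0..2*r+2}) upper_triangle \<kappa>\<^sub>2)"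

definition integral_operator :: "(real \<times> real \<Rightarrow> real) \<Rightarrow> linf \<Rightarrow>\<^sub>L linf" where
  "integral_operator \<kappa> = Blinfun (\<lambda>x. abs_linf
     (\<lambda>s. LINT t|unit_lebesgue. complex_of_real (\<kappa> (s, t)) * rep_linf x t))"

lemma finite_measure_unit_lebesgue: "finite_measure unit_lebesgue"
  by (rule finite_measureI) (simp add: emeasure_restrict_space)

lemma rep_linf_ess_bounded: "ess_bounded (rep_linf x)"
  using Quotient_rep_reflp[OF Quotient_linf, of x] by (simp add: linf_rel_def)

lemma linf_norm_rep_linf: "linf_norm (rep_linf x) = norm x"
  by (simp add: norm_linf.rep_eq)

lemma rep_abs_linf:
  assumes "ess_bounded f"
  shows "linf_rel (rep_linf (abs_linf f)) f"
  using Quotient_rep_abs[OF Quotient_linf, of f] assms by (simp add: linf_rel_def)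

lemma ess_bounded_integrable:
  assumes "ess_bounded f"
  shows "integrable unit_lebesgue f"
  using finite_measure.integrable_const_bound[OF finite_measure_unit_lebesgue] assms
  by (auto simp: ess_bounded_def)

lemma norm_integral_le:
  assumes "ess_bounded f" "\<And>t. t \<in> {0..1} \<Longrightarrow> norm (k t) \<le> B" "k \<in> borel_measurable unit_lebesgue"
  shows "ess_bounded (\<lambda>t. k t * f t)" "norm (LINT t|unit_lebesgue. k t * f t) \<le> B * linf_norm f"
proof -
  have B: "0 \<le> B" using order_trans[OF norm_ge_zero assms(2)[of 0]] by simp
  have "AE t in unit_lebesgue. t \<in> space unit_lebesgue" by (rule AE_space)
  with linf_norm_AE[OF assms(1)]
  have *: "AE t in unit_lebesgue. norm (k t * f t) \<le> B * linf_norm f"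
    by eventually_elim (use assms(2) B in \<open>auto simp: norm_mult intro!: mult_mono\<close>)
  thus b: "ess_bounded (\<lambda>t. k t * f t)"
    using assms(1,3) by (auto simp: ess_bounded_def)
  have "norm (LINT t|unit_lebesgue. k t * f t) \<le> (LINT t|unit_lebesgue. norm (k t * f t))"
    by (rule integral_norm_bound)
  also have "\<dots> \<le> (LINT t|unit_lebesgue. B * linf_norm f)"
    by (rule integral_mono_AE[OF integrable_norm[OF ess_bounded_integrable[OF b]]
        finite_measure.integrable_const[OF finite_measure_unit_lebesgue] *])
  finally show "norm (LINT t|unit_lebesgue. k t * f t) \<le> B * linf_norm f"
    by (simp add: measure_restrict_space)
qed

lemma integral_operator_apply:
  assumes "continuous_on ({0..1} \<times> {0..1}) \<kappa>"
  shows "blinfun_apply (integral_operator \<kappa>) x =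
           abs_linf (\<lambda>s. LINT t|unit_lebesgue. complex_of_real (\<kappa> (s, t)) * rep_linf x t)"
proof -
  define G where "G f s = (LINT t|unit_lebesgue. complex_of_real (\<kappa> (s, t)) * f t)" for f s
  have "compact (\<kappa> ` ({0..1} \<times> {0..1}))"
    by (intro compact_continuous_image assms compact_Times) auto
  then obtain B where B: "\<And>s t. s \<in> {0..1} \<Longrightarrow> t \<in> {0..1} \<Longrightarrow> \<bar>\<kappa> (s, t)\<bar> \<le> B"
    by (fastforce dest!: compact_imp_bounded simp: bounded_iff)
  have uc: "uniformly_continuous_on ({0..1} \<times> {0..1}) \<kappa>"
    by (intro compact_uniformly_continuous assms compact_Times) auto
  have meas: "(\<lambda>t. complex_of_real (\<kappa> (s, t))) \<in> borel_measurable unit_lebesgue" if "s \<in> {0..1}" for s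
  proof -
    have "continuous_on {0..1} (\<lambda>t. complex_of_real (\<kappa> (s, t)))"
      by (intro continuous_on_of_real continuous_on_compose2[OF assms] continuous_intros)
        (use that in auto)
    thus ?thesis
      by (rule continuous_imp_measurable_on_sets_lebesgue) auto
  qed
  have int: "integrable unit_lebesgue (\<lambda>t. complex_of_real (\<kappa> (s, t)) * f t)"
    if "s \<in> {0..1}" "ess_bounded f" for s f
    by (rule ess_bounded_integrable, rule norm_integral_le(1)[where B = B]) (use that meas B in auto)
  have Gle: "norm (G f s) \<le> B * linf_norm f" if "s \<in> {0..1}" "ess_bounded f" for s f
    unfolding G_def by (rule norm_integral_le(2)) (use that meas B in auto)
  have Gcont: "continuous_on {0..1} (G f)" if f: "ess_bounded f" for f
    unfolding continuous_on_iff
  proof (intro ballI allI impI)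
    fix s e :: real assume s: "s \<in> {0..1}" and e: "e > 0"
    define c where "c = e / (linf_norm f + 1)"
    have N: "0 \<le> linf_norm f" by (rule esssup_linf_norm(2)[OF f])
    have c: "c > 0" using e N by (simp add: c_def)
    obtain d where d: "d > 0" "\<And>p q. p \<in> {0..1} \<times> {0..1} \<Longrightarrow> q \<in> {0..1} \<times> {0..1} \<Longrightarrow> dist q p < d
        \<Longrightarrow> dist (\<kappa> q) (\<kappa> p) < c"
      using uc c unfolding uniformly_continuous_on_def by blast
    have "dist (G f s') (G f s) < e" if s': "s' \<in> {0..1}" "dist s' s < d" for s'
    proof -
      have "G f s' - G f s =
          (LINT t|unit_lebesgue. complex_of_real (\<kappa> (s', t) - \<kappa> (s, t)) * f t)"
        unfolding G_def using int[OF s f] int[OF s'(1) f]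
        by (simp add: left_diff_distrib)
      also have "norm \<dots> \<le> c * linf_norm f"
      proof (rule norm_integral_le(2)[OF f])
        show "norm (complex_of_real (\<kappa> (s', t) - \<kappa> (s, t))) \<le> c" if t: "t \<in> {0..1}" for t
        proof -
          have "dist (s', t) (s, t) < d" using s' by (simp add: dist_Pair_Pair)
          hence "dist (\<kappa> (s', t)) (\<kappa> (s, t)) < c" using d(2)[of "(s, t)" "(s', t)"] s s' t by auto
          thus ?thesis
            by (simp only: norm_of_real) (simp add: dist_real_def)
        qed
        show "(\<lambda>t. complex_of_real (\<kappa> (s', t) - \<kappa> (s, t))) \<in> borel_measurable unit_lebesgue"
          using borel_measurable_diff[OF meas[OF s'(1)] meas[OF s]] by simp
      qed
      also have "c * linf_norm f < e"
        using e N by (simp add: c_def field_simps)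
      finally show ?thesis by (simp add: dist_norm)
    qed
    thus "\<exists>d>0. \<forall>s'\<in>{0..1}. dist s' s < d \<longrightarrow> dist (G f s') (G f s) < e"
      using d(1) by blast
  qed
  have AE01: "AE s in unit_lebesgue. s \<in> {0..1}"
    using AE_space[of unit_lebesgue] by simp
  have Geb: "ess_bounded (G f)" if f: "ess_bounded f" for f
    unfolding ess_bounded_def
  proof (intro conjI exI)
    show "G f \<in> borel_measurable unit_lebesgue"
      by (rule continuous_imp_measurable_on_sets_lebesgue[OF Gcont[OF f]]) auto
    show "AE s in unit_lebesgue. norm (G f s) \<le> B * linf_norm f"
      using AE01 by eventually_elim (rule Gle[OF _ f])
  qed
  have G_cong: "G f s = G g s" if "linf_rel f g" "s \<in> {0..1}" for f g s
    unfolding G_def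
  proof (rule integral_cong_AE)
    show "AE t in unit_lebesgue. complex_of_real (\<kappa> (s, t)) * f t = complex_of_real (\<kappa> (s, t)) * g t"
      using that by (auto simp: linf_rel_def elim: eventually_mono)
  qed (use int that in \<open>auto simp: linf_rel_def\<close>)
  have abs_eqI: "abs_linf f = abs_linf g"
    if "ess_bounded f" "ess_bounded g" "\<And>s. s \<in> {0..1} \<Longrightarrow> f s = g s" for f g
  proof (rule Quotient_rel_abs[OF Quotient_linf])
    have "AE s in unit_lebesgue. f s = g s"
      using AE01 by eventually_elim (rule that(3))
    thus "linf_rel f g" using that(1,2) by (simp add: linf_rel_def)
  qed
  have relG: "linf_rel (G (rep_linf x)) (G (rep_linf x))" for x
    by (simp add: linf_rel_def Geb rep_linf_ess_bounded)
  have abs_rep: "abs_linf (rep_linf x) = x" for x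
    by (rule Quotient_abs_rep[OF Quotient_linf])
  have relR: "linf_rel (rep_linf x) (rep_linf x)" for x
    by (rule Quotient_rep_reflp[OF Quotient_linf])
  have "bounded_linear (\<lambda>x. abs_linf (G (rep_linf x)))"
  proof (rule bounded_linear_intro)
    fix x y :: linf and a :: real
    note ex = rep_linf_ess_bounded[of x] and ey = rep_linf_ess_bounded[of y]
    have rel_add: "linf_rel (rep_linf (x + y)) (\<lambda>t. rep_linf x t + rep_linf y t)"
      using rep_abs_linf[OF ess_bounded_add[OF ex ey]] plus_linf.abs_eq[OF relR relR, of x y]
      by (simp add: abs_rep)
    show "abs_linf (G (rep_linf (x + y))) = abs_linf (G (rep_linf x)) + abs_linf (G (rep_linf y))"
    proof -
      have "abs_linf (G (rep_linf (x + y))) = abs_linf (\<lambda>s. G (rep_linf x) s + G (rep_linf y) s)"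
      proof (rule abs_eqI)
        fix s :: real assume s: "s \<in> {0..1}"
        show "G (rep_linf (x + y)) s = G (rep_linf x) s + G (rep_linf y) s"
          using G_cong[OF rel_add s] int[OF s ex] int[OF s ey]
          by (simp add: G_def distrib_left)
      qed (intro Geb ess_bounded_add rep_linf_ess_bounded)+
      also have "\<dots> = abs_linf (G (rep_linf x)) + abs_linf (G (rep_linf y))"
        by (rule plus_linf.abs_eq[OF relG relG, symmetric])
      finally show ?thesis .
    qed
    have rel_scale: "linf_rel (rep_linf (a *\<^sub>R x)) (\<lambda>t. complex_of_real a * rep_linf x t)"
      using rep_abs_linf[OF ess_bounded_cmult[OF ex]] cscale.abs_eq[OF relR, of "complex_of_real a" x]
      by (simp add: scaleR_linf_def abs_rep)
    show "abs_linf (G (rep_linf (a *\<^sub>R x))) = a *\<^sub>R abs_linf (G (rep_linf x))"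
    proof -
      have "abs_linf (G (rep_linf (a *\<^sub>R x))) = abs_linf (\<lambda>s. complex_of_real a * G (rep_linf x) s)"
      proof (rule abs_eqI)
        fix s :: real assume s: "s \<in> {0..1}"
        show "G (rep_linf (a *\<^sub>R x)) s = complex_of_real a * G (rep_linf x) s"
          using G_cong[OF rel_scale s] by (simp add: G_def mult.left_commute)
      qed (intro Geb ess_bounded_cmult rep_linf_ess_bounded)+
      also have "\<dots> = a *\<^sub>R abs_linf (G (rep_linf x))"
        unfolding scaleR_linf_def by (rule cscale.abs_eq[OF relG, symmetric])
      finally show ?thesis .
    qed
    show "norm (abs_linf (G (rep_linf x))) \<le> norm x * B"
    proof -
      have "norm (abs_linf (G (rep_linf x))) = linf_norm (G (rep_linf x))"
        by (rule norm_linf.abs_eq[OF relG])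
      also have "\<dots> \<le> B * linf_norm (rep_linf x)"
        by (rule linf_norm_le[OF Geb[OF ex]]) (use AE01 in eventually_elim, rule Gle[OF _ ex])
      finally show ?thesis by (simp add: linf_norm_rep_linf mult.commute)
    qed
  qed
  from bounded_linear_Blinfun_apply[OF this] show ?thesis
    unfolding integral_operator_def G_def by metis
qed



section \<open>Discretization\<close>

definition piecewise_poly_space :: "nat \<Rightarrow> nat \<Rightarrow> linf set" where
  "piecewise_poly_space r n =
     {x. \<forall>j\<in>{1..n}. \<exists>p :: complex poly. degree p \<le> 2 * r \<and>
        (AE t in lebesgue_on {real (j - 1) / real n .. real j / real n}.
           rep_linf x t = poly p (complex_of_real t))}"

definition l2_inner :: "linf \<Rightarrow> linf \<Rightarrow> complex" where
  "l2_inner x y = (LINT t|unit_lebesgue. rep_linf x t * cnj (rep_linf y t))"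

definition orth_projection :: "nat \<Rightarrow> nat \<Rightarrow> linf \<Rightarrow>\<^sub>L linf" where
  "orth_projection r n = Blinfun (\<lambda>x. THE y. y \<in> piecewise_poly_space r n \<and>
     (\<forall>v\<in>piecewise_poly_space r n. l2_inner (x - y) v = 0))"

definition modified_operator :: "linf \<Rightarrow>\<^sub>L linf \<Rightarrow> linf \<Rightarrow>\<^sub>L linf \<Rightarrow> linf \<Rightarrow>\<^sub>L linf" where
  "modified_operator K P = (P o\<^sub>L K) + (K o\<^sub>L P) - (P o\<^sub>L K o\<^sub>L P)"

end

theory Submission
  imports Defs
begin

text \<open>
  Write \<open>P\<close> for the orthogonal projection, \<open>Q = I - P\<close>, \<open>h = 1/n\<close>, and \<open>z\<close> for the modified Galerkin
  eigenvalue. Since \<open>K - (PK + KP - PKP) = QKQ\<close>, a modified Galerkin eigenvector satisfies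
  \<open>(K - z) \<phi> = QKQ \<phi>\<close>. For \<open>z\<close> inside the curve, the contour integral
  \<open>A = (1 / 2 \<pi> i) \<integral> (w - z)\<^sup>-\<^sup>1 (K - w)\<^sup>-\<^sup>1 dw\<close> is an inverse of \<open>K - z\<close> modulo the spectral projection,
  \<open>A (K - z) = (K - z) A = I - E\<close>, because \<open>(K - z) (K - w)\<^sup>-\<^sup>1 = I + (w - z) (K - w)\<^sup>-\<^sup>1\<close> and the curve
  winds once around \<open>z\<close> (\<open>contour_parametrix\<close>). Therefore \<open>E\<close> commutes with \<open>K\<close> and fixes the
  eigenvector \<open>\<psi>\<close>, its range is spanned by \<open>\<psi>\<close>, and

    \<open>\<phi> - E \<phi> = A QKQ \<phi>\<close>, \<open>\<phi>' - E \<phi>' = (1/z) A K QKQ \<phi>\<close>, \<open>\<lambda> (\<lambda> - z) E \<phi> = E K QKQ \<phi>\<close>,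

  the last one because \<open>(\<lambda> - z) E \<phi> = E QKQ \<phi>\<close> and \<open>E K = \<lambda> E\<close>. The norm of \<open>A\<close> stays bounded: on
  the curve \<open>K - w\<close> is bounded below uniformly, so \<open>QKQ \<longlonglongrightarrow> 0\<close> keeps \<open>z\<close> away from the curve.

  It remains to bound \<open>QKQ \<phi>\<close> and \<open>K QKQ \<phi>\<close>. On each cell \<open>[j/n, (j+1)/n]\<close> the function \<open>w = Q x\<close> is
  orthogonal to the polynomials of degree at most \<open>2r\<close>. In \<open>\<integral> \<kappa>(s,t) w(t) dt\<close> one may thus subtract
  from \<open>\<kappa>(s,\<cdot>)\<close> any such polynomial on each cell. This gains \<open>h\<^sup>2\<^sup>r\<^sup>+\<^sup>1\<close> on cells not containing \<open>s\<close>,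
  where the kernel is smooth, but only \<open>h\<close> on the one cell that contains \<open>s\<close>, which itself has
  length \<open>h\<close>; so \<open>K w = O((h\<^sup>2\<^sup>r\<^sup>+\<^sup>1 + h\<^sup>2) \<parallel>w\<parallel>)\<close>. The term \<open>h\<^sup>2\<^sup>r\<^sup>+\<^sup>1\<close> dominates for \<open>r = 0\<close>, which is why
  that case is different. In the same way the oscillation of \<open>K w\<close> over one cell is \<open>O(h\<^sup>2 \<parallel>w\<parallel>)\<close>,
  and hence so is \<open>Q K w\<close> (\<open>integral_operator_estimates\<close>).

  Finally, \<open>\<phi> = E \<phi> + (\<phi> - E \<phi>)\<close>. The first summand is a multiple of \<open>\<psi>\<close>, which is smooth because
  the equation \<open>\<lambda> \<psi> = K \<psi>\<close> can be bootstrapped, so \<open>Q \<psi> = O(h\<^sup>2\<^sup>r\<^sup>+\<^sup>1)\<close> (\<open>eigenvector_approx\<close>). The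
  second one has no smoothness, but \<open>QKQ = O(h\<^sup>2)\<close> in operator norm, so its contribution is absorbed
  into the left-hand side (\<open>rank_one_spectral_error\<close>).
\<close>

section \<open>Essentially bounded functions form a Banach space\<close>

lemma abs_rep_linf: "abs_linf (rep_linf x) = x"
  by (rule Quotient_abs_rep[OF Quotient_linf])

lemma rep_abs_AE:
  assumes "ess_bounded f"
  shows "AE t in unit_lebesgue. rep_linf (abs_linf f) t = f t"
  using rep_abs_linf[OF assms] by (simp add: linf_rel_def)

lemma linf_rel_refl: "ess_bounded f \<Longrightarrow> linf_rel f f"
  by (simp add: linf_rel_def)

lemma abs_linf_cong_AE:
  assumes "ess_bounded f" "ess_bounded g" "AE t in unit_lebesgue. f t = g t"
  shows "abs_linf f = abs_linf g"
  by (rule Quotient_rel_abs[OF Quotient_linf]) (use assms in \<open>simp add: linf_rel_def\<close>)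

lemma abs_linf_add:
  "ess_bounded f \<Longrightarrow> ess_bounded g \<Longrightarrow> abs_linf (\<lambda>t. f t + g t) = abs_linf f + abs_linf g"
  by (rule plus_linf.abs_eq[symmetric]; rule linf_rel_refl)

lemma abs_linf_diff:
  "ess_bounded f \<Longrightarrow> ess_bounded g \<Longrightarrow> abs_linf (\<lambda>t. f t - g t) = abs_linf f - abs_linf g"
  by (rule minus_linf.abs_eq[symmetric]; rule linf_rel_refl)

lemma abs_linf_cmult:
  "ess_bounded f \<Longrightarrow> abs_linf (\<lambda>t. c * f t) = cscale c (abs_linf f)"
  by (rule cscale.abs_eq[symmetric]; rule linf_rel_refl)

lemma rep_add_AE: "AE t in unit_lebesgue. rep_linf (x + y) t = rep_linf x t + rep_linf y t"
  using rep_abs_AE[OF ess_bounded_add[OF rep_linf_ess_bounded rep_linf_ess_bounded], of x y]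
  by (simp add: abs_linf_add rep_linf_ess_bounded abs_rep_linf)

lemma rep_diff_AE: "AE t in unit_lebesgue. rep_linf (x - y) t = rep_linf x t - rep_linf y t"
  using rep_abs_AE[OF ess_bounded_diff[OF rep_linf_ess_bounded rep_linf_ess_bounded], of x y]
  by (simp add: abs_linf_diff rep_linf_ess_bounded abs_rep_linf)

lemma rep_cscale_AE: "AE t in unit_lebesgue. rep_linf (cscale c x) t = c * rep_linf x t"
  using rep_abs_AE[OF ess_bounded_cmult[OF rep_linf_ess_bounded], of c x]
  by (simp add: abs_linf_cmult rep_linf_ess_bounded abs_rep_linf)

lemma rep_norm_AE: "AE t in unit_lebesgue. norm (rep_linf x t) \<le> norm x"
  using linf_norm_AE[OF rep_linf_ess_bounded, of x] by (simp add: linf_norm_rep_linf)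

lemma norm_linf_leI:
  assumes "AE t in unit_lebesgue. norm (rep_linf x t) \<le> C"
  shows "norm x \<le> C"
  using linf_norm_le[OF rep_linf_ess_bounded assms] by (simp add: linf_norm_rep_linf)

lemma norm_abs_linf_leI:
  assumes "ess_bounded f" "AE t in unit_lebesgue. norm (f t) \<le> C"
  shows "norm (abs_linf f) \<le> C"
  by (rule norm_linf_leI) (use rep_abs_AE[OF assms(1)] assms(2) in eventually_elim, simp)

lemma AE_unit_mem: "AE t in unit_lebesgue. t \<in> {0..1}"
  using AE_space[of unit_lebesgue] by simp

lemma scaleR_eq_cscale: "a *\<^sub>R x = cscale (complex_of_real a) x"
  by (simp add: scaleR_linf_def)

text \<open>
  The bounds in \<open>L\<^sup>\<infinity>\<close> hold outside a null set for each pair of members of the sequence, hence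
  simultaneously for all pairs outside a single null set. Off that set the representatives form a
  Cauchy sequence of complex numbers, and their pointwise limit represents the limit.
\<close>
instance linf :: banach
proof
  fix X :: "nat \<Rightarrow> linf"
  assume X: "Cauchy X"
  define f where "f n = rep_linf (X n)" for n
  have fm: "f n \<in> borel_measurable unit_lebesgue" for n
    using rep_linf_ess_bounded[of "X n"] by (simp add: ess_bounded_def f_def)
  have d: "AE t in unit_lebesgue. \<forall>m n. norm (f m t - f n t) \<le> norm (X m - X n)"
    unfolding AE_all_countable
  proof (intro allI)
    fix m n
    show "AE t in unit_lebesgue. norm (f m t - f n t) \<le> norm (X m - X n)"
      using rep_diff_AE[of "X m" "X n"] rep_norm_AE[of "X m - X n"]
      by eventually_elim (simp add: f_def)
  qed
  define g where "g t = lim (\<lambda>n. f n t)" for t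
  have gm: "g \<in> borel_measurable unit_lebesgue"
    unfolding g_def by (rule borel_measurable_lim_metric) (rule fm)
  have conv: "AE t in unit_lebesgue. (\<lambda>n. f n t) \<longlonglongrightarrow> g t"
    using d
  proof eventually_elim
    case (elim t)
    have "Cauchy (\<lambda>n. f n t)"
    proof (rule CauchyI)
      fix e :: real assume "0 < e"
      then obtain M where M: "\<And>m n. m \<ge> M \<Longrightarrow> n \<ge> M \<Longrightarrow> norm (X m - X n) < e"
        using CauchyD[OF X] by blast
      show "\<exists>M. \<forall>m\<ge>M. \<forall>n\<ge>M. norm (f m t - f n t) < e"
        using elim M by (meson order.strict_trans1)
    qed
    thus ?case unfolding g_def using Cauchy_convergent_iff convergent_LIMSEQ_iff by blast
  qed
  obtain B where B: "\<And>n. norm (X n) \<le> B"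
    using Cauchy_Bseq[OF X] by (auto simp: Bseq_def)
  have bd: "AE t in unit_lebesgue. \<forall>n. norm (f n t) \<le> B"
    unfolding AE_all_countable
  proof
    fix n show "AE t in unit_lebesgue. norm (f n t) \<le> B"
      using rep_norm_AE[of "X n"] by eventually_elim (use B[of n] in \<open>simp add: f_def\<close>)
  qed
  have gb: "ess_bounded g"
    unfolding ess_bounded_def
  proof (intro conjI exI gm)
    show "AE t in unit_lebesgue. norm (g t) \<le> B"
      using conv bd
    proof eventually_elim
      case (elim t)
      show ?case by (rule Lim_bounded[OF tendsto_norm[OF elim(1)], of 0]) (use elim in auto)
    qed
  qed
  have "X \<longlonglongrightarrow> abs_linf g"
  proof (rule LIMSEQ_I)
    fix e :: real assume e: "0 < e"
    obtain M where M: "\<And>m n. m \<ge> M \<Longrightarrow> n \<ge> M \<Longrightarrow> norm (X m - X n) < e/2"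
      using CauchyD[OF X, of "e/2"] e by auto
    have "norm (X n - abs_linf g) < e" if n: "n \<ge> M" for n
    proof -
      have "AE t in unit_lebesgue. norm (rep_linf (X n - abs_linf g) t) \<le> e/2"
        using rep_diff_AE[of "X n" "abs_linf g"] rep_abs_AE[OF gb] conv d
      proof eventually_elim
        case (elim t)
        have "(\<lambda>m. norm (f n t - f m t)) \<longlonglongrightarrow> norm (f n t - g t)"
          using elim by (intro tendsto_intros)
        moreover have "norm (f n t - f m t) \<le> e/2" if "m \<ge> M" for m
          using elim M[OF n that] by (meson less_imp_le order.trans)
        ultimately have "norm (f n t - g t) \<le> e/2" by (blast intro: Lim_bounded)
        thus ?case using elim by (simp add: f_def)
      qed
      thus ?thesis using norm_linf_leI[of "X n - abs_linf g" "e/2"] e by auto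
    qed
    thus "\<exists>no. \<forall>n\<ge>no. norm (X n - abs_linf g) < e" by blast
  qed
  thus "convergent X" by (auto simp: convergent_def)
qed

section \<open>Riemann--Stieltjes integrals of operator-valued functions\<close>

text \<open>
  The empty set is treated separately because intersections of partition intervals can be empty,
  while \<open>Sup {}\<close> is an unspecified real number.
\<close>
definition increment :: "(real \<Rightarrow> 'a::real_normed_vector) \<Rightarrow> real set \<Rightarrow> 'a" where
  "increment g k = (if k = {} then 0 else g (Sup k) - g (Inf k))"

lemma increment_empty_interior:
  assumes "k = cbox a b" "interior k = {}"
  shows "increment g k = 0"
  using assms by (cases a b rule: linorder_cases) (auto simp: increment_def)

lemma sum_increment_division:
  assumes "d division_of cbox a b"
  shows "(\<Sum>k\<in>d. increment g k) = increment g (cbox a b)"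
proof -
  interpret operative_real plus 0 "increment g"
    rewrites "comm_monoid_set.F (+) 0 = sum"
    by standard[1] (auto simp add: sum_def increment_def)
  show ?thesis using division assms by simp
qed

text \<open>
  Two tags of the same interval would force that interval to be a single point, so tagged
  partitions of an interval can be re-indexed by their intervals.
\<close>
lemma tagged_division_inj_snd:
  assumes "p tagged_division_of {a..b::real}"
  shows "inj_on snd p"
proof (rule inj_onI)
  fix u v assume uv: "u \<in> p" "v \<in> p" "snd u = snd v"
  obtain x k y where u: "u = (x, k)" and v: "v = (y, k)" using uv by (metis prod.collapse)
  have x: "x \<in> k" and y: "y \<in> k" using tagged_division_ofD(2)[OF assms] uv u v by auto
  show "u = v"
  proof (rule ccontr)
    assume "u \<noteq> v"
    hence "interior k = {}" using tagged_division_ofD(5)[OF assms] uv u v by fastforce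
    moreover obtain c d where "k = cbox c d" using tagged_division_ofD(4)[OF assms] uv u by blast
    ultimately have "x = y" using x y by (auto simp: box_eq_empty)
    thus False using \<open>u \<noteq> v\<close> u v by simp
  qed
qed

text \<open>
  Different intervals of \<open>q\<close> can cut \<open>k\<close> in the same point; such intersections are counted twice,
  but they carry no increment.
\<close>
lemma sum_increment_refine:
  assumes q: "q tagged_division_of {0..1}" and k: "k = cbox a b" "k \<subseteq> {0..1}" "k \<noteq> {}"
  shows "(\<Sum>(y, l)\<in>q. increment g (k \<inter> l)) = increment g k"
proof -
  note dq = division_of_tagged_division[OF q]
  note finq = division_ofD(1)[OF dq]
  have "(\<Sum>(y, l)\<in>q. increment g (k \<inter> l)) = (\<Sum>l\<in>snd ` q. increment g (k \<inter> l))"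
    by (subst sum.reindex[OF tagged_division_inj_snd[OF q]]) (auto simp: case_prod_beta)
  also have "\<dots> = sum (increment g) ((\<lambda>l. k \<inter> l) ` snd ` q)"
  proof (subst sum.reindex_nontrivial[OF finq])
    fix l l' assume l: "l \<in> snd ` q" "l' \<in> snd ` q" "l \<noteq> l'" "k \<inter> l = k \<inter> l'"
    have "interior l \<inter> interior l' = {}" using division_ofD(5)[OF dq] l by blast
    hence "interior (k \<inter> l) = {}" using l(4) by (metis Int_assoc inf_bot_right interior_Int inf.left_idem Int_commute)
    moreover obtain c d where "l = cbox c d" using division_ofD(4)[OF dq l(1)] by blast
    moreover obtain c' d' where "cbox a b \<inter> cbox c d = cbox c' d'" by (meson Int_interval)
    ultimately show "increment g (k \<inter> l) = 0"
      using increment_empty_interior k by metis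
  qed (simp add: o_def)
  also have "\<dots> = sum (increment g) {cbox a b \<inter> l | l. l \<in> snd ` q \<and> cbox a b \<inter> l \<noteq> {}}"
    by (rule sum.mono_neutral_right) (use finq k in \<open>auto simp: increment_def\<close>)
  also have "\<dots> = increment g k"
    using sum_increment_division[OF division_inter_1[OF dq, of a b]] k by auto
  finally show ?thesis .
qed

text \<open>
  The intersections of the intervals of two partitions form a partition again, the common
  refinement, and the total variation bounds the sum over it.
\<close>
lemma sum_increment_pairs:
  fixes g :: "real \<Rightarrow> complex"
  assumes p: "p tagged_division_of {0..1}" and q: "q tagged_division_of {0..1}"
    and B: "\<And>d. d division_of {0..1} \<Longrightarrow> (\<Sum>k\<in>d. norm (g (Sup k) - g (Inf k))) \<le> B"
  shows "(\<Sum>(x, k)\<in>p. \<Sum>(y, l)\<in>q. norm (increment g (k \<inter> l))) \<le> B"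
proof -
  note dp = division_of_tagged_division[OF p] and dq = division_of_tagged_division[OF q]
  note finp = division_ofD(1)[OF dp] and finq = division_ofD(1)[OF dq]
  define D where "D = {k1 \<inter> k2 | k1 k2. k1 \<in> snd ` p \<and> k2 \<in> snd ` q \<and> k1 \<inter> k2 \<noteq> {}}"
  have D: "D division_of {0..1}"
    using division_inter[OF dp dq] by (simp add: D_def)
  have "(\<Sum>(x, k)\<in>p. \<Sum>(y, l)\<in>q. norm (increment g (k \<inter> l)))
      = (\<Sum>k\<in>snd ` p. \<Sum>l\<in>snd ` q. norm (increment g (k \<inter> l)))"
    by (simp add: sum.reindex[OF tagged_division_inj_snd[OF p]] sum.reindex[OF tagged_division_inj_snd[OF q]]
        case_prod_beta)
  also have "\<dots> = (\<Sum>u\<in>snd ` p \<times> snd ` q. norm (increment g (fst u \<inter> snd u)))"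
    by (simp add: sum.cartesian_product case_prod_beta)
  also have "\<dots> = sum (\<lambda>m. norm (increment g m)) ((\<lambda>u. fst u \<inter> snd u) ` (snd ` p \<times> snd ` q))"
  proof (subst sum.reindex_nontrivial)
    show "finite (snd ` p \<times> snd ` q)" using finp finq by simp
    fix u v assume u: "u \<in> snd ` p \<times> snd ` q" and v: "v \<in> snd ` p \<times> snd ` q" and "u \<noteq> v"
      and eq: "fst u \<inter> snd u = fst v \<inter> snd v"
    have "fst u \<noteq> fst v \<or> snd u \<noteq> snd v" using \<open>u \<noteq> v\<close> by (auto simp: prod_eq_iff)
    hence "interior (fst u) \<inter> interior (fst v) = {} \<or> interior (snd u) \<inter> interior (snd v) = {}"
      using division_ofD(5)[OF dp, of "fst u" "fst v"] division_ofD(5)[OF dq, of "snd u" "snd v"] u v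
      by (auto simp: mem_Times_iff)
    hence e: "interior (fst u \<inter> snd u) = {}"
      using arg_cong[OF eq, of interior] by auto
    have u': "fst u \<in> snd ` p" "snd u \<in> snd ` q" using u by (simp_all add: mem_Times_iff)
    obtain a b where "fst u = cbox a b" using division_ofD(4)[OF dp u'(1)] by blast
    moreover obtain c d where "snd u = cbox c d" using division_ofD(4)[OF dq u'(2)] by blast
    moreover obtain c' d' where "cbox a b \<inter> cbox c d = cbox c' d'" by (meson Int_interval)
    ultimately show "norm (increment g (fst u \<inter> snd u)) = 0"
      using increment_empty_interior[OF _ e] by simp
  qed (simp add: o_def)
  also have "\<dots> = sum (\<lambda>m. norm (increment g m)) D"
  proof (rule sum.mono_neutral_right)
    show "D \<subseteq> (\<lambda>u. fst u \<inter> snd u) ` (snd ` p \<times> snd ` q)"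
      proof
      fix m assume "m \<in> D"
      then obtain k1 k2 where "m = k1 \<inter> k2" "k1 \<in> snd ` p" "k2 \<in> snd ` q" unfolding D_def by blast
      thus "m \<in> (\<lambda>u. fst u \<inter> snd u) ` (snd ` p \<times> snd ` q)"
        by (intro image_eqI[of _ _ "(k1, k2)"]) auto
    qed
    show "\<forall>i\<in>(\<lambda>u. fst u \<inter> snd u) ` (snd ` p \<times> snd ` q) - D. norm (increment g i) = 0"
      proof
      fix m assume m: "m \<in> (\<lambda>u. fst u \<inter> snd u) ` (snd ` p \<times> snd ` q) - D"
      then obtain u where u: "u \<in> snd ` p \<times> snd ` q" "m = fst u \<inter> snd u" "m \<notin> D" by blast
      hence "m = {}" unfolding D_def mem_Times_iff mem_Collect_eq by blast
      thus "norm (increment g m) = 0" by (simp add: increment_def)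
    qed
  qed (use finp finq in simp)
  also have "\<dots> = (\<Sum>k\<in>D. norm (g (Sup k) - g (Inf k)))"
    by (rule sum.cong) (use division_ofD(3)[OF D] in \<open>auto simp: increment_def\<close>)
  also have "\<dots> \<le> B" by (rule B[OF D])
  finally show ?thesis .
qed

lemma cmul_apply [simp]: "(cmul c) x = cscale c x"
  by (simp add: cmul.rep_eq)

lemma cmul_add: "cmul (a + b) = cmul a + cmul b"
  by (rule blinfun_eqI) (simp add: blinfun.bilinear_simps linf.scale_left_distrib)

lemma cmul_diff: "cmul (a - b) = cmul a - cmul b"
  by (rule blinfun_eqI) (simp add: blinfun.bilinear_simps linf.scale_left_diff_distrib)

lemma cmul_zero [simp]: "cmul 0 = 0"
  by (rule blinfun_eqI) (simp)

lemma cmul_one [simp]: "cmul 1 = id_blinfun"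
  by (rule blinfun_eqI) (simp)

lemma cmul_mult: "cmul a o\<^sub>L cmul b = cmul (a * b)"
  by (rule blinfun_eqI) simp

lemma cmul_sum: "cmul (\<Sum>i\<in>A. f i) = (\<Sum>i\<in>A. cmul (f i))"
  by (induction A rule: infinite_finite_induct) (auto simp: cmul_add)

lemma norm_cmul_le: "norm (cmul c) \<le> norm c"
  by (rule norm_blinfun_bound) (auto simp: norm_cscale)

lemma norm_cmul_compose_le: "norm (cmul c o\<^sub>L T) \<le> norm c * norm T"
  using norm_blinfun_compose[of "cmul c" T] norm_cmul_le[of c]
  by (meson mult_right_mono norm_ge_zero order_trans)

lemma blinfun_compose_assoc: "(A o\<^sub>L B) o\<^sub>L C = A o\<^sub>L (B o\<^sub>L C)"
  by (rule blinfun_eqI) simp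

lemma compose_id_blinfun [simp]: "T o\<^sub>L id_blinfun = T" "id_blinfun o\<^sub>L T = T"
  by (rule blinfun_eqI, simp)+

lemmas compose_simps = bounded_bilinear.add_left[OF bounded_bilinear_blinfun_compose]
  bounded_bilinear.add_right[OF bounded_bilinear_blinfun_compose]
  bounded_bilinear.diff_left[OF bounded_bilinear_blinfun_compose]
  bounded_bilinear.diff_right[OF bounded_bilinear_blinfun_compose]
  bounded_bilinear.zero_left[OF bounded_bilinear_blinfun_compose]
  bounded_bilinear.zero_right[OF bounded_bilinear_blinfun_compose]

definition rs_sum :: "(real \<Rightarrow> complex) \<Rightarrow> (complex \<Rightarrow> linf \<Rightarrow>\<^sub>L linf) \<Rightarrow> (real \<times> real set) set \<Rightarrow> linf \<Rightarrow>\<^sub>L linf" where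
  "rs_sum \<gamma> F p = (\<Sum>(x, k)\<in>p. cmul (\<gamma> (Sup k) - \<gamma> (Inf k)) o\<^sub>L F (\<gamma> x))"

text \<open>
  Every Riemann--Stieltjes sum is a sum over the common refinement with any other partition,
  so two sums can be compared interval by interval.
\<close>
lemma rs_sum_refine:
  assumes p: "p tagged_division_of {0..1}" and q: "q tagged_division_of {0..1}"
  shows "rs_sum \<gamma> F p = (\<Sum>(x, k)\<in>p. \<Sum>(y, l)\<in>q. cmul (increment \<gamma> (k \<inter> l)) o\<^sub>L F (\<gamma> x))"
proof -
  have "cmul (\<gamma> (Sup k) - \<gamma> (Inf k)) o\<^sub>L F (\<gamma> x) = (\<Sum>(y, l)\<in>q. cmul (increment \<gamma> (k \<inter> l)) o\<^sub>L F (\<gamma> x))"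
    if xk: "(x, k) \<in> p" for x k
  proof -
    obtain a b where k: "k = cbox a b" using tagged_division_ofD(4)[OF p xk] by blast
    have x: "x \<in> k" "k \<subseteq> {0..1}" using tagged_division_ofD(2,3)[OF p xk] .
    have "\<gamma> (Sup k) - \<gamma> (Inf k) = increment \<gamma> k" using x by (auto simp: increment_def)
    also have "\<dots> = (\<Sum>(y, l)\<in>q. increment \<gamma> (k \<inter> l))"
      by (rule sum_increment_refine[OF q k x(2), symmetric]) (use x in auto)
    also have "cmul \<dots> o\<^sub>L F (\<gamma> x) = (\<Sum>(y, l)\<in>q. cmul (increment \<gamma> (k \<inter> l)) o\<^sub>L F (\<gamma> x))"
      by (simp add: cmul_sum bounded_bilinear.sum_left[OF bounded_bilinear_blinfun_compose] case_prod_beta)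
    finally show ?thesis .
  qed
  thus ?thesis unfolding rs_sum_def by (intro sum.cong) auto
qed

lemma dist_tags:
  assumes p: "p tagged_division_of {0..1}" and q: "q tagged_division_of {0..1}"
    and "(x, k) \<in> p" "(y, l) \<in> q" "k \<inter> l \<noteq> {}" "diameter k < \<delta>" "diameter l < \<delta>"
  shows "dist x y < 2 * \<delta>" "x \<in> {0..1}" "y \<in> {0..1::real}"
proof -
  obtain z where z: "z \<in> k" "z \<in> l" using assms(5) by blast
  note x = tagged_division_ofD(2,3)[OF p assms(3)] and y = tagged_division_ofD(2,3)[OF q assms(4)]
  have "bounded k" "bounded l"
    by (rule bounded_subset[OF bounded_closed_interval x(2)], rule bounded_subset[OF bounded_closed_interval y(2)])
  hence "dist x z \<le> diameter k" "dist y z \<le> diameter l"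
    using diameter_bounded_bound[OF _ x(1) z(1)] diameter_bounded_bound[OF _ y(1) z(2)] by simp_all
  thus "dist x y < 2 * \<delta>" using assms dist_triangle2[of x y z] by linarith
  show "x \<in> {0..1}" "y \<in> {0..1}" using x y by auto
qed

text \<open>
  On the common refinement the two sums differ only in the tags at which \<open>F\<close> is evaluated, and
  tags of overlapping short intervals are close to each other.
\<close>
lemma rs_sum_close:
  assumes p: "p tagged_division_of {0..1}" and q: "q tagged_division_of {0..1}"
    and B: "\<And>d. d division_of {0..1} \<Longrightarrow> (\<Sum>k\<in>d. norm (\<gamma> (Sup k) - \<gamma> (Inf k))) \<le> B"
    and dp: "\<And>x k. (x, k) \<in> p \<Longrightarrow> diameter k < \<delta>" and dq: "\<And>x k. (x, k) \<in> q \<Longrightarrow> diameter k < \<delta>"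
    and osc: "\<And>x y. x \<in> {0..1} \<Longrightarrow> y \<in> {0..1} \<Longrightarrow> dist x y < 2 * \<delta> \<Longrightarrow> norm (F (\<gamma> x) - F (\<gamma> y)) \<le> \<epsilon>"
    and e: "0 \<le> \<epsilon>"
  shows "norm (rs_sum \<gamma> F p - rs_sum \<gamma> F q) \<le> \<epsilon> * B"
proof -
  have "rs_sum \<gamma> F q = (\<Sum>(y, l)\<in>q. \<Sum>(x, k)\<in>p. cmul (increment \<gamma> (k \<inter> l)) o\<^sub>L F (\<gamma> y))"
    using rs_sum_refine[OF q p] by (simp add: Int_commute)
  also have "\<dots> = (\<Sum>(x, k)\<in>p. \<Sum>(y, l)\<in>q. cmul (increment \<gamma> (k \<inter> l)) o\<^sub>L F (\<gamma> y))"
    unfolding case_prod_beta by (rule sum.swap)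
  finally have "rs_sum \<gamma> F p - rs_sum \<gamma> F q =
      (\<Sum>(x, k)\<in>p. \<Sum>(y, l)\<in>q. cmul (increment \<gamma> (k \<inter> l)) o\<^sub>L (F (\<gamma> x) - F (\<gamma> y)))"
    unfolding rs_sum_refine[OF p q] by (simp add: sum_subtractf case_prod_beta compose_simps)
  also have "norm \<dots> \<le> (\<Sum>(x, k)\<in>p. \<Sum>(y, l)\<in>q. norm (increment \<gamma> (k \<inter> l)) * \<epsilon>)"
    unfolding case_prod_beta
  proof (intro sum_norm_le order_trans[OF norm_sum] sum_mono)
    fix u v assume uv: "u \<in> p" "v \<in> q"
    show "norm (cmul (increment \<gamma> (snd u \<inter> snd v)) o\<^sub>L (F (\<gamma> (fst u)) - F (\<gamma> (fst v))))
       \<le> norm (increment \<gamma> (snd u \<inter> snd v)) * \<epsilon>"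
    proof (cases "snd u \<inter> snd v = {}")
      case True thus ?thesis by (simp add: increment_def compose_simps)
    next
      case False
      have "norm (F (\<gamma> (fst u)) - F (\<gamma> (fst v))) \<le> \<epsilon>"
      proof -
        have uv': "(fst u, snd u) \<in> p" "(fst v, snd v) \<in> q" using uv by simp_all
        note tags = dist_tags[OF p q uv' False dp[OF uv'(1)] dq[OF uv'(2)]]
        show ?thesis by (rule osc[OF tags(2,3,1)])
      qed
      thus ?thesis
        by (intro order_trans[OF norm_cmul_compose_le] mult_left_mono norm_ge_zero)
    qed
  qed
  also have "\<dots> = \<epsilon> * (\<Sum>(x, k)\<in>p. \<Sum>(y, l)\<in>q. norm (increment \<gamma> (k \<inter> l)))"
    by (simp add: sum_distrib_left mult.commute case_prod_beta)
  also have "\<dots> \<le> \<epsilon> * B"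
    using sum_increment_pairs[OF p q B] e by (intro mult_left_mono) auto
  finally show ?thesis .
qed

definition fine_partition :: "real \<Rightarrow> (real \<times> real set) set \<Rightarrow> bool" where
  "fine_partition \<delta> p \<longleftrightarrow> p tagged_division_of {0..1} \<and> (\<forall>(x, k)\<in>p. diameter k < \<delta>)"

lemma fine_partitionD:
  assumes "fine_partition \<delta> p"
  shows "p tagged_division_of {0..1}" "\<And>x k. (x, k) \<in> p \<Longrightarrow> diameter k < \<delta>"
  using assms by (auto simp: fine_partition_def)

lemma fine_partition_mono: "fine_partition \<delta> p \<Longrightarrow> \<delta> \<le> \<delta>' \<Longrightarrow> fine_partition \<delta>' p"
  unfolding fine_partition_def by (blast intro: order.strict_trans2)

lemma ex_fine_partition:
  assumes "0 < \<delta>"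
  shows "\<exists>p. fine_partition \<delta> p"
proof -
  have g: "gauge (\<lambda>x::real. ball x (\<delta>/3))" using assms by (intro gauge_ball) auto
  obtain p where p: "p tagged_division_of cbox 0 1" "(\<lambda>x::real. ball x (\<delta>/3)) fine p"
    using fine_division_exists[OF g] by blast
  have "diameter k < \<delta>" if "(x, k) \<in> p" for x k
  proof -
    have "k \<subseteq> ball x (\<delta>/3)" using p(2) that by (auto dest: fineD)
    hence "diameter k \<le> diameter (ball x (\<delta>/3))" by (rule diameter_subset) auto
    also have "\<dots> < \<delta>" using assms by (simp add: diameter_ball)
    finally show ?thesis .
  qed
  hence "fine_partition \<delta> p" using p(1) by (auto simp: fine_partition_def)
  thus ?thesis by blast
qed

lemma has_op_path_integral_iff:
  "has_op_path_integral F I \<gamma> \<longleftrightarrow>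
     (\<forall>\<epsilon>>0. \<exists>\<delta>>0. \<forall>p. fine_partition \<delta> p \<longrightarrow> norm (rs_sum \<gamma> F p - I) < \<epsilon>)"
  unfolding has_op_path_integral_def rs_sum_def fine_partition_def ..

lemma has_op_path_integralD:
  assumes "has_op_path_integral F I \<gamma>" "0 < \<epsilon>"
  obtains \<delta> where "\<delta> > 0" "\<And>p. fine_partition \<delta> p \<Longrightarrow> norm (rs_sum \<gamma> F p - I) < \<epsilon>"
proof -
  obtain \<delta> where "\<delta> > 0" "\<forall>p. fine_partition \<delta> p \<longrightarrow> norm (rs_sum \<gamma> F p - I) < \<epsilon>"
    using assms unfolding has_op_path_integral_iff by iprover
  thus thesis by (intro that[of \<delta>]) iprover+
qed

text \<open>
  Sums over sufficiently fine partitions are close to each other, since \<open>F\<close> is uniformly continuous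
  along the path; completeness of the operator space supplies the limit.
\<close>
lemma has_op_path_integral_exists:
  assumes "rectifiable_path \<gamma>" and F: "continuous_on (path_image \<gamma>) F"
  shows "\<exists>I. has_op_path_integral F I \<gamma>"
proof -
  obtain B where B: "\<And>d. d division_of {0..1} \<Longrightarrow> (\<Sum>k\<in>d. norm (\<gamma> (Sup k) - \<gamma> (Inf k))) \<le> B"
    using assms(1) by (auto simp: rectifiable_path_def)
  have "{cbox 0 (1::real)} division_of cbox 0 1" by (rule division_of_self) auto
  from B[OF this[unfolded box_real]] have B0: "0 \<le> B" by (simp add: order_trans[OF norm_ge_zero])
  have c: "continuous_on {0..1} (\<lambda>x. F (\<gamma> x))"
    using assms(1) F unfolding rectifiable_path_def path_def path_image_def
    by (auto intro: continuous_on_compose2)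
  have uc: "uniformly_continuous_on {0..1} (\<lambda>x. F (\<gamma> x))"
    by (rule compact_uniformly_continuous[OF c]) simp
  have main: "\<exists>\<delta>>0. \<forall>p q. fine_partition \<delta> p \<and> fine_partition \<delta> q \<longrightarrow>
      norm (rs_sum \<gamma> F p - rs_sum \<gamma> F q) \<le> \<epsilon>" if e: "\<epsilon> > 0" for \<epsilon>
  proof -
    have "\<epsilon> / (B + 1) > 0" using e B0 by simp
    then obtain d where d: "d > 0" "\<And>x y. x \<in> {0..1} \<Longrightarrow> y \<in> {0..1} \<Longrightarrow> dist x y < d
        \<Longrightarrow> dist (F (\<gamma> x)) (F (\<gamma> y)) < \<epsilon> / (B + 1)"
      using uc unfolding uniformly_continuous_on_def by (metis dist_commute)
    have "norm (rs_sum \<gamma> F p - rs_sum \<gamma> F q) \<le> \<epsilon>"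
      if "fine_partition (d/2) p" "fine_partition (d/2) q" for p q
    proof -
      have "norm (rs_sum \<gamma> F p - rs_sum \<gamma> F q) \<le> \<epsilon> / (B + 1) * B"
      proof (rule rs_sum_close[OF that[THEN fine_partitionD(1)] B that[THEN fine_partitionD(2)]])
        show "norm (F (\<gamma> x) - F (\<gamma> y)) \<le> \<epsilon> / (B + 1)"
          if "x \<in> {0..1}" "y \<in> {0..1}" "dist x y < 2 * (d / 2)" for x y
          using d(2)[of x y] that by (simp add: dist_norm)
      qed (use e B0 in auto)
      also have "\<dots> \<le> \<epsilon>" using e B0 by (simp add: field_simps)
      finally show ?thesis .
    qed
    thus ?thesis using d(1) by (intro exI[of _ "d/2"]) auto
  qed
  have "\<forall>n. \<exists>\<delta>>0. \<forall>p q. fine_partition \<delta> p \<and> fine_partition \<delta> q \<longrightarrow>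
      norm (rs_sum \<gamma> F p - rs_sum \<gamma> F q) \<le> inverse (real (Suc n))"
    by (intro allI main) simp
  then obtain D where D: "\<And>n. D n > 0"
    "\<And>n p q. fine_partition (D n) p \<Longrightarrow> fine_partition (D n) q \<Longrightarrow>
      norm (rs_sum \<gamma> F p - rs_sum \<gamma> F q) \<le> inverse (real (Suc n))"
    by metis
  \<comment> \<open>Meshes decreasing in \<open>n\<close>, so that later partitions meet all earlier requirements.\<close>
  define D' where "D' n = Min (D ` {..n})" for n
  have D': "D' n > 0" "m \<le> n \<Longrightarrow> D' n \<le> D m" for m n
    using D(1) by (auto simp: D'_def)
  obtain P where P: "\<And>n. fine_partition (D' n) (P n)"
    using ex_fine_partition[OF D'(1)] by metis
  have close: "norm (rs_sum \<gamma> F (P m) - rs_sum \<gamma> F p) \<le> inverse (real (Suc N))"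
    if "fine_partition (D N) p" "m \<ge> N" for m N p
    by (rule D(2)[OF fine_partition_mono[OF P D'(2)[OF that(2)]] that(1)])
  have "Cauchy (\<lambda>n. rs_sum \<gamma> F (P n))"
  proof (rule CauchyI)
    fix e :: real assume "0 < e"
    then obtain N where N: "inverse (real (Suc N)) < e" using reals_Archimedean by blast
    have "norm (rs_sum \<gamma> F (P m) - rs_sum \<gamma> F (P n)) < e" if "m \<ge> N" "n \<ge> N" for m n
      using close[OF fine_partition_mono[OF P D'(2)[OF that(2)]] that(1)] N by simp
    thus "\<exists>M. \<forall>m\<ge>M. \<forall>n\<ge>M. norm (rs_sum \<gamma> F (P m) - rs_sum \<gamma> F (P n)) < e" by blast
  qed
  then obtain I where I: "(\<lambda>n. rs_sum \<gamma> F (P n)) \<longlonglongrightarrow> I"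
    by (auto simp: Cauchy_convergent_iff convergent_def)
  have "has_op_path_integral F I \<gamma>"
    unfolding has_op_path_integral_iff
  proof (intro allI impI)
    fix e :: real assume "0 < e"
    then obtain N where N: "inverse (real (Suc N)) < e" using reals_Archimedean by blast
    have "norm (rs_sum \<gamma> F p - I) < e" if p: "fine_partition (D N) p" for p
    proof -
      have "(\<lambda>n. norm (rs_sum \<gamma> F (P n) - rs_sum \<gamma> F p)) \<longlonglongrightarrow> norm (I - rs_sum \<gamma> F p)"
        by (intro tendsto_intros I)
      moreover have "\<forall>n\<ge>N. norm (rs_sum \<gamma> F (P n) - rs_sum \<gamma> F p) \<le> inverse (real (Suc N))"
        by (intro allI impI close[OF p])
      ultimately have "norm (I - rs_sum \<gamma> F p) \<le> inverse (real (Suc N))"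
        by (rule Lim_bounded)
      thus ?thesis using N by (simp add: norm_minus_commute)
    qed
    thus "\<exists>\<delta>>0. \<forall>p. fine_partition \<delta> p \<longrightarrow> norm (rs_sum \<gamma> F p - I) < e"
      using D(1) by blast
  qed
  thus ?thesis by blast
qed

lemma has_op_path_integral_unique:
  assumes "has_op_path_integral F I \<gamma>" "has_op_path_integral F J \<gamma>"
  shows "I = J"
proof (rule ccontr)
  assume "I \<noteq> J"
  hence e: "norm (I - J) / 2 > 0" by simp
  obtain d1 where d1: "d1 > 0" "\<And>p. fine_partition d1 p \<Longrightarrow> norm (rs_sum \<gamma> F p - I) < norm (I - J) / 2"
    using has_op_path_integralD[OF assms(1) e] by blast
  obtain d2 where d2: "d2 > 0" "\<And>p. fine_partition d2 p \<Longrightarrow> norm (rs_sum \<gamma> F p - J) < norm (I - J) / 2"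
    using has_op_path_integralD[OF assms(2) e] by blast
  obtain p where p: "fine_partition (min d1 d2) p"
    using ex_fine_partition[of "min d1 d2"] d1(1) d2(1) by auto
  show False
    using d1(2)[OF fine_partition_mono[OF p]] d2(2)[OF fine_partition_mono[OF p]]
      norm_triangle_ineq4[of "rs_sum \<gamma> F p - J" "rs_sum \<gamma> F p - I"] by simp
qed

lemma op_path_integral_eq: "has_op_path_integral F I \<gamma> \<Longrightarrow> op_path_integral \<gamma> F = I"
  unfolding op_path_integral_def by (rule the_equality, assumption, rule has_op_path_integral_unique)

lemma has_op_path_integral_add:
  assumes "has_op_path_integral F I \<gamma>" "has_op_path_integral G J \<gamma>"
  shows "has_op_path_integral (\<lambda>w. F w + G w) (I + J) \<gamma>"
  unfolding has_op_path_integral_iff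
proof (intro allI impI)
  fix e :: real assume "0 < e"
  hence e: "0 < e/2" by simp
  obtain d1 where d1: "d1 > 0" "\<And>p. fine_partition d1 p \<Longrightarrow> norm (rs_sum \<gamma> F p - I) < e/2"
    using has_op_path_integralD[OF assms(1) e] by blast
  obtain d2 where d2: "d2 > 0" "\<And>p. fine_partition d2 p \<Longrightarrow> norm (rs_sum \<gamma> G p - J) < e/2"
    using has_op_path_integralD[OF assms(2) e] by blast
  have "norm (rs_sum \<gamma> (\<lambda>w. F w + G w) p - (I + J)) < e"
    if p: "fine_partition (min d1 d2) p" for p
  proof -
    have "rs_sum \<gamma> (\<lambda>w. F w + G w) p = rs_sum \<gamma> F p + rs_sum \<gamma> G p"
      unfolding rs_sum_def case_prod_beta sum.distrib[symmetric] by (simp only: compose_simps)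
    thus ?thesis
      using d1(2)[OF fine_partition_mono[OF p]] d2(2)[OF fine_partition_mono[OF p]]
        norm_diff_triangle_ineq[of "rs_sum \<gamma> F p" "rs_sum \<gamma> G p" I J] by simp
  qed
  moreover have "0 < min d1 d2" using d1(1) d2(1) by simp
  ultimately show "\<exists>\<delta>>0. \<forall>p. fine_partition \<delta> p \<longrightarrow> norm (rs_sum \<gamma> (\<lambda>w. F w + G w) p - (I + J)) < e"
    by iprover
qed

text \<open>
  Integrals commute with composition from either side by a fixed operator. The hypothesis compares
  summands, so that it covers operators that first have to be moved past the scalar factor.
\<close>
lemma has_op_path_integral_linear:
  assumes "has_op_path_integral F I \<gamma>" and L: "bounded_linear L"
    and comm: "\<And>c w. w \<in> path_image \<gamma> \<Longrightarrow> L (cmul c o\<^sub>L F w) = cmul c o\<^sub>L G w"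
  shows "has_op_path_integral G (L I) \<gamma>"
  unfolding has_op_path_integral_iff
proof (intro allI impI)
  fix e :: real assume e: "0 < e"
  obtain N where N: "N > 0" "\<And>x. norm (L x) \<le> norm x * N" using bounded_linear.pos_bounded[OF L] by blast
  have e': "0 < e / N" using e N by simp
  obtain d where d: "d > 0" "\<And>p. fine_partition d p \<Longrightarrow> norm (rs_sum \<gamma> F p - I) < e / N"
    using has_op_path_integralD[OF assms(1) e'] by blast
  have "norm (rs_sum \<gamma> G p - L I) < e" if p: "fine_partition d p" for p
  proof -
    have "rs_sum \<gamma> G p = (\<Sum>u\<in>p. L (cmul (\<gamma> (Sup (snd u)) - \<gamma> (Inf (snd u))) o\<^sub>L F (\<gamma> (fst u))))"
      unfolding rs_sum_def case_prod_beta
    proof (rule sum.cong[OF refl])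
      fix u assume "u \<in> p"
      hence "fst u \<in> {0..1}"
        using tagged_division_ofD(2,3)[OF fine_partitionD(1)[OF p], of "fst u" "snd u"] by auto
      thus "cmul (\<gamma> (Sup (snd u)) - \<gamma> (Inf (snd u))) o\<^sub>L G (\<gamma> (fst u)) =
         L (cmul (\<gamma> (Sup (snd u)) - \<gamma> (Inf (snd u))) o\<^sub>L F (\<gamma> (fst u)))"
        by (intro comm[symmetric]) (auto simp: path_image_def)
    qed
    also have "\<dots> = L (rs_sum \<gamma> F p)"
      unfolding rs_sum_def case_prod_beta by (rule linear_sum[OF bounded_linear.linear[OF L], symmetric])
    finally have "norm (rs_sum \<gamma> G p - L I) \<le> norm (rs_sum \<gamma> F p - I) * N"
      using N(2)[of "rs_sum \<gamma> F p - I"] by (simp add: linear_diff[OF bounded_linear.linear[OF L]])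
    also have "\<dots> < e" using d(2)[OF p] N(1) by (simp add: field_simps)
    finally show ?thesis .
  qed
  thus "\<exists>\<delta>>0. \<forall>p. fine_partition \<delta> p \<longrightarrow> norm (rs_sum \<gamma> G p - L I) < e" using d(1) by blast
qed

lemma has_op_path_integral_norm_le:
  assumes "has_op_path_integral F I \<gamma>"
    and B: "\<And>d. d division_of {0..1} \<Longrightarrow> (\<Sum>k\<in>d. norm (\<gamma> (Sup k) - \<gamma> (Inf k))) \<le> B"
    and M: "\<And>w. w \<in> path_image \<gamma> \<Longrightarrow> norm (F w) \<le> M"
  shows "norm I \<le> M * B"
proof (rule field_le_epsilon)
  fix e :: real assume "0 < e"
  obtain d where d: "d > 0" "\<And>p. fine_partition d p \<Longrightarrow> norm (rs_sum \<gamma> F p - I) < e"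
    using has_op_path_integralD[OF assms(1) \<open>0 < e\<close>] by blast
  obtain p where p: "fine_partition d p"
    using ex_fine_partition[OF d(1)] by blast
  note p1 = fine_partitionD(1)[OF p]
  have M0: "0 \<le> M" using M[of "\<gamma> 0"] order_trans[OF norm_ge_zero] by (auto simp: path_image_def)
  have "norm (rs_sum \<gamma> F p) \<le> (\<Sum>(x, k)\<in>p. norm (\<gamma> (Sup k) - \<gamma> (Inf k)) * M)"
    unfolding rs_sum_def case_prod_beta
  proof (rule sum_norm_le)
    fix u assume u: "u \<in> p"
    have "fst u \<in> {0..1}" using tagged_division_ofD(2,3)[OF p1, of "fst u" "snd u"] u by auto
    hence "norm (F (\<gamma> (fst u))) \<le> M" by (intro M) (auto simp: path_image_def)
    thus "norm (cmul (\<gamma> (Sup (snd u)) - \<gamma> (Inf (snd u))) o\<^sub>L F (\<gamma> (fst u)))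
        \<le> norm (\<gamma> (Sup (snd u)) - \<gamma> (Inf (snd u))) * M"
      by (intro order_trans[OF norm_cmul_compose_le] mult_left_mono norm_ge_zero)
  qed
  also have "\<dots> = M * (\<Sum>k\<in>snd ` p. norm (\<gamma> (Sup k) - \<gamma> (Inf k)))"
    by (simp add: sum.reindex[OF tagged_division_inj_snd[OF p1]] case_prod_beta sum_distrib_left mult.commute)
  also have "\<dots> \<le> M * B"
    using B[OF division_of_tagged_division[OF p1]] M0 by (intro mult_left_mono)
  finally show "norm I \<le> M * B + e"
    using d(2)[OF p] norm_triangle_ineq4[of "rs_sum \<gamma> F p" "rs_sum \<gamma> F p - I"] by simp
qed

section \<open>Resolvents and contour integrals\<close>

text \<open>
  The path need not be differentiable, so the integral is computed from a continuous logarithm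
  \<open>\<gamma> = z + exp q\<close>: on an interval \<open>[a,b]\<close> with tag \<open>x\<close> the summand is
  \<open>exp (q b - q x) - exp (q a - q x)\<close>, which agrees with \<open>q b - q a\<close> up to a small multiple of itself,
  and the latter increments telescope to \<open>2 \<pi> i\<close> times the winding number.
\<close>
lemma has_op_path_integral_Cauchy_kernel:
  assumes \<gamma>: "rectifiable_path \<gamma>" and z: "z \<notin> path_image \<gamma>"
  shows "has_op_path_integral (\<lambda>w. cmul (1 / (w - z))) (cmul (2 * of_real pi * \<i> * winding_number \<gamma> z)) \<gamma>"
  unfolding has_op_path_integral_iff
proof (intro allI impI)
  fix e :: real assume e: "0 < e"
  have p\<gamma>: "path \<gamma>" using \<gamma> by (simp add: rectifiable_path_def)
  obtain B0 where B0: "\<And>d. d division_of {0..1} \<Longrightarrow> (\<Sum>k\<in>d. norm (\<gamma> (Sup k) - \<gamma> (Inf k))) \<le> B0"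
    using \<gamma> by (auto simp: rectifiable_path_def)
  define B where "B = max B0 1"
  have B: "\<And>d. d division_of {0..1} \<Longrightarrow> (\<Sum>k\<in>d. norm (\<gamma> (Sup k) - \<gamma> (Inf k))) \<le> B" and Bpos: "B > 0"
    using B0 by (fastforce simp: B_def)+
  obtain q where q: "path q" "pathfinish q - pathstart q = 2 * of_real pi * \<i> * winding_number \<gamma> z"
      "\<And>t. t \<in> {0..1} \<Longrightarrow> \<gamma> t = z + exp (q t)"
    using winding_number_as_continuous_log[OF p\<gamma> z] by blast
  obtain m where m: "m > 0" "\<And>w. w \<in> path_image \<gamma> \<Longrightarrow> m \<le> dist z w"
    using separate_point_closed[OF closed_path_image[OF p\<gamma>] z] by blast
  \<comment> \<open>The bound \<open>1/2\<close> makes \<open>exp u - exp v\<close> control \<open>u - v\<close>; the other one makes the total error at most \<open>e/2\<close>.\<close>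
  define \<epsilon> where "\<epsilon> = min (1/2) (e * m / (4 * B))"
  have \<epsilon>: "\<epsilon> > 0" "\<epsilon> \<le> 1/2" "2 * \<epsilon> / m * B < e"
  proof -
    show "\<epsilon> > 0" "\<epsilon> \<le> 1/2" using e m Bpos by (auto simp: \<epsilon>_def)
    have "\<epsilon> \<le> e * m / (4 * B)" by (simp add: \<epsilon>_def)
    hence "2 * \<epsilon> / m * B \<le> e / 2" using m Bpos by (simp add: field_simps)
    thus "2 * \<epsilon> / m * B < e" using e by simp
  qed
  have "isCont (exp :: complex \<Rightarrow> complex) 0" by simp
  then obtain \<eta> where \<eta>: "\<eta> > 0" "\<And>w::complex. norm w < \<eta> \<Longrightarrow> norm (exp w - 1) < \<epsilon>"
    using \<epsilon>(1) unfolding continuous_at_eps_delta by (auto simp: dist_norm)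
  have exp_est: "norm (exp u - exp v - (u - v)) \<le> 2 * \<epsilon> * norm (exp u - exp v)"
    if "norm u < \<eta>" "norm v < \<eta>" for u v :: complex
  proof -
    have "norm ((exp u - u) - (exp v - v)) \<le> \<epsilon> * norm (u - v)"
    proof (rule field_differentiable_bound[of "ball 0 \<eta>" "\<lambda>w. exp w - w" "\<lambda>w. exp w - 1"])
      show "((\<lambda>w. exp w - w) has_field_derivative exp w - 1) (at w within ball 0 \<eta>)" for w :: complex
        by (auto intro!: derivative_eq_intros)
    qed (use \<eta>(2) that in \<open>auto simp: less_imp_le\<close>)
    hence 1: "norm (exp u - exp v - (u - v)) \<le> \<epsilon> * norm (u - v)" by (simp add: algebra_simps)
    also have "\<epsilon> * norm (u - v) \<le> norm (u - v) / 2" using \<epsilon>(2) mult_right_mono[OF \<epsilon>(2), of "norm (u - v)"] by simp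
    finally have "norm (u - v) \<le> 2 * norm (exp u - exp v)"
      using norm_triangle_ineq4[of "exp u - exp v" "exp u - exp v - (u - v)"] by simp
    hence "\<epsilon> * norm (u - v) \<le> 2 * \<epsilon> * norm (exp u - exp v)" using \<epsilon>(1) by simp
    thus ?thesis using 1 by linarith
  qed
  have "uniformly_continuous_on {0..1} q"
    using q(1) by (intro compact_uniformly_continuous) (auto simp: path_def)
  then obtain d where d: "d > 0" "\<And>x y. x \<in> {0..1} \<Longrightarrow> y \<in> {0..1} \<Longrightarrow> dist x y < d \<Longrightarrow> norm (q x - q y) < \<eta>"
    using \<eta>(1) unfolding uniformly_continuous_on_def dist_norm by metis
  have "norm (rs_sum \<gamma> (\<lambda>w. cmul (1 / (w - z))) p - cmul (2 * of_real pi * \<i> * winding_number \<gamma> z)) < e"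
    if fp: "fine_partition d p" for p
  proof -
    note p = fine_partitionD[OF fp]
    let ?c = "\<lambda>u. (\<gamma> (Sup (snd u)) - \<gamma> (Inf (snd u))) / (\<gamma> (fst u) - z)"
    let ?q = "\<lambda>u. q (Sup (snd u)) - q (Inf (snd u))"
    have 1: "rs_sum \<gamma> (\<lambda>w. cmul (1 / (w - z))) p = cmul (\<Sum>u\<in>p. ?c u)"
      unfolding rs_sum_def cmul_sum by (simp add: case_prod_beta cmul_mult)
    have 2: "2 * of_real pi * \<i> * winding_number \<gamma> z = (\<Sum>u\<in>p. ?q u)"
      using additive_tagged_division_1[OF _ p(1), of q] q(2) by (simp add: case_prod_beta pathfinish_def pathstart_def)
    have "norm (rs_sum \<gamma> (\<lambda>w. cmul (1 / (w - z))) p - cmul (2 * of_real pi * \<i> * winding_number \<gamma> z))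
        \<le> norm (\<Sum>u\<in>p. ?c u - ?q u)"
      unfolding 1 2 cmul_diff[symmetric] sum_subtractf[symmetric] by (rule norm_cmul_le)
    also have "\<dots> \<le> (\<Sum>u\<in>p. 2 * \<epsilon> / m * norm (\<gamma> (Sup (snd u)) - \<gamma> (Inf (snd u))))"
    proof (rule sum_norm_le)
      fix u assume u: "u \<in> p"
      obtain x k where xk: "u = (x, k)" by (cases u)
      have x: "x \<in> k" "k \<subseteq> {0..1}" and "diameter k < d"
        using tagged_division_ofD(2,3)[OF p(1)] p(2) u unfolding xk by auto
      obtain a b where k: "k = {a..b}" using tagged_division_ofD(4)[OF p(1)] u unfolding xk by (metis box_real(2))
      have ab: "a \<le> b" "a \<in> {0..1}" "b \<in> {0..1}" "x \<in> {0..1}" using x k by auto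
      have "dist b x < d" "dist a x < d"
        using x k \<open>diameter k < d\<close> ab by (auto simp: dist_real_def)
      hence small: "norm (q b - q x) < \<eta>" "norm (q a - q x) < \<eta>" using d(2) ab by auto
      have \<gamma>': "\<gamma> b - \<gamma> a = (\<gamma> x - z) * (exp (q b - q x) - exp (q a - q x))"
        using q(3) ab by (simp add: exp_diff field_simps)
      have nz: "m \<le> norm (\<gamma> x - z)" using m(2)[of "\<gamma> x"] ab by (auto simp: path_image_def dist_norm norm_minus_commute)
      hence c: "?c u = exp (q b - q x) - exp (q a - q x)"
        using \<gamma>' m(1) ab by (auto simp: xk k)
      have "norm (?c u - ?q u) \<le> 2 * \<epsilon> * norm (?c u)"
        unfolding c using exp_est[OF small] ab by (simp add: xk k)
      also have "norm (?c u) \<le> norm (\<gamma> b - \<gamma> a) / m"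
        using nz m(1) ab by (simp add: xk k norm_divide frac_le)
      finally show "norm (?c u - ?q u) \<le> 2 * \<epsilon> / m * norm (\<gamma> (Sup (snd u)) - \<gamma> (Inf (snd u)))"
        using \<epsilon>(1) ab by (simp add: xk k)
    qed
    also have "\<dots> = 2 * \<epsilon> / m * (\<Sum>k\<in>snd ` p. norm (\<gamma> (Sup k) - \<gamma> (Inf k)))"
      by (simp add: sum.reindex[OF tagged_division_inj_snd[OF p(1)]] sum_distrib_left)
    also have "\<dots> \<le> 2 * \<epsilon> / m * B"
      using B[OF division_of_tagged_division[OF p(1)]] \<epsilon>(1) m(1) by (intro mult_left_mono) auto
    also have "\<dots> < e" by (rule \<epsilon>(3))
    finally show ?thesis .
  qed
  thus "\<exists>\<delta>>0. \<forall>p. fine_partition \<delta> p \<longrightarrow>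
      norm (rs_sum \<gamma> (\<lambda>w. cmul (1 / (w - z))) p - cmul (2 * of_real pi * \<i> * winding_number \<gamma> z)) < e"
    using d(1) by blast
qed

text \<open>
  The type of bounded operators provides real linearity only.
\<close>
definition complex_linear_op :: "linf \<Rightarrow>\<^sub>L linf \<Rightarrow> bool" where
  "complex_linear_op T \<longleftrightarrow> (\<forall>c. T o\<^sub>L cmul c = cmul c o\<^sub>L T)"

lemma is_inverse_op_resolvent:
  assumes "z \<in> resolvent_set T"
  shows "(T - cmul z) o\<^sub>L resolvent T z = id_blinfun" "resolvent T z o\<^sub>L (T - cmul z) = id_blinfun"
proof -
  obtain S where S: "is_inverse_op (T - cmul z) S" using assms by (auto simp: resolvent_set_def)
  have "resolvent T z = S"
    unfolding resolvent_def
  proof (rule the_equality[where P = "is_inverse_op (T - cmul z)", OF S])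
    fix S' assume "is_inverse_op (T - cmul z) S'"
    hence "S' = S' o\<^sub>L ((T - cmul z) o\<^sub>L S)" "S = (S' o\<^sub>L (T - cmul z)) o\<^sub>L S"
      using S by (simp_all add: is_inverse_op_def)
    thus "S' = S" by (simp add: blinfun_compose_assoc)
  qed
  thus "(T - cmul z) o\<^sub>L resolvent T z = id_blinfun" "resolvent T z o\<^sub>L (T - cmul z) = id_blinfun"
    using S by (auto simp: is_inverse_op_def)
qed

lemma complex_linear_resolvent:
  assumes T: "complex_linear_op T" and z: "z \<in> resolvent_set T"
  shows "complex_linear_op (resolvent T z)"
  unfolding complex_linear_op_def
proof
  fix c
  let ?R = "resolvent T z"
  have comm: "(T - cmul z) o\<^sub>L cmul c = cmul c o\<^sub>L (T - cmul z)"
    using T by (simp add: complex_linear_op_def compose_simps cmul_mult mult.commute)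
  have "?R o\<^sub>L cmul c = ?R o\<^sub>L (cmul c o\<^sub>L ((T - cmul z) o\<^sub>L ?R))"
    by (simp add: is_inverse_op_resolvent[OF z])
  also have "\<dots> = ?R o\<^sub>L (((T - cmul z) o\<^sub>L cmul c) o\<^sub>L ?R)"
    by (simp add: comm blinfun_compose_assoc)
  also have "\<dots> = (?R o\<^sub>L (T - cmul z)) o\<^sub>L (cmul c o\<^sub>L ?R)"
    by (simp only: blinfun_compose_assoc)
  also have "\<dots> = cmul c o\<^sub>L ?R" by (simp add: is_inverse_op_resolvent[OF z])
  finally show "?R o\<^sub>L cmul c = cmul c o\<^sub>L ?R" .
qed

lemma resolvent_diff:
  assumes "z \<in> resolvent_set T" "w \<in> resolvent_set T"
  shows "resolvent T w - resolvent T z = resolvent T w o\<^sub>L (cmul (w - z) o\<^sub>L resolvent T z)"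
proof -
  have "resolvent T w o\<^sub>L (cmul (w - z) o\<^sub>L resolvent T z)
      = resolvent T w o\<^sub>L (((T - cmul z) - (T - cmul w)) o\<^sub>L resolvent T z)"
    by (simp add: cmul_diff)
  also have "\<dots> = (resolvent T w o\<^sub>L ((T - cmul z) o\<^sub>L resolvent T z)) - ((resolvent T w o\<^sub>L (T - cmul w)) o\<^sub>L resolvent T z)"
    by (simp only: compose_simps blinfun_compose_assoc)
  also have "\<dots> = resolvent T w - resolvent T z"
    using assms by (simp add: is_inverse_op_resolvent)
  finally show ?thesis by simp
qed

text \<open>
  By the resolvent identity, \<open>R w\<close> is bounded by \<open>2 N\<close> near a point where the norm is at most \<open>N\<close>;
  inserting this bound into the identity again gives continuity.
\<close>
lemma continuous_on_resolvent:
  assumes "S \<subseteq> resolvent_set T"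
  shows "continuous_on S (resolvent T)"
proof -
  have "((resolvent T) \<longlongrightarrow> resolvent T z) (at z within S)" if "z \<in> S" for z
  proof -
    define N where "N = norm (resolvent T z) + 1"
    have N: "N > 0" "norm (resolvent T z) \<le> N" by (auto simp: N_def add_nonneg_pos)
    have "\<forall>\<^sub>F w in at z within S. dist w z < 1 / (2 * N)"
      using N unfolding eventually_at by (intro exI[of _ "1 / (2 * N)"]) auto
    moreover have "\<forall>\<^sub>F w in at z within S. w \<in> S"
      by (simp add: eventually_at_topological) auto
    ultimately have "\<forall>\<^sub>F w in at z within S. norm (resolvent T w - resolvent T z) \<le> 2 * N\<^sup>2 * norm (w - z)"
    proof eventually_elim
      case (elim w)
      have wz: "norm (w - z) < 1 / (2 * N)" using elim by (simp add: dist_norm)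
      have le: "norm (resolvent T w - resolvent T z) \<le> norm (resolvent T w) * (norm (w - z) * N)"
      proof -
        have "norm (resolvent T w - resolvent T z) \<le> norm (resolvent T w) * norm (cmul (w - z) o\<^sub>L resolvent T z)"
          using elim that assms by (subst resolvent_diff) (auto intro: norm_blinfun_compose)
        also have "norm (cmul (w - z) o\<^sub>L resolvent T z) \<le> norm (w - z) * N"
          by (rule order_trans[OF norm_cmul_compose_le]) (use N in \<open>auto intro: mult_left_mono\<close>)
        finally show ?thesis by (simp add: mult_left_mono)
      qed
      have "norm (w - z) * N \<le> 1/2" using wz N by (simp add: field_simps)
      hence "norm (resolvent T w) * (norm (w - z) * N) \<le> norm (resolvent T w) * (1/2)"
        by (intro mult_left_mono) auto
      hence "norm (resolvent T w) \<le> 2 * N"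
        using le N norm_triangle_ineq2[of "resolvent T w" "resolvent T z"] by simp
      hence "norm (resolvent T w) * (norm (w - z) * N) \<le> (2 * N) * (norm (w - z) * N)"
        using N by (intro mult_right_mono) auto
      thus ?case using le by (simp add: power2_eq_square mult_ac)
    qed
    moreover have "((\<lambda>w. 2 * N\<^sup>2 * norm (w - z)) \<longlongrightarrow> 0) (at z within S)"
      by (auto intro!: tendsto_eq_intros)
    ultimately have "((\<lambda>w. resolvent T w - resolvent T z) \<longlongrightarrow> 0) (at z within S)"
      by (rule Lim_null_comparison)
    thus ?thesis by (rule LIM_zero_cancel)
  qed
  thus ?thesis by (simp add: continuous_on_def)
qed

text \<open>
  The operator \<open>A\<close> is the integral of \<open>(w - z)\<^sup>-\<^sup>1 R(w)\<close>. Composing with \<open>T - z = (T - w) + (w - z)\<close>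
  turns the integrand into \<open>(w - z)\<^sup>-\<^sup>1 I + R(w)\<close>, whose integral is \<open>2 \<pi> i (I - E)\<close> for the
  spectral projection \<open>E\<close>. Since \<open>E\<close> is only given as a contour integral, this identity is the source of all its properties: applied to an
  eigenvector inside the curve it shows that \<open>E\<close> fixes it, and comparing the two sides shows that
  \<open>E\<close> commutes with the operator.
\<close>
lemma contour_parametrix:
  assumes T: "complex_linear_op T" and \<gamma>: "rectifiable_path \<gamma>"
    and res: "path_image \<gamma> \<subseteq> resolvent_set T"
    and z: "z \<notin> path_image \<gamma>" "winding_number \<gamma> z = 1"
    and B: "\<And>d. d division_of {0..1} \<Longrightarrow> (\<Sum>k\<in>d. norm (\<gamma> (Sup k) - \<gamma> (Inf k))) \<le> B"
    and M: "\<And>w. w \<in> path_image \<gamma> \<Longrightarrow> norm (resolvent T w) \<le> M"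
    and d: "0 < d" "\<And>w. w \<in> path_image \<gamma> \<Longrightarrow> d \<le> norm (w - z)"
  obtains A where "A o\<^sub>L (T - cmul z) = id_blinfun - spectral_projection T \<gamma>"
    "(T - cmul z) o\<^sub>L A = id_blinfun - spectral_projection T \<gamma>" "norm A \<le> M * B / d"
proof -
  let ?F = "\<lambda>w. cmul (1 / (w - z)) o\<^sub>L resolvent T w"
  have cont: "continuous_on (path_image \<gamma>) (resolvent T)" by (rule continuous_on_resolvent[OF res])
  obtain J where J: "has_op_path_integral (resolvent T) J \<gamma>"
    using has_op_path_integral_exists[OF \<gamma> cont] by blast
  have bl: "bounded_linear cmul"
    by (rule bounded_linear_intro[where K = 1])
      (auto simp: cmul_add norm_cmul_le intro!: blinfun_eqI simp: scaleR_eq_cscale scaleR_blinfun.rep_eq scaleR_conv_of_real)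
  have "continuous_on (path_image \<gamma>) (\<lambda>w. cmul (1 / (w - z)))"
    by (rule continuous_on_compose2[OF linear_continuous_on[OF bl, of UNIV]])
      (use z(1) in \<open>auto intro!: continuous_intros\<close>)
  hence "continuous_on (path_image \<gamma>) ?F"
    using cont by (rule bounded_bilinear.continuous_on[OF bounded_bilinear_blinfun_compose])
  then obtain I where I: "has_op_path_integral ?F I \<gamma>"
    using has_op_path_integral_exists[OF \<gamma>] by blast
  have E: "spectral_projection T \<gamma> = cmul (- 1 / (2 * of_real pi * \<i>)) o\<^sub>L J"
    unfolding spectral_projection_def op_path_integral_eq[OF J] by simp
  have target: "has_op_path_integral (\<lambda>w. cmul (1 / (w - z)) + resolvent T w) (cmul (2 * of_real pi * \<i>) + J) \<gamma>"
    using has_op_path_integral_add[OF has_op_path_integral_Cauchy_kernel[OF \<gamma> z(1)] J] z(2) by simp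
  have split: "T - cmul z = (T - cmul w) + cmul (w - z)" for w
    by (simp add: cmul_diff)
  have key: "cmul (1 / (w - z)) o\<^sub>L (resolvent T w o\<^sub>L (T - cmul z)) = cmul (1 / (w - z)) + resolvent T w"
    "cmul (1 / (w - z)) o\<^sub>L ((T - cmul z) o\<^sub>L resolvent T w) = cmul (1 / (w - z)) + resolvent T w"
    if w: "w \<in> path_image \<gamma>" for w
  proof -
    have wr: "w \<in> resolvent_set T" and wz: "w \<noteq> z" using w res z by auto
    have c: "resolvent T w o\<^sub>L cmul (w - z) = cmul (w - z) o\<^sub>L resolvent T w"
      using complex_linear_resolvent[OF T wr] by (simp add: complex_linear_op_def)
    have one: "cmul (1 / (w - z)) o\<^sub>L (cmul (w - z) o\<^sub>L resolvent T w) = resolvent T w"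
      using wz by (simp add: blinfun_compose_assoc[symmetric] cmul_mult)
    show "cmul (1 / (w - z)) o\<^sub>L (resolvent T w o\<^sub>L (T - cmul z)) = cmul (1 / (w - z)) + resolvent T w"
      unfolding split[of w]
      by (simp only: bounded_bilinear.add_right[OF bounded_bilinear_blinfun_compose]
          is_inverse_op_resolvent[OF wr] c one compose_id_blinfun)
    show "cmul (1 / (w - z)) o\<^sub>L ((T - cmul z) o\<^sub>L resolvent T w) = cmul (1 / (w - z)) + resolvent T w"
      unfolding split[of w]
      by (simp only: bounded_bilinear.add_left[OF bounded_bilinear_blinfun_compose]
          bounded_bilinear.add_right[OF bounded_bilinear_blinfun_compose]
          is_inverse_op_resolvent[OF wr] one compose_id_blinfun)
  qed
  have commT: "(T - cmul z) o\<^sub>L cmul c = cmul c o\<^sub>L (T - cmul z)" for c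
    using T by (simp add: complex_linear_op_def compose_simps cmul_mult mult.commute)
  have commT': "(T - cmul z) o\<^sub>L (cmul c o\<^sub>L X) = cmul c o\<^sub>L ((T - cmul z) o\<^sub>L X)" for c X
    using arg_cong[OF commT[of c], of "\<lambda>Y. Y o\<^sub>L X"] by (simp only: blinfun_compose_assoc)
  have right: "I o\<^sub>L (T - cmul z) = cmul (2 * of_real pi * \<i>) + J"
  proof (rule has_op_path_integral_unique[OF _ target])
    show "has_op_path_integral (\<lambda>w. cmul (1 / (w - z)) + resolvent T w) (I o\<^sub>L (T - cmul z)) \<gamma>"
      by (rule has_op_path_integral_linear[OF I, where L = "\<lambda>X. X o\<^sub>L (T - cmul z)"])
        (auto intro: bounded_bilinear.bounded_linear_left[OF bounded_bilinear_blinfun_compose]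
          simp: blinfun_compose_assoc key)
  qed
  have left: "(T - cmul z) o\<^sub>L I = cmul (2 * of_real pi * \<i>) + J"
  proof (rule has_op_path_integral_unique[OF _ target])
    have "(T - cmul z) o\<^sub>L (cmul c o\<^sub>L ?F w) = cmul c o\<^sub>L (cmul (1 / (w - z)) + resolvent T w)"
      if "w \<in> path_image \<gamma>" for c w
    proof -
      have "(T - cmul z) o\<^sub>L (cmul c o\<^sub>L ?F w) = cmul c o\<^sub>L (cmul (1 / (w - z)) o\<^sub>L ((T - cmul z) o\<^sub>L resolvent T w))"
        by (simp only: commT')
      thus ?thesis using key(2)[OF that] by simp
    qed
    thus "has_op_path_integral (\<lambda>w. cmul (1 / (w - z)) + resolvent T w) ((T - cmul z) o\<^sub>L I) \<gamma>"
      by (intro has_op_path_integral_linear[OF I, where L = "\<lambda>X. (T - cmul z) o\<^sub>L X"])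
        (auto intro: bounded_bilinear.bounded_linear_right[OF bounded_bilinear_blinfun_compose])
  qed
  define A where "A = cmul (1 / (2 * of_real pi * \<i>)) o\<^sub>L I"
  have fin: "cmul (1 / (2 * of_real pi * \<i>)) o\<^sub>L (cmul (2 * of_real pi * \<i>) + J) = id_blinfun - spectral_projection T \<gamma>"
  proof -
    have neg: "cmul (- 1 / (2 * of_real pi * \<i>)) = - cmul (1 / (2 * of_real pi * \<i>))"
      using cmul_diff[of 0 "1 / (2 * of_real pi * \<i>)"] by simp
    show ?thesis unfolding E neg
      by (simp add: compose_simps cmul_mult bounded_bilinear.minus_left[OF bounded_bilinear_blinfun_compose])
  qed
  show thesis
  proof (rule that)
    show "A o\<^sub>L (T - cmul z) = id_blinfun - spectral_projection T \<gamma>"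
      unfolding A_def blinfun_compose_assoc right by (rule fin)
    show "(T - cmul z) o\<^sub>L A = id_blinfun - spectral_projection T \<gamma>"
      unfolding A_def commT' left by (rule fin)
    have M0: "0 \<le> M" using M[of "\<gamma> 0"] order_trans[OF norm_ge_zero] by (auto simp: path_image_def)
    have B0: "0 \<le> B"
      using B[of "{{0..1}}"] division_of_self[of 0 "1::real"] by (simp add: order_trans[OF norm_ge_zero])
    have "norm I \<le> M / d * B"
    proof (rule has_op_path_integral_norm_le[OF I B])
      fix w assume w: "w \<in> path_image \<gamma>"
      have "norm (?F w) \<le> norm (1 / (w - z)) * norm (resolvent T w)" by (rule norm_cmul_compose_le)
      also have "\<dots> \<le> 1 / d * M"
        using d(1) d(2)[OF w] M[OF w] by (intro mult_mono) (auto simp: norm_divide intro: divide_left_mono frac_le)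
      finally show "norm (?F w) \<le> M / d" by simp
    qed
    moreover have "norm A \<le> norm (1 / (2 * of_real pi * \<i>)) * norm I" unfolding A_def by (rule norm_cmul_compose_le)
    moreover have "norm (1 / (2 * of_real pi * \<i>)) \<le> 1"
      using pi_ge_two by (simp add: norm_divide norm_mult)
    ultimately have "norm A \<le> norm I" "norm I \<le> M * B / d"
      using mult_right_mono[of "norm (1 / (2 * of_real pi * \<i>))" 1 "norm I"] by auto
    thus "norm A \<le> M * B / d" by linarith
  qed
qed

lemma complex_linear_spectral_projection:
  assumes T: "complex_linear_op T" and \<gamma>: "rectifiable_path \<gamma>"
    and res: "path_image \<gamma> \<subseteq> resolvent_set T"
  shows "complex_linear_op (spectral_projection T \<gamma>)"
proof -
  obtain J where J: "has_op_path_integral (resolvent T) J \<gamma>"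
    using has_op_path_integral_exists[OF \<gamma> continuous_on_resolvent[OF res]] by blast
  have comm: "J o\<^sub>L cmul c = cmul c o\<^sub>L J" for c
  proof (rule has_op_path_integral_unique)
    show "has_op_path_integral (\<lambda>w. cmul c o\<^sub>L resolvent T w) (J o\<^sub>L cmul c) \<gamma>"
    proof (rule has_op_path_integral_linear[OF J, where L = "\<lambda>X. X o\<^sub>L cmul c"])
      show "bounded_linear (\<lambda>X. X o\<^sub>L cmul c)"
        by (rule bounded_bilinear.bounded_linear_left[OF bounded_bilinear_blinfun_compose])
      fix d w assume "w \<in> path_image \<gamma>"
      hence "resolvent T w o\<^sub>L cmul c = cmul c o\<^sub>L resolvent T w"
        using complex_linear_resolvent[OF T] res by (auto simp: complex_linear_op_def)
      thus "(cmul d o\<^sub>L resolvent T w) o\<^sub>L cmul c = cmul d o\<^sub>L (cmul c o\<^sub>L resolvent T w)"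
        by (simp add: blinfun_compose_assoc)
    qed
    show "has_op_path_integral (\<lambda>w. cmul c o\<^sub>L resolvent T w) (cmul c o\<^sub>L J) \<gamma>"
    proof (rule has_op_path_integral_linear[OF J, where L = "\<lambda>X. cmul c o\<^sub>L X"])
      show "bounded_linear (\<lambda>X. cmul c o\<^sub>L X)"
        by (rule bounded_bilinear.bounded_linear_right[OF bounded_bilinear_blinfun_compose])
      show "cmul c o\<^sub>L (cmul d o\<^sub>L resolvent T w) = cmul d o\<^sub>L (cmul c o\<^sub>L resolvent T w)" for d w
        by (simp add: blinfun_compose_assoc[symmetric] cmul_mult mult.commute)
    qed
  qed
  show ?thesis
    unfolding complex_linear_op_def spectral_projection_def op_path_integral_eq[OF J] blinfun_compose_assoc comm
    by (simp add: blinfun_compose_assoc[symmetric] cmul_mult mult.commute)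
qed

section \<open>Orthonormal polynomials on the unit interval\<close>

definition poly_inner :: "real poly \<Rightarrow> real poly \<Rightarrow> real" where
  "poly_inner p q = integral {0..1} (\<lambda>t. poly p t * poly q t)"

lemma poly_prod_integrable: "(\<lambda>t. poly p t * poly q t) integrable_on {0..1::real}"
  by (intro integrable_continuous_real continuous_intros)

lemma poly_inner_commute: "poly_inner p q = poly_inner q p"
  by (simp add: poly_inner_def mult.commute)

lemma poly_inner_diff: "poly_inner (p - q) s = poly_inner p s - poly_inner q s"
  by (simp add: poly_inner_def left_diff_distrib integral_diff poly_prod_integrable)

lemma poly_inner_smult: "poly_inner (smult c p) s = c * poly_inner p s"
  by (simp add: poly_inner_def mult.assoc)

lemma poly_inner_sum: "finite A \<Longrightarrow> poly_inner (\<Sum>i\<in>A. f i) s = (\<Sum>i\<in>A. poly_inner (f i) s)"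
  by (simp add: poly_inner_def poly_sum sum_distrib_right integral_sum poly_prod_integrable)

lemma poly_inner_pos:
  assumes "p \<noteq> 0" shows "poly_inner p p > 0"
proof -
  have "poly_inner p p \<noteq> 0"
  proof
    assume "poly_inner p p = 0"
    hence "\<forall>x\<in>{0..1}. poly p x * poly p x = 0"
      unfolding poly_inner_def by (subst (asm) integral_eq_0_iff) (auto intro!: continuous_intros)
    hence "{0..1} \<subseteq> {x. poly p x = 0}" by auto
    hence "finite {0..1::real}" using poly_roots_finite[OF assms] by (rule finite_subset)
    thus False by (simp add: infinite_Icc)
  qed
  moreover have "poly_inner p p \<ge> 0"
    unfolding poly_inner_def by (intro integral_nonneg poly_prod_integrable) simp
  ultimately show ?thesis by simp
qed

text \<open>
  Gram--Schmidt orthogonalisation of the monomials.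
\<close>
lemma ex_orthonormal_polys:
  "\<exists>q :: nat \<Rightarrow> real poly. (\<forall>i\<le>m. degree (q i) = i) \<and> (\<forall>i\<le>m. q i \<noteq> 0) \<and>
     (\<forall>i\<le>m. \<forall>j\<le>m. poly_inner (q i) (q j) = (if i = j then 1 else 0))"
proof (induction m)
  case 0
  have "poly_inner 1 1 = 1" by (simp add: poly_inner_def)
  thus ?case by (intro exI[of _ "\<lambda>_. 1"]) simp
next
  case (Suc m)
  then obtain q :: "nat \<Rightarrow> real poly" where q: "\<And>i. i \<le> m \<Longrightarrow> degree (q i) = i" "\<And>i. i \<le> m \<Longrightarrow> q i \<noteq> 0"
    "\<And>i j. i \<le> m \<Longrightarrow> j \<le> m \<Longrightarrow> poly_inner (q i) (q j) = (if i = j then 1 else 0)" by blast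
  let ?x = "monom 1 (Suc m) :: real poly"
  define s where "s = (\<Sum>i\<le>m. smult (poly_inner ?x (q i)) (q i))"
  define f where "f = ?x - s"
  have "degree s \<le> m"
    unfolding s_def by (intro degree_sum_le) (auto intro: order_trans[OF degree_smult_le] simp: q(1))
  hence "degree (- s) < degree ?x" by (simp add: degree_monom_eq)
  hence df: "degree f = Suc m"
    unfolding f_def diff_conv_add_uminus by (subst degree_add_eq_left) (simp_all add: degree_monom_eq)
  hence f0: "f \<noteq> 0" by auto
  have orth: "poly_inner f (q j) = 0" if "j \<le> m" for j
    using that by (simp add: f_def s_def poly_inner_diff poly_inner_sum poly_inner_smult q(3) if_distrib cong: if_cong)
  define c where "c = 1 / sqrt (poly_inner f f)"
  have c: "c \<noteq> 0" "c * (c * poly_inner f f) = 1"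
    using poly_inner_pos[OF f0] by (auto simp: c_def field_simps)
  define q' where "q' = q(Suc m := smult c f)"
  have "degree (q' i) = i \<and> q' i \<noteq> 0" if "i \<le> Suc m" for i
    using that q(1,2)[of i] c df f0 by (cases "i = Suc m") (auto simp: q'_def)
  moreover have "poly_inner (q' i) (q' j) = (if i = j then 1 else 0)" if "i \<le> Suc m" "j \<le> Suc m" for i j
  proof -
    have comm: "poly_inner (q i) (smult c f) = c * poly_inner f (q i)" for i
      by (subst poly_inner_commute) (simp add: poly_inner_smult)
    have "poly_inner (smult c f) (smult c f) = 1"
      by (subst poly_inner_smult, subst poly_inner_commute, subst poly_inner_smult) (rule c(2))
    thus ?thesis
      using that orth[of i] orth[of j] q(3)[of i j]
      by (cases "i = Suc m"; cases "j = Suc m") (auto simp: q'_def poly_inner_smult comm)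
  qed
  ultimately show ?case by blast
qed

lemma poly_map_poly_of_real: "poly (map_poly complex_of_real p) (of_real t) = of_real (poly p t)"
  by (induction p) (auto simp: map_poly_pCons)

lemma degree_le_if_coeff_eq_0:
  fixes p :: "'a::zero poly"
  assumes "degree p \<le> Suc m" "coeff p (Suc m) = 0"
  shows "degree p \<le> m"
proof (rule degree_le, intro allI impI)
  fix i assume "m < i"
  thus "coeff p i = 0"
    using assms coeff_eq_0[of p i] by (cases "i = Suc m") auto
qed

text \<open>
  Real orthonormal polynomials of degrees \<open>0, ..., m\<close> also span the complex polynomials, by
  successively removing leading coefficients.
\<close>
lemma poly_combination:
  fixes q :: "nat \<Rightarrow> real poly" and p :: "complex poly"
  assumes q: "\<And>i. i \<le> m \<Longrightarrow> degree (q i) = i" "\<And>i. i \<le> m \<Longrightarrow> q i \<noteq> 0"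
  shows "degree p \<le> m \<Longrightarrow> \<exists>c. \<forall>t. poly p (of_real t) = (\<Sum>i\<le>m. c i * of_real (poly (q i) t))"
  using assms
proof (induction m arbitrary: p)
  case 0
  obtain a where a: "p = [:a:]" using 0 degree_eq_zeroE[of p] by auto
  obtain b where b: "q 0 = [:b:]" using 0 degree_eq_zeroE[of "q 0"] by auto
  have "b \<noteq> 0" using 0 b by auto
  thus ?case by (intro exI[of _ "\<lambda>_. a / of_real b"]) (simp add: a b)
next
  case (Suc m)
  let ?Q = "map_poly complex_of_real (q (Suc m))"
  have ev: "poly ?Q (of_real t) = of_real (poly (q (Suc m)) t)" for t
    by (rule poly_map_poly_of_real)
  have dQ: "degree ?Q = Suc m"
    using Suc.prems(2)[of "Suc m"] by (simp add: degree_map_poly)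
  define a where "a = coeff p (Suc m) / coeff ?Q (Suc m)"
  have Q0: "coeff ?Q (Suc m) \<noteq> 0" using leading_coeff_neq_0[of ?Q] dQ by fastforce
  have "degree (p - smult a ?Q) \<le> Suc m"
    using Suc.prems(1) dQ by (intro degree_diff_le) (auto intro: order_trans[OF degree_smult_le])
  moreover have "coeff (p - smult a ?Q) (Suc m) = 0" using Q0 by (simp add: a_def)
  ultimately have "degree (p - smult a ?Q) \<le> m" by (rule degree_le_if_coeff_eq_0)
  hence "\<exists>c. \<forall>t. poly (p - smult a ?Q) (of_real t) = (\<Sum>i\<le>m. c i * of_real (poly (q i) t))"
    by (rule Suc.IH) (simp_all add: Suc.prems(2,3))
  then obtain c where c: "\<forall>t. poly (p - smult a ?Q) (of_real t) = (\<Sum>i\<le>m. c i * of_real (poly (q i) t))" ..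
  show ?case
  proof (intro exI allI)
    fix t
    show "poly p (of_real t) = (\<Sum>i\<le>Suc m. (c(Suc m := a)) i * of_real (poly (q i) t))"
      using c[rule_format, of t] by (simp add: ev algebra_simps)
  qed
qed

section \<open>Projection onto polynomials on one cell\<close>

definition cell :: "nat \<Rightarrow> nat \<Rightarrow> real set" where
  "cell n j = {real j / real n .. real (Suc j) / real n}"

lemma cell_subset: "j < n \<Longrightarrow> cell n j \<subseteq> {0..1}"
  by (auto simp: cell_def field_simps)

lemma cell_sets [simp]: "cell n j \<in> sets lebesgue"
  by (simp add: cell_def)

lemma finite_measure_cell: "finite_measure (lebesgue_on (cell n j))"
  by (rule finite_measureI) (simp add: cell_def emeasure_restrict_space emeasure_lborel_Icc_eq)

lemma measure_cell: "n \<ge> 1 \<Longrightarrow> measure (lebesgue_on (cell n j)) (cell n j) = 1 / real n"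
  by (simp add: cell_def measure_restrict_space field_simps)

lemma AE_lebesgue_on_subset:
  assumes "AE t in lebesgue_on S. P t" "T \<subseteq> S" "S \<in> sets lebesgue" "T \<in> sets lebesgue"
  shows "AE t in lebesgue_on T. P t"
proof -
  have "AE t in lebesgue. t \<in> S \<longrightarrow> P t" using assms by (subst (asm) AE_restrict_space_iff) auto
  hence "AE t in lebesgue. t \<in> T \<longrightarrow> P t" by eventually_elim (use assms(2) in auto)
  thus ?thesis using assms by (subst AE_restrict_space_iff) auto
qed

lemma AE_cell:
  assumes "AE t in unit_lebesgue. P t" "j < n"
  shows "AE t in lebesgue_on (cell n j). P t"
  by (rule AE_lebesgue_on_subset[OF assms(1) cell_subset[OF assms(2)]]) auto

lemma AE_cell_mem: "AE t in lebesgue_on (cell n j). t \<in> cell n j"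
  using AE_space[of "lebesgue_on (cell n j)"] by simp

lemma cells_cover:
  assumes "n \<ge> 1" "t \<in> {0..1::real}"
  shows "\<exists>j<n. t \<in> cell n j"
proof (cases "t = 1")
  case True
  have "t \<in> cell n (n - 1)" using assms True by (auto simp: cell_def field_simps)
  thus ?thesis using assms by (intro exI[of _ "n - 1"]) auto
next
  case False
  define j where "j = nat \<lfloor>real n * t\<rfloor>"
  have j: "real j \<le> real n * t" "real n * t < real j + 1" using assms by (auto simp: j_def)
  have "real n * t < real n" using False assms by simp
  hence "j < n" using j by linarith
  moreover have "t \<in> cell n j" using j assms by (auto simp: cell_def field_simps)
  ultimately show ?thesis by blast
qed

lemma AE_unit_of_cells:
  assumes "n \<ge> 1" "\<And>j. j < n \<Longrightarrow> AE t in lebesgue_on (cell n j). P t"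
  shows "AE t in unit_lebesgue. P t"
proof -
  have "\<forall>j\<in>{..<n}. AE t in lebesgue. t \<in> cell n j \<longrightarrow> P t"
    using assms(2) by (auto simp: AE_restrict_space_iff)
  hence "AE t in lebesgue. \<forall>j\<in>{..<n}. t \<in> cell n j \<longrightarrow> P t"
    by (subst AE_finite_all) simp_all
  hence "AE t in lebesgue. t \<in> {0..1} \<longrightarrow> P t"
    by eventually_elim (use cells_cover[OF assms(1)] in blast)
  thus ?thesis by (subst AE_restrict_space_iff) auto
qed

lemma integrable_cell:
  fixes f :: "real \<Rightarrow> complex"
  assumes "integrable unit_lebesgue f" "j < n"
  shows "integrable (lebesgue_on (cell n j)) f"
  unfolding cell_def
  by (rule integrable_subinterval[OF assms(1)]) (use cell_subset[OF assms(2)] in \<open>simp add: cell_def\<close>)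

lemma integral_cells:
  fixes f :: "real \<Rightarrow> complex"
  assumes f: "integrable unit_lebesgue f" and n: "n \<ge> 1"
  shows "(LINT t|unit_lebesgue. f t) = (\<Sum>j<n. LINT t|lebesgue_on (cell n j). f t)"
proof -
  have "(LINT t|lebesgue_on {0..real k / real n}. f t) = (\<Sum>j<k. LINT t|lebesgue_on (cell n j). f t)" if "k \<le> n" for k
    using that
  proof (induction k)
    case 0
    have "emeasure (lebesgue_on {0::real}) (space (lebesgue_on {0})) = 0"
      by (simp add: emeasure_restrict_space)
    thus ?case by (simp add: integral_eq_zero_null_sets null_sets_def)
  next
    case (Suc k)
    have "integrable (lebesgue_on {0..real (Suc k) / real n}) f"
      by (rule integrable_subinterval[OF f]) (use Suc.prems n in \<open>auto simp: field_simps\<close>)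
    hence "(LINT t|lebesgue_on {0..real (Suc k) / real n}. f t)
        = (LINT t|lebesgue_on {0..real k / real n}. f t) + (LINT t|lebesgue_on {real k / real n..real (Suc k) / real n}. f t)"
      by (rule integral_combine) (auto intro!: divide_right_mono)
    thus ?case using Suc by (simp add: cell_def)
  qed
  from this[of n] show ?thesis using n by simp
qed

lemma norm_LINT_cell_le:
  fixes f :: "real \<Rightarrow> complex"
  assumes f: "integrable (lebesgue_on (cell n j)) f" and n: "n \<ge> 1"
    and C: "AE t in lebesgue_on (cell n j). norm (f t) \<le> C"
  shows "norm (LINT t|lebesgue_on (cell n j). f t) \<le> C / real n"
proof -
  have "norm (LINT t|lebesgue_on (cell n j). f t) \<le> (LINT t|lebesgue_on (cell n j). norm (f t))"
    by (rule integral_norm_bound)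
  also have "\<dots> \<le> (LINT t|lebesgue_on (cell n j). C)"
    by (rule integral_mono_AE[OF integrable_norm[OF f]
        finite_measure.integrable_const[OF finite_measure_cell] C])
  also have "\<dots> = C / real n" using measure_cell[OF n, of j] by simp
  finally show ?thesis .
qed

lemma ess_bounded_mult_continuous:
  assumes f: "ess_bounded f" and k: "continuous_on {0..1} k"
  shows "ess_bounded (\<lambda>t. k t * f t)"
proof -
  have "compact (k ` {0..1})" by (rule compact_continuous_image[OF k]) simp
  hence "bounded (k ` {0..1})" by (rule compact_imp_bounded)
  then obtain B where "\<forall>x\<in>k ` {0..1}. norm x \<le> B" unfolding bounded_iff ..
  hence "norm (k t) \<le> B" if "t \<in> {0..1}" for t using that by blast
  moreover have "k \<in> borel_measurable unit_lebesgue"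
    by (rule continuous_imp_measurable_on_sets_lebesgue[OF k]) simp
  ultimately show ?thesis by (rule norm_integral_le(1)[OF f])
qed

lemma ess_bounded_continuous: "continuous_on {0..1} k \<Longrightarrow> ess_bounded k"
  using ess_bounded_mult_continuous[of "\<lambda>_. 1" k] by (auto simp: ess_bounded_def)

lemma integrable_cell_mult:
  assumes "ess_bounded f" "continuous_on {0..1} k" "j < n"
  shows "integrable (lebesgue_on (cell n j)) (\<lambda>t. k t * f t)"
  by (rule integrable_cell[OF ess_bounded_integrable[OF ess_bounded_mult_continuous[OF assms(1,2)]] assms(3)])

text \<open>
  Normalised shifted Legendre polynomials, up to sign. They are fixed by a choice, as only
  orthonormality and the degrees matter.
\<close>
definition legendre :: "nat \<Rightarrow> nat \<Rightarrow> real poly" where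
  "legendre m = (SOME q. (\<forall>i\<le>m. degree (q i) = i) \<and> (\<forall>i\<le>m. q i \<noteq> 0) \<and>
     (\<forall>i\<le>m. \<forall>j\<le>m. poly_inner (q i) (q j) = (if i = j then 1 else 0)))"

lemma legendre:
  "i \<le> m \<Longrightarrow> degree (legendre m i) = i" "i \<le> m \<Longrightarrow> legendre m i \<noteq> 0"
  "i \<le> m \<Longrightarrow> k \<le> m \<Longrightarrow> poly_inner (legendre m i) (legendre m k) = (if i = k then 1 else 0)"
  using someI_ex[OF ex_orthonormal_polys[of m]] unfolding legendre_def by auto

text \<open>
  The factor \<open>n\<close> in the argument maps the cell to \<open>[0,1]\<close>. All cells thus share one finite family of
  polynomials, which makes the bounds below uniform in \<open>n\<close>; the functions are orthogonal on the cell
  with squared norm \<open>1/n\<close>.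
\<close>
definition cell_basis :: "nat \<Rightarrow> nat \<Rightarrow> nat \<Rightarrow> nat \<Rightarrow> real \<Rightarrow> complex" where
  "cell_basis m n j i t = of_real (poly (legendre m i) (real n * t - real j))"

lemma continuous_on_cell_basis: "continuous_on S (cell_basis m n j i)"
  unfolding cell_basis_def by (intro continuous_intros)

lemma cell_basis_orthonormal:
  assumes n: "n \<ge> 1" and "i \<le> m" "k \<le> m"
  shows "(LINT t|lebesgue_on (cell n j). cell_basis m n j i t * cell_basis m n j k t) = (if i = k then 1 / of_nat n else 0)"
proof -
  let ?f = "\<lambda>t. poly (legendre m i) t * poly (legendre m k) t"
  have "(?f has_integral poly_inner (legendre m i) (legendre m k)) (cbox 0 1)"
    unfolding poly_inner_def using poly_prod_integrable by (simp add: integrable_integral)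
  from has_integral_affinity'[OF this, of "real n" "- real j"] n
  have "((\<lambda>t. ?f (real n * t - real j)) has_integral (if i = k then 1 / real n else 0)) (cell n j)"
    using legendre(3)[OF assms(2,3)] by (auto simp: cell_def field_simps)
  hence "((\<lambda>t. complex_of_real (?f (real n * t - real j))) has_integral of_real (if i = k then 1 / real n else 0)) (cell n j)"
    by (rule has_integral_of_real)
  hence "((\<lambda>t. cell_basis m n j i t * cell_basis m n j k t) has_integral (if i = k then 1 / of_nat n else 0)) (cell n j)"
    unfolding cell_basis_def by (simp add: if_distrib[of complex_of_real] cong: if_cong)
  moreover have "integrable (lebesgue_on (cell n j)) (\<lambda>t. cell_basis m n j i t * cell_basis m n j k t)"
    unfolding cell_def by (intro continuous_imp_integrable_real continuous_intros continuous_on_cell_basis)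
  ultimately show ?thesis
    by (simp add: lebesgue_integral_eq_integral integral_unique)
qed

lemma poly_cell_basis:
  assumes p: "degree p \<le> m" and n: "n \<ge> 1"
  obtains c where "\<And>t. poly p (complex_of_real t) = (\<Sum>i\<le>m. c i * cell_basis m n j i t)"
proof -
  define p' where "p' = pcompose p [:of_real (real j / real n), of_real (1 / real n):]"
  have "degree p' \<le> m"
    unfolding p'_def using degree_pcompose_le[of p "[:of_real (real j / real n), of_real (1 / real n):]"] p
    by (simp split: if_splits)
  then obtain c where c: "\<forall>t. poly p' (of_real t) = (\<Sum>i\<le>m. c i * of_real (poly (legendre m i) t))"
    using poly_combination[of m "legendre m" p'] legendre by metis
  have "poly p (complex_of_real t) = (\<Sum>i\<le>m. c i * cell_basis m n j i t)" for t
  proof -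
    have "complex_of_real t = of_real (real j / real n) + of_real (real n * t - real j) * of_real (1 / real n)"
      unfolding of_real_mult[symmetric] of_real_add[symmetric] using n by (simp add: field_simps)
    hence "poly p (complex_of_real t) = poly p' (of_real (real n * t - real j))"
      by (simp add: p'_def poly_pcompose mult.commute)
    also have "\<dots> = (\<Sum>i\<le>m. c i * cell_basis m n j i t)"
      unfolding cell_basis_def by (rule c[rule_format])
    finally show ?thesis .
  qed
  thus thesis by (rule that)
qed

definition cell_coeff :: "nat \<Rightarrow> nat \<Rightarrow> nat \<Rightarrow> (real \<Rightarrow> complex) \<Rightarrow> nat \<Rightarrow> complex" where
  "cell_coeff m n j f i = of_nat n * (LINT t|lebesgue_on (cell n j). cell_basis m n j i t * f t)"

definition cell_proj :: "nat \<Rightarrow> nat \<Rightarrow> nat \<Rightarrow> (real \<Rightarrow> complex) \<Rightarrow> real \<Rightarrow> complex" where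
  "cell_proj m n j f s = (\<Sum>i\<le>m. cell_coeff m n j f i * cell_basis m n j i s)"

lemma continuous_on_cell_proj: "continuous_on S (cell_proj m n j f)"
  unfolding cell_proj_def by (intro continuous_intros continuous_on_cell_basis)

lemma cell_proj_diff:
  assumes "ess_bounded f" "ess_bounded g" "j < n"
  shows "cell_proj m n j (\<lambda>t. f t - g t) s = cell_proj m n j f s - cell_proj m n j g s"
  using integrable_cell_mult[OF assms(1) continuous_on_cell_basis assms(3)]
    integrable_cell_mult[OF assms(2) continuous_on_cell_basis assms(3)]
  by (simp add: cell_proj_def cell_coeff_def right_diff_distrib left_diff_distrib sum_subtractf)

lemma cell_coeff_combination:
  assumes "j < n" "k \<le> m"
  shows "cell_coeff m n j (\<lambda>t. \<Sum>i\<le>m. c i * cell_basis m n j i t) k = c k"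
proof -
  have n: "n \<ge> 1" using assms by simp
  have int: "integrable (lebesgue_on (cell n j)) (\<lambda>t. cell_basis m n j k t * cell_basis m n j i t)" for i
    unfolding cell_def by (intro continuous_imp_integrable_real continuous_intros continuous_on_cell_basis)
  have "(LINT t|lebesgue_on (cell n j). cell_basis m n j k t * (\<Sum>i\<le>m. c i * cell_basis m n j i t))
      = (LINT t|lebesgue_on (cell n j). (\<Sum>i\<le>m. c i * (cell_basis m n j k t * cell_basis m n j i t)))"
    by (simp add: sum_distrib_left mult_ac)
  also have "\<dots> = (\<Sum>i\<le>m. c i * (if k = i then 1 / of_nat n else 0))"
    by (subst Bochner_Integration.integral_sum)
      (auto simp: int cell_basis_orthonormal[OF n assms(2)] intro!: sum.cong)
  also have "\<dots> = c k / of_nat n" using assms by (simp add: if_distrib cong: if_cong)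
  finally show ?thesis using n by (simp add: cell_coeff_def)
qed

lemma cell_proj_poly:
  assumes "degree p \<le> m" "j < n"
  shows "cell_proj m n j (\<lambda>t. poly p (complex_of_real t)) s = poly p (of_real s)"
proof -
  have n: "n \<ge> 1" using assms by simp
  obtain c where c: "\<And>t. poly p (complex_of_real t) = (\<Sum>i\<le>m. c i * cell_basis m n j i t)"
    using poly_cell_basis[OF assms(1) n] by blast
  show ?thesis unfolding cell_proj_def c
    by (intro sum.cong refl) (simp add: cell_coeff_combination[OF assms(2)])
qed

definition legendre_bound :: "nat \<Rightarrow> real" where
  "legendre_bound m = (SOME M. M \<ge> 1 \<and> (\<forall>i\<le>m. \<forall>t\<in>{0..1}. \<bar>poly (legendre m i) t\<bar> \<le> M))"

lemma legendre_bound: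
  "legendre_bound m \<ge> 1" "i \<le> m \<Longrightarrow> t \<in> {0..1} \<Longrightarrow> \<bar>poly (legendre m i) t\<bar> \<le> legendre_bound m"
proof -
  have "\<exists>B. \<forall>t\<in>{0..1}. \<bar>poly (legendre m i) t\<bar> \<le> B" for i
  proof -
    have "compact (poly (legendre m i) ` {0..1})"
      by (intro compact_continuous_image continuous_intros) auto
    thus ?thesis by (auto dest!: compact_imp_bounded simp: bounded_iff)
  qed
  then obtain B where B: "\<And>i t. t \<in> {0..1} \<Longrightarrow> \<bar>poly (legendre m i) t\<bar> \<le> B i" by metis
  define M where "M = Max (insert 1 (B ` {..m}))"
  have "M \<ge> 1" by (simp add: M_def)
  moreover have "\<bar>poly (legendre m i) t\<bar> \<le> M" if "i \<le> m" "t \<in> {0..1}" for i t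
  proof -
    have "B i \<le> M" using that unfolding M_def by (intro Max_ge) auto
    thus ?thesis using B[OF that(2), of i] by linarith
  qed
  ultimately have "\<exists>M. M \<ge> 1 \<and> (\<forall>i\<le>m. \<forall>t\<in>{0..1}. \<bar>poly (legendre m i) t\<bar> \<le> M)" by blast
  from someI_ex[OF this] show "legendre_bound m \<ge> 1" "i \<le> m \<Longrightarrow> t \<in> {0..1} \<Longrightarrow> \<bar>poly (legendre m i) t\<bar> \<le> legendre_bound m"
    unfolding legendre_bound_def by blast+
qed

lemma norm_cell_basis_le:
  assumes "i \<le> m" "t \<in> cell n j" "n \<ge> 1"
  shows "norm (cell_basis m n j i t) \<le> legendre_bound m"
  unfolding cell_basis_def norm_of_real
  by (rule legendre_bound(2)[OF assms(1)]) (use assms(2,3) in \<open>auto simp: cell_def field_simps\<close>)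

lemma norm_cell_coeff_le:
  assumes f: "ess_bounded f" and j: "j < n" and i: "i \<le> m"
    and d: "AE t in lebesgue_on (cell n j). norm (f t) \<le> \<delta>"
  shows "norm (cell_coeff m n j f i) \<le> legendre_bound m * \<delta>"
proof -
  have n: "n \<ge> 1" using j by simp
  have "norm (LINT t|lebesgue_on (cell n j). cell_basis m n j i t * f t) \<le> legendre_bound m * \<delta> / real n"
  proof (rule norm_LINT_cell_le[OF integrable_cell_mult[OF f continuous_on_cell_basis j] n])
    show "AE t in lebesgue_on (cell n j). norm (cell_basis m n j i t * f t) \<le> legendre_bound m * \<delta>"
      using d AE_cell_mem
    proof eventually_elim
      case (elim t)
      show ?case using norm_cell_basis_le[OF i elim(2) n] elim(1) legendre_bound(1)[of m]
        by (simp add: norm_mult mult_mono)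
    qed
  qed
  thus ?thesis using n by (simp add: cell_coeff_def norm_mult field_simps)
qed

text \<open>
  The bound in the supremum norm, uniform in \<open>n\<close>: coefficients and basis functions are both
  controlled by the largest value of the Legendre polynomials.
\<close>
lemma norm_cell_proj_le:
  assumes f: "ess_bounded f" and j: "j < n"
    and d: "AE t in lebesgue_on (cell n j). norm (f t) \<le> \<delta>" and s: "s \<in> cell n j" and d0: "0 \<le> \<delta>"
  shows "norm (cell_proj m n j f s) \<le> real (Suc m) * (legendre_bound m)\<^sup>2 * \<delta>"
proof -
  have n: "n \<ge> 1" using j by simp
  have "norm (cell_proj m n j f s) \<le> (\<Sum>i\<le>m. (legendre_bound m * \<delta>) * legendre_bound m)"
    unfolding cell_proj_def
  proof (rule sum_norm_le)
    fix i assume "i \<in> {..m}"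
    hence i: "i \<le> m" by simp
    show "norm (cell_coeff m n j f i * cell_basis m n j i s) \<le> (legendre_bound m * \<delta>) * legendre_bound m"
      unfolding norm_mult
      using norm_cell_coeff_le[OF f j i d] norm_cell_basis_le[OF i s n] legendre_bound(1)[of m] d0
      by (intro mult_mono) auto
  qed
  thus ?thesis by (simp add: power2_eq_square mult_ac)
qed

lemma cell_proj_residual_orthogonal:
  assumes f: "ess_bounded f" and j: "j < n" and p: "degree p \<le> m"
  shows "(LINT t|lebesgue_on (cell n j). poly p (complex_of_real t) * (f t - cell_proj m n j f t)) = 0"
proof -
  have n: "n \<ge> 1" using j by simp
  have basis: "(LINT t|lebesgue_on (cell n j). cell_basis m n j k t * (f t - cell_proj m n j f t)) = 0" if k: "k \<le> m" for k
  proof -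
    have c1: "cell_coeff m n j (cell_proj m n j f) k = cell_coeff m n j f k"
      using cell_coeff_combination[OF j k, of "cell_coeff m n j f"] unfolding cell_proj_def[symmetric] .
    have "(LINT t|lebesgue_on (cell n j). cell_basis m n j k t * cell_proj m n j f t) = cell_coeff m n j f k / of_nat n"
      using c1 n by (simp add: cell_coeff_def[of m n j "cell_proj m n j f"] field_simps)
    moreover have "(LINT t|lebesgue_on (cell n j). cell_basis m n j k t * f t) = cell_coeff m n j f k / of_nat n"
      using n by (simp add: cell_coeff_def)
    moreover have "integrable (lebesgue_on (cell n j)) (\<lambda>t. cell_basis m n j k t * f t)"
      by (rule integrable_cell_mult[OF f continuous_on_cell_basis j])
    moreover have "integrable (lebesgue_on (cell n j)) (\<lambda>t. cell_basis m n j k t * cell_proj m n j f t)"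
      unfolding cell_def by (intro continuous_imp_integrable_real continuous_intros continuous_on_cell_basis continuous_on_cell_proj)
    ultimately show ?thesis by (simp add: right_diff_distrib)
  qed
  obtain c where c: "\<And>t. poly p (complex_of_real t) = (\<Sum>i\<le>m. c i * cell_basis m n j i t)"
    using poly_cell_basis[OF p n] by blast
  have eb: "ess_bounded (\<lambda>t. f t - cell_proj m n j f t)"
    by (intro ess_bounded_diff f ess_bounded_continuous continuous_on_cell_proj)
  have "(LINT t|lebesgue_on (cell n j). poly p (complex_of_real t) * (f t - cell_proj m n j f t))
     = (LINT t|lebesgue_on (cell n j). (\<Sum>i\<le>m. c i * (cell_basis m n j i t * (f t - cell_proj m n j f t))))"
    by (simp add: c sum_distrib_right mult.assoc)
  also have "\<dots> = (\<Sum>i\<le>m. c i * (LINT t|lebesgue_on (cell n j). cell_basis m n j i t * (f t - cell_proj m n j f t)))"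
    by (subst Bochner_Integration.integral_sum)
      (auto intro!: integrable_mult_right integrable_cell_mult[OF eb continuous_on_cell_basis j])
  also have "\<dots> = 0" by (simp add: basis)
  finally show ?thesis .
qed

section \<open>The orthogonal projection onto piecewise polynomials\<close>

text \<open>
  Half-open cells are disjoint, so at most one summand is nonzero at each point; the point 1, which
  none of them contains, is null.
\<close>
definition pw_proj :: "nat \<Rightarrow> nat \<Rightarrow> (real \<Rightarrow> complex) \<Rightarrow> real \<Rightarrow> complex" where
  "pw_proj m n f s = (\<Sum>j<n. indicator {real j / real n..<real (Suc j) / real n} s * cell_proj m n j f s)"

lemma pw_proj_eq:
  assumes j: "j < n" and s: "s \<in> {real j / real n..<real (Suc j) / real n}"
  shows "pw_proj m n f s = cell_proj m n j f s"
proof -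
  have n: "real n > 0" using j by simp
  have "indicator {real k / real n..<real (Suc k) / real n} s = (if k = j then 1 else (0::complex))" for k
  proof (cases "k = j")
    case False
    have s': "real j \<le> s * real n" "s * real n < real j + 1" using s n by (auto simp: field_simps)
    have "s \<notin> {real k / real n..<real (Suc k) / real n}"
    proof
      assume "s \<in> {real k / real n..<real (Suc k) / real n}"
      hence "real k \<le> s * real n" "s * real n < real k + 1" using n by (auto simp: field_simps)
      hence "real k < real j + 1" "real j < real k + 1" using s' by linarith+
      thus False using False by linarith
    qed
    thus ?thesis using False by simp
  qed (use s in simp)
  hence "pw_proj m n f s = (\<Sum>k<n. if k = j then cell_proj m n k f s else 0)"
    unfolding pw_proj_def by (intro sum.cong) auto
  also have "\<dots> = cell_proj m n j f s" using j by simp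
  finally show ?thesis .
qed

lemma AE_lebesgue_on_neq: "S \<in> sets lebesgue \<Longrightarrow> AE t in lebesgue_on S. t \<noteq> (c::real)"
  using AE_completion[OF AE_lborel_singleton[of c]]
  by (subst AE_restrict_space_iff) (auto elim: eventually_mono)

lemma pw_proj_AE:
  assumes j: "j < n"
  shows "AE t in lebesgue_on (cell n j). pw_proj m n f t = cell_proj m n j f t"
  using AE_cell_mem AE_lebesgue_on_neq[where c = "real (Suc j) / real n", OF cell_sets]
proof eventually_elim
  case (elim t)
  thus ?case by (intro pw_proj_eq j) (auto simp: cell_def)
qed

definition proj_const :: "nat \<Rightarrow> real" where
  "proj_const m = 1 + real (Suc m) * (legendre_bound m)\<^sup>2"

lemma proj_const_ge_1: "proj_const m \<ge> 1"
  by (simp add: proj_const_def)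

lemma norm_pw_proj_le:
  assumes f: "ess_bounded f" and n: "n \<ge> 1"
  shows "AE t in unit_lebesgue. norm (pw_proj m n f t) \<le> proj_const m * linf_norm f"
proof (rule AE_unit_of_cells[OF n])
  fix j assume j: "j < n"
  note d = AE_cell[OF linf_norm_AE[OF f] j] and d0 = esssup_linf_norm(2)[OF f]
  show "AE t in lebesgue_on (cell n j). norm (pw_proj m n f t) \<le> proj_const m * linf_norm f"
    using pw_proj_AE[OF j, of m f] AE_cell_mem
  proof eventually_elim
    case (elim t)
    have "norm (pw_proj m n f t) \<le> real (Suc m) * (legendre_bound m)\<^sup>2 * linf_norm f"
      using norm_cell_proj_le[OF f j d elim(2) d0] elim(1) by simp
    also have "\<dots> \<le> proj_const m * linf_norm f"
      using d0 by (intro mult_right_mono) (simp_all add: proj_const_def)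
    finally show ?case .
  qed
qed

lemma ess_bounded_pw_proj:
  assumes f: "ess_bounded f" and n: "n \<ge> 1"
  shows "ess_bounded (pw_proj m n f)"
  unfolding ess_bounded_def
proof (intro conjI exI)
  have "(\<lambda>s. indicator {real j / real n..<real (Suc j) / real n} s * cell_proj m n j f s) \<in> borel_measurable unit_lebesgue" for j
  proof (intro borel_measurable_times)
    show "(indicator {real j / real n..<real (Suc j) / real n} :: real \<Rightarrow> complex) \<in> borel_measurable unit_lebesgue"
      by (intro measurable_restrict_space1 borel_measurable_indicator) (intro sets_completionI_sets, simp)
    show "cell_proj m n j f \<in> borel_measurable unit_lebesgue"
      by (rule continuous_imp_measurable_on_sets_lebesgue[OF continuous_on_cell_proj]) simp
  qed
  thus "pw_proj m n f \<in> borel_measurable unit_lebesgue"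
    unfolding pw_proj_def by (intro borel_measurable_sum)
  show "AE t in unit_lebesgue. norm (pw_proj m n f t) \<le> proj_const m * linf_norm f"
    by (rule norm_pw_proj_le[OF f n])
qed

lemma pw_proj_residual_orthogonal:
  assumes f: "ess_bounded f" and j: "j < n" and p: "degree p \<le> m"
    and w: "AE t in lebesgue_on (cell n j). w t = f t - pw_proj m n f t" and wb: "ess_bounded w"
  shows "(LINT t|lebesgue_on (cell n j). poly p (complex_of_real t) * w t) = 0"
proof -
  have cp: "continuous_on {0..1} (\<lambda>t. poly p (complex_of_real t))"
    by (intro continuous_intros)
  have eb: "ess_bounded (\<lambda>t. f t - cell_proj m n j f t)"
    by (intro ess_bounded_diff f ess_bounded_continuous continuous_on_cell_proj)
  have "(LINT t|lebesgue_on (cell n j). poly p (complex_of_real t) * w t)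
      = (LINT t|lebesgue_on (cell n j). poly p (complex_of_real t) * (f t - cell_proj m n j f t))"
  proof (rule integral_cong_AE)
    show "(\<lambda>t. poly p (complex_of_real t) * w t) \<in> borel_measurable (lebesgue_on (cell n j))"
      using integrable_cell_mult[OF wb cp j] by simp
    show "(\<lambda>t. poly p (complex_of_real t) * (f t - cell_proj m n j f t)) \<in> borel_measurable (lebesgue_on (cell n j))"
      using integrable_cell_mult[OF eb cp j] by simp
    show "AE t in lebesgue_on (cell n j). poly p (complex_of_real t) * w t = poly p (complex_of_real t) * (f t - cell_proj m n j f t)"
      using w pw_proj_AE[OF j, of m f] by eventually_elim simp
  qed
  thus ?thesis using cell_proj_residual_orthogonal[OF f j p] by simp
qed

text \<open>
  The local projection reproduces polynomials, so the error of \<open>f\<close> equals that of \<open>f - p\<close>.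
\<close>
lemma pw_proj_residual_le:
  assumes f: "ess_bounded f" and j: "j < n" and p: "degree p \<le> m"
    and e: "AE t in lebesgue_on (cell n j). norm (f t - poly p (complex_of_real t)) \<le> \<epsilon>" and e0: "0 \<le> \<epsilon>"
  shows "AE t in lebesgue_on (cell n j). norm (f t - pw_proj m n f t) \<le> proj_const m * \<epsilon>"
proof -
  let ?p = "\<lambda>t. poly p (complex_of_real t)"
  have pb: "ess_bounded ?p" by (intro ess_bounded_continuous continuous_intros)
  have eb: "ess_bounded (\<lambda>t. f t - ?p t)" by (intro ess_bounded_diff f pb)
  show ?thesis using e pw_proj_AE[OF j, of m f] AE_cell_mem
  proof eventually_elim
    case (elim t)
    have "f t - pw_proj m n f t = (f t - ?p t) - cell_proj m n j (\<lambda>t. f t - ?p t) t"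
      using elim(2) by (simp add: cell_proj_diff[OF f pb j] cell_proj_poly[OF p j])
    also have "norm \<dots> \<le> norm (f t - ?p t) + norm (cell_proj m n j (\<lambda>t. f t - ?p t) t)"
      by (rule norm_triangle_ineq4)
    also have "\<dots> \<le> \<epsilon> + real (Suc m) * (legendre_bound m)\<^sup>2 * \<epsilon>"
      using elim(1) norm_cell_proj_le[OF eb j e elim(3) e0] by (rule add_mono)
    finally show ?case by (simp add: proj_const_def algebra_simps)
  qed
qed

lemma ess_bounded_mult:
  assumes "ess_bounded f" "ess_bounded g"
  shows "ess_bounded (\<lambda>t. f t * g t)"
proof -
  have "AE t in unit_lebesgue. norm (f t * g t) \<le> linf_norm f * linf_norm g"
    using linf_norm_AE[OF assms(1)] linf_norm_AE[OF assms(2)]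
    by eventually_elim (simp add: norm_mult mult_mono esssup_linf_norm(2)[OF assms(1)])
  thus ?thesis using assms by (auto simp: ess_bounded_def)
qed

lemma ess_bounded_cnj:
  assumes "ess_bounded f"
  shows "ess_bounded (\<lambda>t. cnj (f t))"
  using assms borel_measurable_continuous_on[OF continuous_on_cnj[OF continuous_on_id], of f unit_lebesgue]
  by (auto simp: ess_bounded_def)

lemma l2_integrable: "integrable unit_lebesgue (\<lambda>t. rep_linf x t * cnj (rep_linf y t))"
  by (intro ess_bounded_integrable ess_bounded_mult ess_bounded_cnj rep_linf_ess_bounded)

lemma l2_inner_add: "l2_inner (x + y) v = l2_inner x v + l2_inner y v"
proof -
  have "l2_inner (x + y) v = (LINT t|unit_lebesgue. rep_linf x t * cnj (rep_linf v t) + rep_linf y t * cnj (rep_linf v t))"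
    unfolding l2_inner_def
  proof (rule integral_cong_AE)
    show "AE t in unit_lebesgue. rep_linf (x + y) t * cnj (rep_linf v t)
        = rep_linf x t * cnj (rep_linf v t) + rep_linf y t * cnj (rep_linf v t)"
      using rep_add_AE[of x y] by eventually_elim (simp add: distrib_right)
  qed (use l2_integrable in \<open>auto intro!: borel_measurable_integrable\<close>)
  thus ?thesis by (simp add: l2_inner_def l2_integrable)
qed

lemma l2_inner_cscale: "l2_inner (cscale c x) v = c * l2_inner x v"
proof -
  have "l2_inner (cscale c x) v = (LINT t|unit_lebesgue. c * (rep_linf x t * cnj (rep_linf v t)))"
    unfolding l2_inner_def
  proof (rule integral_cong_AE)
    show "AE t in unit_lebesgue. rep_linf (cscale c x) t * cnj (rep_linf v t) = c * (rep_linf x t * cnj (rep_linf v t))"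
      using rep_cscale_AE[of c x] by eventually_elim simp
  qed (use l2_integrable in \<open>auto intro!: borel_measurable_integrable borel_measurable_times\<close>)
  thus ?thesis by (simp add: l2_inner_def)
qed

lemma cscale_minus_one: "cscale (- 1) x = - x"
  using linf.scale_minus_left[of 1 x] by simp

lemma l2_inner_diff: "l2_inner (x - y) v = l2_inner x v - l2_inner y v"
  using l2_inner_add[of x "cscale (- 1) y" v] l2_inner_cscale[of "- 1" y v]
  by (simp only: cscale_minus_one) simp

lemma l2_inner_self_eq_0:
  assumes "l2_inner x x = 0" shows "x = 0"
proof -
  have int: "integrable unit_lebesgue (\<lambda>t. (norm (rep_linf x t))\<^sup>2)"
    using integrable_Re[OF l2_integrable[of x x]] by (simp add: complex_mult_cnj cmod_def)
  have "(LINT t|unit_lebesgue. (norm (rep_linf x t))\<^sup>2) = Re (l2_inner x x)"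
    unfolding l2_inner_def by (subst integral_Re[OF l2_integrable, symmetric]) (simp add: complex_mult_cnj cmod_def)
  hence "AE t in unit_lebesgue. (norm (rep_linf x t))\<^sup>2 = 0"
    using assms integral_nonneg_eq_0_iff_AE[OF int] by simp
  hence "AE t in unit_lebesgue. norm (rep_linf x t) \<le> 0" by eventually_elim simp
  hence "norm x \<le> 0" by (rule norm_linf_leI)
  thus ?thesis by simp
qed

lemma piecewise_poly_spaceE:
  assumes "v \<in> piecewise_poly_space r n" "j < n"
  obtains p where "degree p \<le> 2 * r" "AE t in lebesgue_on (cell n j). rep_linf v t = poly p (complex_of_real t)"
proof -
  have "Suc j \<in> {1..n}" using assms by simp
  thus thesis using assms(1) that unfolding piecewise_poly_space_def cell_def mem_Collect_eq
    by (metis diff_Suc_1)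
qed

lemma piecewise_poly_spaceI:
  assumes "\<And>j. j < n \<Longrightarrow> \<exists>p. degree p \<le> 2 * r \<and> (AE t in lebesgue_on (cell n j). rep_linf v t = poly p (complex_of_real t))"
  shows "v \<in> piecewise_poly_space r n"
  unfolding piecewise_poly_space_def mem_Collect_eq
proof
  fix j assume j: "j \<in> {1..n}"
  show "\<exists>p. degree p \<le> 2 * r \<and> (AE t in lebesgue_on {real (j - 1) / real n..real j / real n}. rep_linf v t = poly p (complex_of_real t))"
  proof (cases j)
    case (Suc k)
    thus ?thesis using assms[of k] j unfolding Suc diff_Suc_1 cell_def by simp
  qed (use j in simp)
qed

lemma piecewise_poly_space_add:
  assumes "u \<in> piecewise_poly_space r n" "v \<in> piecewise_poly_space r n"
  shows "u + v \<in> piecewise_poly_space r n"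
proof (rule piecewise_poly_spaceI)
  fix j assume j: "j < n"
  obtain p where p: "degree p \<le> 2 * r" "AE t in lebesgue_on (cell n j). rep_linf u t = poly p (complex_of_real t)"
    by (rule piecewise_poly_spaceE[OF assms(1) j])
  obtain q where q: "degree q \<le> 2 * r" "AE t in lebesgue_on (cell n j). rep_linf v t = poly q (complex_of_real t)"
    by (rule piecewise_poly_spaceE[OF assms(2) j])
  have "AE t in lebesgue_on (cell n j). rep_linf (u + v) t = poly (p + q) (complex_of_real t)"
    using p(2) q(2) AE_cell[OF rep_add_AE[of u v] j] by eventually_elim simp
  thus "\<exists>p. degree p \<le> 2 * r \<and> (AE t in lebesgue_on (cell n j). rep_linf (u + v) t = poly p (complex_of_real t))"
    using degree_add_le[OF p(1) q(1)] by blast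
qed

lemma piecewise_poly_space_cscale:
  assumes "u \<in> piecewise_poly_space r n"
  shows "cscale c u \<in> piecewise_poly_space r n"
proof (rule piecewise_poly_spaceI)
  fix j assume j: "j < n"
  obtain p where p: "degree p \<le> 2 * r" "AE t in lebesgue_on (cell n j). rep_linf u t = poly p (complex_of_real t)"
    by (rule piecewise_poly_spaceE[OF assms(1) j])
  have "AE t in lebesgue_on (cell n j). rep_linf (cscale c u) t = poly (smult c p) (complex_of_real t)"
    using p(2) AE_cell[OF rep_cscale_AE[of c u] j] by eventually_elim simp
  thus "\<exists>p. degree p \<le> 2 * r \<and> (AE t in lebesgue_on (cell n j). rep_linf (cscale c u) t = poly p (complex_of_real t))"
    using order_trans[OF degree_smult_le p(1)] by blast
qed

lemma piecewise_poly_space_diff: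
  assumes "u \<in> piecewise_poly_space r n" "v \<in> piecewise_poly_space r n"
  shows "u - v \<in> piecewise_poly_space r n"
  using piecewise_poly_space_add[OF assms(1) piecewise_poly_space_cscale[OF assms(2), of "- 1"]]
  by (simp add: cscale_minus_one)

text \<open>
  The difference of two candidates lies in the space and is orthogonal to it.
\<close>
lemma orth_projection_unique:
  assumes "y \<in> piecewise_poly_space r n" "\<And>v. v \<in> piecewise_poly_space r n \<Longrightarrow> l2_inner (x - y) v = 0"
    and "z \<in> piecewise_poly_space r n" "\<And>v. v \<in> piecewise_poly_space r n \<Longrightarrow> l2_inner (x - z) v = 0"
  shows "y = z"
proof -
  have d: "z - y \<in> piecewise_poly_space r n" by (rule piecewise_poly_space_diff[OF assms(3,1)])
  have "l2_inner (z - y) (z - y) = l2_inner (x - y) (z - y) - l2_inner (x - z) (z - y)"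
    by (simp add: l2_inner_diff)
  also have "\<dots> = 0" using assms(2)[OF d] assms(4)[OF d] by simp
  finally show ?thesis using l2_inner_self_eq_0[of "z - y"] by simp
qed

abbreviation proj_fun :: "nat \<Rightarrow> nat \<Rightarrow> linf \<Rightarrow> linf" where
  "proj_fun r n x \<equiv> abs_linf (pw_proj (2 * r) n (rep_linf x))"

lemma rep_residual_AE:
  assumes "n \<ge> 1"
  shows "AE t in unit_lebesgue. rep_linf (x - proj_fun r n x) t = rep_linf x t - pw_proj (2 * r) n (rep_linf x) t"
  using rep_diff_AE[of x "proj_fun r n x"] rep_abs_AE[OF ess_bounded_pw_proj[OF rep_linf_ess_bounded assms], of "2 * r" x]
  by eventually_elim simp

lemma proj_fun_mem:
  assumes n: "n \<ge> 1"
  shows "proj_fun r n x \<in> piecewise_poly_space r n"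
proof (rule piecewise_poly_spaceI)
  fix j assume j: "j < n"
  define f where "f = rep_linf x"
  define Q where "Q i = pcompose (map_poly complex_of_real (legendre (2 * r) i)) [:- of_nat j, of_nat n:]" for i
  define p where "p = (\<Sum>i\<le>2 * r. smult (cell_coeff (2 * r) n j f i) (Q i))"
  have "poly (Q i) (of_real t) = cell_basis (2 * r) n j i t" for i t
  proof -
    have "poly (Q i) (of_real t) = poly (map_poly complex_of_real (legendre (2 * r) i)) (of_real (real n * t - real j))"
      by (simp add: Q_def poly_pcompose algebra_simps)
    thus ?thesis by (simp only: poly_map_poly_of_real cell_basis_def)
  qed
  hence p: "poly p (of_real t) = cell_proj (2 * r) n j f t" for t
    by (simp add: p_def poly_sum cell_proj_def)
  have "degree (Q i) \<le> 2 * r" if "i \<le> 2 * r" for i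
  proof -
    have "degree (Q i) \<le> degree (map_poly complex_of_real (legendre (2 * r) i)) * degree [:- of_nat j, of_nat n :: complex:]"
      unfolding Q_def by (rule degree_pcompose_le)
    also have "\<dots> \<le> i" using legendre(1)[OF that] by (simp add: degree_map_poly)
    finally show ?thesis using that by simp
  qed
  hence "degree p \<le> 2 * r" unfolding p_def
    by (intro degree_sum_le) (auto intro: order_trans[OF degree_smult_le])
  moreover have "AE t in lebesgue_on (cell n j). rep_linf (proj_fun r n x) t = poly p (complex_of_real t)"
    using AE_cell[OF rep_abs_AE[OF ess_bounded_pw_proj[OF rep_linf_ess_bounded n], of "2 * r" x] j] pw_proj_AE[OF j, of "2 * r" "rep_linf x"]
    by eventually_elim (simp add: p f_def)
  ultimately show "\<exists>p. degree p \<le> 2 * r \<and> (AE t in lebesgue_on (cell n j). rep_linf (proj_fun r n x) t = poly p (complex_of_real t))"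
    by blast
qed

lemma proj_fun_residual:
  assumes n: "n \<ge> 1" and j: "j < n" and p: "degree p \<le> 2 * r"
  shows "(LINT t|lebesgue_on (cell n j). poly p (complex_of_real t) * rep_linf (x - proj_fun r n x) t) = 0"
  by (rule pw_proj_residual_orthogonal[OF rep_linf_ess_bounded[of x] j p AE_cell[OF rep_residual_AE[OF n] j] rep_linf_ess_bounded])

lemma proj_fun_orthogonal:
  assumes n: "n \<ge> 1" and v: "v \<in> piecewise_poly_space r n"
  shows "l2_inner (x - proj_fun r n x) v = 0"
proof -
  let ?w = "rep_linf (x - proj_fun r n x)"
  have "(LINT t|lebesgue_on (cell n j). ?w t * cnj (rep_linf v t)) = 0" if j: "j < n" for j
  proof -
    obtain p where p: "degree p \<le> 2 * r" "AE t in lebesgue_on (cell n j). rep_linf v t = poly p (complex_of_real t)"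
      by (rule piecewise_poly_spaceE[OF v j])
    have "(LINT t|lebesgue_on (cell n j). ?w t * cnj (rep_linf v t))
        = (LINT t|lebesgue_on (cell n j). poly (map_poly cnj p) (complex_of_real t) * ?w t)"
    proof (rule integral_cong_AE)
      show "(\<lambda>t. ?w t * cnj (rep_linf v t)) \<in> borel_measurable (lebesgue_on (cell n j))"
        by (rule borel_measurable_integrable[OF integrable_cell[OF l2_integrable j]])
      show "(\<lambda>t. poly (map_poly cnj p) (complex_of_real t) * ?w t) \<in> borel_measurable (lebesgue_on (cell n j))"
        by (rule borel_measurable_integrable[OF integrable_cell_mult[OF rep_linf_ess_bounded _ j]]) (intro continuous_intros)
      show "AE t in lebesgue_on (cell n j). ?w t * cnj (rep_linf v t) = poly (map_poly cnj p) (complex_of_real t) * ?w t"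
        using p(2) by eventually_elim (simp add: mult.commute)
    qed
    also have "\<dots> = 0"
      by (rule proj_fun_residual[OF n j]) (use p(1) in \<open>simp add: degree_map_poly\<close>)
    finally show ?thesis .
  qed
  thus ?thesis unfolding l2_inner_def integral_cells[OF l2_integrable n] by simp
qed

lemma proj_fun_eqI:
  assumes "n \<ge> 1" "y \<in> piecewise_poly_space r n" "\<And>v. v \<in> piecewise_poly_space r n \<Longrightarrow> l2_inner (x - y) v = 0"
  shows "y = proj_fun r n x"
  by (rule orth_projection_unique[OF assms(2,3) proj_fun_mem[OF assms(1)] proj_fun_orthogonal[OF assms(1)]])

text \<open>
  Uniqueness of the projection also gives its additivity and homogeneity: both sides of each
  equation lie in the space and have orthogonal residuals.
\<close>
lemma orth_projection_apply:
  assumes n: "n \<ge> 1"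
  shows "(orth_projection r n) x = proj_fun r n x"
proof -
  have the: "(THE y. y \<in> piecewise_poly_space r n \<and> (\<forall>v\<in>piecewise_poly_space r n. l2_inner (x - y) v = 0)) = proj_fun r n x" for x
    by (rule the_equality) (use proj_fun_mem[OF n] proj_fun_orthogonal[OF n] proj_fun_eqI[OF n] in auto)
  have "bounded_linear (proj_fun r n)"
  proof (rule bounded_linear_intro)
    fix x y :: linf and a :: real
    show "proj_fun r n (x + y) = proj_fun r n x + proj_fun r n y"
    proof (rule proj_fun_eqI[OF n, symmetric])
      fix v assume v: "v \<in> piecewise_poly_space r n"
      have "(x + y) - (proj_fun r n x + proj_fun r n y) = (x - proj_fun r n x) + (y - proj_fun r n y)" by simp
      thus "l2_inner ((x + y) - (proj_fun r n x + proj_fun r n y)) v = 0"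
        by (simp only: l2_inner_add proj_fun_orthogonal[OF n v]) simp
    qed (intro piecewise_poly_space_add proj_fun_mem[OF n])
    show "proj_fun r n (a *\<^sub>R x) = a *\<^sub>R proj_fun r n x"
    proof (rule proj_fun_eqI[OF n, symmetric])
      fix v assume v: "v \<in> piecewise_poly_space r n"
      have "a *\<^sub>R x - a *\<^sub>R proj_fun r n x = cscale (of_real a) (x - proj_fun r n x)"
        by (simp add: scaleR_eq_cscale linf.scale_right_diff_distrib)
      thus "l2_inner (a *\<^sub>R x - a *\<^sub>R proj_fun r n x) v = 0"
        by (simp only: l2_inner_cscale proj_fun_orthogonal[OF n v]) simp
    qed (simp only: scaleR_eq_cscale piecewise_poly_space_cscale proj_fun_mem[OF n])
    show "norm (proj_fun r n x) \<le> norm x * proj_const (2 * r)"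
      using norm_abs_linf_leI[OF ess_bounded_pw_proj[OF rep_linf_ess_bounded n] norm_pw_proj_le[OF rep_linf_ess_bounded n, of "2 * r" x]]
      by (simp add: linf_norm_rep_linf mult.commute)
  qed
  from bounded_linear_Blinfun_apply[OF this] show ?thesis
    unfolding orth_projection_def the by simp
qed

lemma orth_projection_residual_orthogonal:
  assumes "j < n" "degree p \<le> 2 * r"
  shows "(LINT t|lebesgue_on (cell n j). poly p (complex_of_real t) * rep_linf (x - (orth_projection r n) x) t) = 0"
  using proj_fun_residual[of n j p r x] assms by (simp add: orth_projection_apply)

lemma orth_projection_residual_le:
  assumes j: "j < n" and p: "degree p \<le> 2 * r"
    and e: "AE t in lebesgue_on (cell n j). norm (rep_linf x t - poly p (complex_of_real t)) \<le> \<epsilon>" "0 \<le> \<epsilon>"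
  shows "AE t in lebesgue_on (cell n j). norm (rep_linf (x - (orth_projection r n) x) t) \<le> proj_const (2 * r) * \<epsilon>"
proof -
  have n: "n \<ge> 1" using j by simp
  show ?thesis
    unfolding orth_projection_apply[OF n]
    using pw_proj_residual_le[OF rep_linf_ess_bounded j p e] AE_cell[OF rep_residual_AE[OF n, of x r] j]
    by eventually_elim simp
qed

lemma norm_orth_projection_residual_le:
  assumes n: "n \<ge> 1"
  shows "norm (x - (orth_projection r n) x) \<le> proj_const (2 * r) * norm x"
proof (rule norm_linf_leI, rule AE_unit_of_cells[OF n])
  fix j assume j: "j < n"
  show "AE t in lebesgue_on (cell n j). norm (rep_linf (x - (orth_projection r n) x) t) \<le> proj_const (2 * r) * norm x"
    by (rule orth_projection_residual_le[OF j, of 0]) (use AE_cell[OF rep_norm_AE j] in simp_all)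
qed

section \<open>Polynomial approximation from bounds on derivatives\<close>

text \<open>
  Differentiability is assumed only on the open interval, since partial derivatives of a kernel are
  available only in the interior of a triangle.
\<close>
lemma mean_value_norm_le:
  fixes f :: "real \<Rightarrow> complex"
  assumes "a \<le> b" "continuous_on {a..b} f"
    and "\<And>x. a < x \<Longrightarrow> x < b \<Longrightarrow> (f has_vector_derivative f' x) (at x)"
    and "\<And>x. a < x \<Longrightarrow> x < b \<Longrightarrow> norm (f' x) \<le> M"
  shows "norm (f b - f a) \<le> M * (b - a)"
proof (cases "a < b")
  case True
  obtain x where x: "x \<in> {a<..<b}" "norm (f b - f a) \<le> norm ((b - a) *\<^sub>R f' x)"
    using mvt_general[OF True assms(2), of "\<lambda>x u. u *\<^sub>R f' x"] assms(3)
    by (auto simp: has_vector_derivative_def)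
  moreover have "norm ((b - a) *\<^sub>R f' x) \<le> M * (b - a)"
    using x(1) True assms(4)[of x] by (simp add: mult.commute mult_right_mono)
  ultimately show ?thesis by linarith
qed (use assms(1) in simp)

lemma ex_poly_antiderivative:
  fixes p :: "complex poly"
  shows "\<exists>P. degree P \<le> Suc (degree p) \<and> pderiv P = p"
proof (intro exI conjI)
  let ?P = "\<Sum>i\<le>degree p. monom (coeff p i / of_nat (Suc i)) (Suc i)"
  show "degree ?P \<le> Suc (degree p)"
    by (intro degree_sum_le) (auto intro: order_trans[OF degree_monom_le])
  have "pderiv ?P = (\<Sum>i\<le>degree p. pderiv (monom (coeff p i / of_nat (Suc i)) (Suc i)))"
    using higher_pderiv_sum[of 1] by simp
  also have "\<dots> = (\<Sum>i\<le>degree p. monom (coeff p i) i)"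
    by (intro sum.cong refl) (simp add: pderiv_monom del: of_nat_Suc)
  finally show "pderiv ?P = p" by (simp add: poly_as_sum_of_monoms)
qed

lemma has_vector_derivative_poly_of_real:
  "((\<lambda>t. poly p (complex_of_real t)) has_vector_derivative poly (pderiv p) (of_real t)) (at t)"
  using has_vector_derivative_real_field[OF poly_DERIV[of p "complex_of_real t"]] by simp

text \<open>
  Induction on \<open>m\<close>: integrate an approximation of the derivative and match the value at the left
  endpoint; the mean value inequality contributes one more factor \<open>b - a\<close>.
\<close>
lemma poly_approx:
  fixes G :: "nat \<Rightarrow> real \<Rightarrow> complex"
  assumes "a \<le> b" and "\<And>k. k \<le> m \<Longrightarrow> continuous_on {a..b} (G k)"
    and "\<And>k t. k \<le> m \<Longrightarrow> a < t \<Longrightarrow> t < b \<Longrightarrow> (G k has_vector_derivative G (Suc k) t) (at t)"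
    and "\<And>t. a < t \<Longrightarrow> t < b \<Longrightarrow> norm (G (Suc m) t) \<le> M"
  shows "\<exists>p. degree p \<le> m \<and> (\<forall>t\<in>{a..b}. norm (G 0 t - poly p (of_real t)) \<le> M * (b - a) ^ Suc m)"
  using assms
proof (induction m arbitrary: G)
  case 0
  have "norm (G 0 t - G 0 a) \<le> M * (b - a)" if t: "t \<in> {a..b}" for t
  proof (cases "t = a")
    case False
    have M: "M \<ge> 0" using 0(4)[of "(a + t) / 2"] t False order_trans[OF norm_ge_zero] by auto
    have "norm (G 0 t - G 0 a) \<le> M * (t - a)"
      using 0 t by (intro mean_value_norm_le[where f' = "G 1"]) (auto intro: continuous_on_subset)
    also have "\<dots> \<le> M * (b - a)" using M t by (intro mult_left_mono) auto
    finally show ?thesis .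
  next
    case True
    show ?thesis
    proof (cases "a = b")
      case False
      hence "M \<ge> 0" using 0(4)[of "(a + b) / 2"] 0(1) order_trans[OF norm_ge_zero] by auto
      thus ?thesis using True 0(1) by simp
    qed (use True in simp)
  qed
  thus ?case by (intro exI[of _ "[:G 0 a:]"]) auto
next
  case (Suc m)
  have "\<exists>p. degree p \<le> m \<and> (\<forall>t\<in>{a..b}. norm (G (Suc 0) t - poly p (of_real t)) \<le> M * (b - a) ^ Suc m)"
    by (rule Suc.IH[of "\<lambda>k. G (Suc k)"]) (use Suc.prems in auto)
  then obtain p where p: "degree p \<le> m" "\<forall>t\<in>{a..b}. norm (G (Suc 0) t - poly p (of_real t)) \<le> M * (b - a) ^ Suc m"
    by blast
  obtain P0 where P0: "degree P0 \<le> Suc (degree p)" "pderiv P0 = p" using ex_poly_antiderivative by blast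
  define P where "P = P0 + [:G 0 a - poly P0 (of_real a):]"
  have P: "pderiv P = p" "poly P (of_real a) = G 0 a" by (simp_all add: P_def P0 pderiv_add pderiv_pCons)
  have dP: "degree P \<le> Suc m" unfolding P_def using P0 p by (intro degree_add_le) auto
  have N: "0 \<le> M * (b - a) ^ Suc m" using p(2) Suc.prems(1) order_trans[OF norm_ge_zero] by fastforce
  have "norm (G 0 t - poly P (of_real t)) \<le> M * (b - a) ^ Suc (Suc m)" if t: "t \<in> {a..b}" for t
  proof -
    have "norm ((G 0 t - poly P (of_real t)) - (G 0 a - poly P (of_real a))) \<le> M * (b - a) ^ Suc m * (t - a)"
    proof (rule mean_value_norm_le[where f = "\<lambda>t. G 0 t - poly P (of_real t)" and f' = "\<lambda>t. G (Suc 0) t - poly p (of_real t)"])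
      show "continuous_on {a..t} (\<lambda>t. G 0 t - poly P (of_real t))"
        using Suc.prems(2)[of 0] t by (intro continuous_intros) (auto intro: continuous_on_subset)
      show "((\<lambda>t. G 0 t - poly P (of_real t)) has_vector_derivative G (Suc 0) x - poly p (of_real x)) (at x)"
        if "a < x" "x < t" for x
        using Suc.prems(3)[of 0 x] has_vector_derivative_poly_of_real[of P x] that t
        by (auto simp: P intro!: has_vector_derivative_diff)
    qed (use p(2) t in auto)
    also have "\<dots> \<le> M * (b - a) ^ Suc m * (b - a)" using N t by (intro mult_left_mono) auto
    finally show ?thesis by (simp add: P(2) mult_ac)
  qed
  thus ?case using dP by blast
qed

text \<open>
  The condition that \<open>has_continuous_partials\<close> imposes on its witness, isolated so that several
  facts can refer to the same family of derivatives.
\<close>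
definition partials_on :: "(nat \<times> nat) set \<Rightarrow> (real \<times> real) set \<Rightarrow> (nat \<Rightarrow> nat \<Rightarrow> real \<times> real \<Rightarrow> real) \<Rightarrow> bool" where
  "partials_on J \<Omega> D \<longleftrightarrow> (\<forall>(j, k)\<in>J. continuous_on \<Omega> (D j k) \<and> bounded (D j k ` \<Omega>)) \<and>
        (\<forall>j k s t. (s, t) \<in> interior \<Omega> \<longrightarrow>
           ((Suc j, k) \<in> J \<longrightarrow>
              ((\<lambda>u. D j k (u, t)) has_real_derivative D (Suc j) k (s, t)) (at s)) \<and>
           ((j, Suc k) \<in> J \<longrightarrow>
              ((\<lambda>u. D j k (s, u)) has_real_derivative D j (Suc k) (s, t)) (at t)))"

lemma partials_onD:
  assumes "partials_on J \<Omega> D"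
  shows "(j, k) \<in> J \<Longrightarrow> continuous_on \<Omega> (D j k)"
    "(j, k) \<in> J \<Longrightarrow> \<exists>M\<ge>0. \<forall>x\<in>\<Omega>. \<bar>D j k x\<bar> \<le> M"
    "(s, t) \<in> interior \<Omega> \<Longrightarrow> (Suc j, k) \<in> J \<Longrightarrow> ((\<lambda>u. D j k (u, t)) has_real_derivative D (Suc j) k (s, t)) (at s)"
    "(s, t) \<in> interior \<Omega> \<Longrightarrow> (j, Suc k) \<in> J \<Longrightarrow> ((\<lambda>u. D j k (s, u)) has_real_derivative D j (Suc k) (s, t)) (at t)"
proof -
  assume "(j, k) \<in> J"
  hence "bounded (D j k ` \<Omega>)" using assms unfolding partials_on_def by blast
  then obtain M where "\<forall>x\<in>D j k ` \<Omega>. norm x \<le> M" unfolding bounded_iff ..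
  thus "\<exists>M\<ge>0. \<forall>x\<in>\<Omega>. \<bar>D j k x\<bar> \<le> M" by (intro exI[of _ "max M 0"]) (auto simp: le_max_iff_disj)
qed (use assms in \<open>unfold partials_on_def, blast+\<close>)

lemma partial_fst_vector_derivative:
  assumes "partials_on J \<Omega> D" "(s, t) \<in> interior \<Omega>" "(Suc j, k) \<in> J"
  shows "((\<lambda>u. complex_of_real (D j k (u, t))) has_vector_derivative of_real (D (Suc j) k (s, t))) (at s)"
  using partials_onD(3)[OF assms] by (intro has_vector_derivative_of_real) (simp add: has_real_derivative_iff_has_vector_derivative)

lemma partial_snd_vector_derivative:
  assumes "partials_on J \<Omega> D" "(s, t) \<in> interior \<Omega>" "(j, Suc k) \<in> J"
  shows "((\<lambda>u. complex_of_real (D j k (s, u))) has_vector_derivative of_real (D j (Suc k) (s, t))) (at t)"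
  using partials_onD(4)[OF assms] by (intro has_vector_derivative_of_real) (simp add: has_real_derivative_iff_has_vector_derivative)

lemma continuous_on_section_snd:
  assumes "partials_on J \<Omega> D" "(j, k) \<in> J" "\<And>t. t \<in> T \<Longrightarrow> (s, t) \<in> \<Omega>"
  shows "continuous_on T (\<lambda>t. complex_of_real (D j k (s, t)))"
  by (intro continuous_on_of_real continuous_on_compose2[OF partials_onD(1)[OF assms(1,2)]] continuous_intros)
    (use assms(3) in auto)

lemma continuous_on_section_fst:
  assumes "partials_on J \<Omega> D" "(j, k) \<in> J" "\<And>s. s \<in> T \<Longrightarrow> (s, t) \<in> \<Omega>"
  shows "continuous_on T (\<lambda>s. complex_of_real (D j k (s, t)))"
  by (intro continuous_on_of_real continuous_on_compose2[OF partials_onD(1)[OF assms(1,2)]] continuous_intros)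
    (use assms(3) in auto)

lemma partials_Lipschitz_fst:
  assumes D: "partials_on J \<Omega> D" and J: "(j, k) \<in> J" "(Suc j, k) \<in> J" and ab: "a \<le> b"
    and cl: "\<And>s. s \<in> {a..b} \<Longrightarrow> (s, t) \<in> \<Omega>" and int: "\<And>s. a < s \<Longrightarrow> s < b \<Longrightarrow> (s, t) \<in> interior \<Omega>"
    and M: "\<And>x. x \<in> \<Omega> \<Longrightarrow> \<bar>D (Suc j) k x\<bar> \<le> M"
  shows "\<bar>D j k (b, t) - D j k (a, t)\<bar> \<le> M * (b - a)"
proof -
  have "norm (complex_of_real (D j k (b, t)) - of_real (D j k (a, t))) \<le> M * (b - a)"
    by (rule mean_value_norm_le[OF ab continuous_on_section_fst[OF D J(1) cl] partial_fst_vector_derivative[OF D int J(2)]])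
      (use M cl in \<open>auto simp del: of_real_diff\<close>)
  thus ?thesis unfolding of_real_diff[symmetric] norm_of_real .
qed

lemma partials_Lipschitz_snd:
  assumes D: "partials_on J \<Omega> D" and J: "(j, k) \<in> J" "(j, Suc k) \<in> J" and ab: "a \<le> b"
    and cl: "\<And>t. t \<in> {a..b} \<Longrightarrow> (s, t) \<in> \<Omega>" and int: "\<And>t. a < t \<Longrightarrow> t < b \<Longrightarrow> (s, t) \<in> interior \<Omega>"
    and M: "\<And>x. x \<in> \<Omega> \<Longrightarrow> \<bar>D j (Suc k) x\<bar> \<le> M"
  shows "\<bar>D j k (s, b) - D j k (s, a)\<bar> \<le> M * (b - a)"
proof -
  have "norm (complex_of_real (D j k (s, b)) - of_real (D j k (s, a))) \<le> M * (b - a)"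
    by (rule mean_value_norm_le[OF ab continuous_on_section_snd[OF D J(1) cl] partial_snd_vector_derivative[OF D int J(2)]])
      (use M cl in \<open>auto simp del: of_real_diff\<close>)
  thus ?thesis unfolding of_real_diff[symmetric] norm_of_real .
qed

lemma partials_poly_approx:
  assumes D: "partials_on J \<Omega> D" and J: "\<And>k. k \<le> Suc m \<Longrightarrow> (0, k) \<in> J" and ab: "a \<le> b"
    and cl: "\<And>t. t \<in> {a..b} \<Longrightarrow> (s, t) \<in> \<Omega>" and int: "\<And>t. a < t \<Longrightarrow> t < b \<Longrightarrow> (s, t) \<in> interior \<Omega>"
    and M: "\<And>x. x \<in> \<Omega> \<Longrightarrow> \<bar>D 0 (Suc m) x\<bar> \<le> M"
  shows "\<exists>p. degree p \<le> m \<and> (\<forall>t\<in>{a..b}. norm (complex_of_real (D 0 0 (s, t)) - poly p (of_real t)) \<le> M * (b - a) ^ Suc m)"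
proof (rule poly_approx[OF ab, of m "\<lambda>k t. complex_of_real (D 0 k (s, t))"])
  show "continuous_on {a..b} (\<lambda>t. complex_of_real (D 0 k (s, t)))" if "k \<le> m" for k
    by (rule continuous_on_section_snd[OF D J cl]) (use that in auto)
  show "((\<lambda>t. complex_of_real (D 0 k (s, t))) has_vector_derivative of_real (D 0 (Suc k) (s, t))) (at t)"
    if "k \<le> m" "a < t" "t < b" for k t
    by (rule partial_snd_vector_derivative[OF D int J]) (use that in auto)
  show "norm (complex_of_real (D 0 (Suc m) (s, t))) \<le> M" if "a < t" "t < b" for t
    using M[of "(s, t)"] cl[of t] that by simp
qed

text \<open>
  The function \<open>t \<mapsto> f(s',t) - f(s,t)\<close> has derivative \<open>D 0 1 (s',t) - D 0 1 (s,t)\<close>, which is small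
  with \<open>s' - s\<close>; so it is constant up to the product of both side lengths.
\<close>
lemma partials_mixed_difference:
  assumes D: "partials_on J \<Omega> D" and J: "(0, 0) \<in> J" "(0, 1) \<in> J" "(1, 1) \<in> J"
    and ab: "a \<le> b" and s: "s \<le> s'"
    and cl: "\<And>u t. u \<in> {s..s'} \<Longrightarrow> t \<in> {a..b} \<Longrightarrow> (u, t) \<in> \<Omega>"
    and int: "\<And>u t. u \<in> {s..s'} \<Longrightarrow> a < t \<Longrightarrow> t < b \<Longrightarrow> (u, t) \<in> interior \<Omega>"
    and M: "\<And>x. x \<in> \<Omega> \<Longrightarrow> \<bar>D 1 1 x\<bar> \<le> M"
  shows "\<exists>c. \<forall>t\<in>{a..b}. norm (complex_of_real (D 0 0 (s', t) - D 0 0 (s, t)) - c) \<le> M * (s' - s) * (b - a)"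
proof -
  define G where "G k t = complex_of_real (D 0 k (s', t)) - of_real (D 0 k (s, t))" for k t
  have "\<exists>p. degree p \<le> 0 \<and> (\<forall>t\<in>{a..b}. norm (G 0 t - poly p (of_real t)) \<le> M * (s' - s) * (b - a) ^ Suc 0)"
  proof (rule poly_approx[OF ab])
    show "continuous_on {a..b} (G k)" if "k \<le> 0" for k
      using that unfolding G_def
      by (intro continuous_on_diff continuous_on_section_snd[OF D]) (use J cl s in auto)
    show "(G k has_vector_derivative G (Suc k) t) (at t)" if "k \<le> 0" "a < t" "t < b" for k t
      using that unfolding G_def
      by (intro has_vector_derivative_diff partial_snd_vector_derivative[OF D int]) (use J s in auto)
    show "norm (G (Suc 0) t) \<le> M * (s' - s)" if t: "a < t" "t < b" for t
    proof -
      have "\<bar>D 0 1 (s', t) - D 0 1 (s, t)\<bar> \<le> M * (s' - s)"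
        by (rule partials_Lipschitz_fst[OF D _ _ s]) (use J cl int M t in auto)
      thus ?thesis unfolding G_def of_real_diff[symmetric] norm_of_real by simp
    qed
  qed
  then obtain p where p: "degree p \<le> 0" "\<forall>t\<in>{a..b}. norm (G 0 t - poly p (of_real t)) \<le> M * (s' - s) * (b - a)"
    by auto
  obtain c where "p = [:c:]" using p(1) degree_eq_zeroE[of p] by auto
  thus ?thesis using p(2) by (intro exI[of _ c]) (simp add: G_def)
qed

lemma lower_triangle_interior:
  assumes "0 < t" "t < s" "s < 1" shows "(s, t) \<in> interior lower_triangle"
proof -
  have "open {x::real \<times> real. 0 < snd x \<and> snd x < fst x \<and> fst x < 1}"
    by (intro open_Collect_conj open_Collect_less continuous_intros)
  hence "{x::real \<times> real. 0 < snd x \<and> snd x < fst x \<and> fst x < 1} \<subseteq> interior lower_triangle"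
    by (intro interior_maximal) (auto simp: lower_triangle_def)
  thus ?thesis using assms by auto
qed

lemma upper_triangle_interior:
  assumes "0 < s" "s < t" "t < 1" shows "(s, t) \<in> interior upper_triangle"
proof -
  have "open {x::real \<times> real. 0 < fst x \<and> fst x < snd x \<and> snd x < 1}"
    by (intro open_Collect_conj open_Collect_less continuous_intros)
  hence "{x::real \<times> real. 0 < fst x \<and> fst x < snd x \<and> snd x < 1} \<subseteq> interior upper_triangle"
    by (intro interior_maximal) (auto simp: upper_triangle_def)
  thus ?thesis using assms by auto
qed

section \<open>Pointwise estimates for Green's kernels\<close>

abbreviation open_cell :: "nat \<Rightarrow> nat \<Rightarrow> real set" where
  "open_cell n i \<equiv> {real i / real n<..<real (Suc i) / real n}"

lemma open_cell_unit:
  assumes "i < n" "s \<in> open_cell n i"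
  shows "0 < s \<and> s < 1"
proof -
  have "0 \<le> real i / real n" "real (Suc i) / real n \<le> 1" using assms(1) by (auto simp: field_simps)
  thus ?thesis using assms(2) unfolding greaterThanLessThan_iff by linarith
qed

lemma cell_order:
  assumes "i < k" "n \<ge> 1" shows "real (Suc i) / real n \<le> real k / real n"
  using assms by (intro divide_right_mono) auto

lemma cell_bounds: "j < n \<Longrightarrow> 0 \<le> real j / real n \<and> real j / real n < real (Suc j) / real n \<and> real (Suc j) / real n \<le> 1"
  by (auto simp: field_simps)

lemma cell_width: "n \<ge> 1 \<Longrightarrow> real (Suc j) / real n - real j / real n = 1 / real n"
  by (simp add: field_simps)

lemma mem_lower_triangle: "(s, t) \<in> lower_triangle \<longleftrightarrow> 0 \<le> t \<and> t \<le> s \<and> s \<le> 1"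
  by (simp add: lower_triangle_def)

lemma mem_upper_triangle: "(s, t) \<in> upper_triangle \<longleftrightarrow> 0 \<le> s \<and> s \<le> t \<and> t \<le> 1"
  by (simp add: upper_triangle_def)

lemma green_kernelE:
  assumes "green_kernel r \<kappa>"
  obtains D1 D2 where "partials_on ({0..2*r+2} \<times> {0..2*r+2}) lower_triangle D1"
    "partials_on ({0..2*r+2} \<times> {0..2*r+2}) upper_triangle D2"
    "\<And>x. x \<in> lower_triangle \<Longrightarrow> \<kappa> x = D1 0 0 x" "\<And>x. x \<in> upper_triangle \<Longrightarrow> \<kappa> x = D2 0 0 x"
    "continuous_on ({0..1} \<times> {0..1}) \<kappa>"
proof -
  obtain \<kappa>1 \<kappa>2 where k: "continuous_on ({0..1} \<times> {0..1}) \<kappa>"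
     "\<forall>x\<in>lower_triangle. \<kappa> x = \<kappa>1 x" "\<forall>x\<in>upper_triangle. \<kappa> x = \<kappa>2 x"
     "has_continuous_partials ({0..2*r+2} \<times> {0..2*r+2}) lower_triangle \<kappa>1"
     "has_continuous_partials ({0..2*r+2} \<times> {0..2*r+2}) upper_triangle \<kappa>2"
    using assms unfolding green_kernel_def by (elim conjE exE)
  from k(4) obtain D1 where "\<forall>x\<in>lower_triangle. D1 0 0 x = \<kappa>1 x" "partials_on ({0..2*r+2} \<times> {0..2*r+2}) lower_triangle D1"
    unfolding has_continuous_partials_def partials_on_def[symmetric] by (elim conjE exE)
  moreover from k(5) obtain D2 where "\<forall>x\<in>upper_triangle. D2 0 0 x = \<kappa>2 x" "partials_on ({0..2*r+2} \<times> {0..2*r+2}) upper_triangle D2"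
    unfolding has_continuous_partials_def partials_on_def[symmetric] by (elim conjE exE)
  ultimately show thesis using that k(1,2,3) by simp
qed

text \<open>
  Lipschitz continuity holds across the diagonal because the two branches agree there. For the last
  two bounds \<open>s\<close> lies in another cell than \<open>t\<close>, so the whole cell of \<open>t\<close> lies in one triangle. The
  variable that is held fixed avoids 0 and 1, as derivatives along the edges of the square are not
  given; these values form a null set.
\<close>
lemma green_kernel_estimates:
  assumes \<kappa>: "green_kernel r \<kappa>"
  obtains M where "M \<ge> 0"
    and "\<And>s t t'. 0 < s \<Longrightarrow> s < 1 \<Longrightarrow> t \<in> {0..1} \<Longrightarrow> t' \<in> {0..1} \<Longrightarrow> \<bar>\<kappa> (s, t) - \<kappa> (s, t')\<bar> \<le> M * \<bar>t - t'\<bar>"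
    and "\<And>s s' t. 0 < t \<Longrightarrow> t < 1 \<Longrightarrow> s \<in> {0..1} \<Longrightarrow> s' \<in> {0..1} \<Longrightarrow> \<bar>\<kappa> (s, t) - \<kappa> (s', t)\<bar> \<le> M * \<bar>s - s'\<bar>"
    and "\<And>n i j s. i < n \<Longrightarrow> j < n \<Longrightarrow> i \<noteq> j \<Longrightarrow> s \<in> open_cell n i \<Longrightarrow>
      \<exists>p. degree p \<le> 2 * r \<and> (\<forall>t\<in>cell n j. norm (complex_of_real (\<kappa> (s, t)) - poly p (of_real t)) \<le> M * (1 / real n) ^ (2 * r + 1))"
    and "\<And>n i j s s'. i < n \<Longrightarrow> j < n \<Longrightarrow> i \<noteq> j \<Longrightarrow> s \<in> open_cell n i \<Longrightarrow> s' \<in> open_cell n i \<Longrightarrow>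
      \<exists>c. \<forall>t\<in>cell n j. norm (complex_of_real (\<kappa> (s, t) - \<kappa> (s', t)) - c) \<le> M * (1 / real n) ^ 2"
proof -
  let ?J = "{0..2*r+2} \<times> {0..2*r+2}"
  obtain D1 D2 where D1: "partials_on ?J lower_triangle D1" and D2: "partials_on ?J upper_triangle D2"
    and \<kappa>1: "\<And>x. x \<in> lower_triangle \<Longrightarrow> \<kappa> x = D1 0 0 x" and \<kappa>2: "\<And>x. x \<in> upper_triangle \<Longrightarrow> \<kappa> x = D2 0 0 x"
    using green_kernelE[OF \<kappa>] by metis
  have "\<exists>M\<ge>0. (\<forall>x\<in>lower_triangle. \<bar>D1 j k x\<bar> \<le> M) \<and> (\<forall>x\<in>upper_triangle. \<bar>D2 j k x\<bar> \<le> M)" if jk: "(j, k) \<in> ?J" for j k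
  proof -
    obtain M1 M2 where "M1 \<ge> 0" "\<forall>x\<in>lower_triangle. \<bar>D1 j k x\<bar> \<le> M1" "M2 \<ge> 0" "\<forall>x\<in>upper_triangle. \<bar>D2 j k x\<bar> \<le> M2"
      using partials_onD(2)[OF D1 jk] partials_onD(2)[OF D2 jk] by blast
    thus ?thesis by (intro exI[of _ "M1 + M2"]) (auto intro: add_increasing add_increasing2)
  qed
  from this[of 0 1] this[of 1 0] this[of 1 1] this[of 0 "Suc (2 * r)"]
  obtain Ma Mb Mc Md where
    Ma: "Ma \<ge> 0" "\<forall>x\<in>lower_triangle. \<bar>D1 0 1 x\<bar> \<le> Ma" "\<forall>x\<in>upper_triangle. \<bar>D2 0 1 x\<bar> \<le> Ma" and
    Mb: "Mb \<ge> 0" "\<forall>x\<in>lower_triangle. \<bar>D1 1 0 x\<bar> \<le> Mb" "\<forall>x\<in>upper_triangle. \<bar>D2 1 0 x\<bar> \<le> Mb" and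
    Mc: "Mc \<ge> 0" "\<forall>x\<in>lower_triangle. \<bar>D1 1 1 x\<bar> \<le> Mc" "\<forall>x\<in>upper_triangle. \<bar>D2 1 1 x\<bar> \<le> Mc" and
    Md: "Md \<ge> 0" "\<forall>x\<in>lower_triangle. \<bar>D1 0 (Suc (2 * r)) x\<bar> \<le> Md" "\<forall>x\<in>upper_triangle. \<bar>D2 0 (Suc (2 * r)) x\<bar> \<le> Md"
    by auto
  define M where "M = Ma + Mb + Mc + Md"
  have M: "M \<ge> 0" "Ma \<le> M" "Mb \<le> M" "Mc \<le> M" "Md \<le> M"
    using Ma(1) Mb(1) Mc(1) Md(1) by (auto simp: M_def)
  have J: "(0, 0) \<in> ?J" "(0, 1) \<in> ?J" "(1, 0) \<in> ?J" "(1, 1) \<in> ?J" "\<And>k. k \<le> Suc (2 * r) \<Longrightarrow> (0, k) \<in> ?J"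
    by auto
  have lip_t: "\<bar>\<kappa> (s, t') - \<kappa> (s, t)\<bar> \<le> M * (t' - t)" if s: "0 < s" "s < 1" and t: "0 \<le> t" "t \<le> t'" "t' \<le> 1" for s t t'
  proof -
    have low: "\<bar>\<kappa> (s, b) - \<kappa> (s, a)\<bar> \<le> M * (b - a)" if "0 \<le> a" "a \<le> b" "b \<le> s" for a b
    proof -
      have "\<bar>D1 0 0 (s, b) - D1 0 0 (s, a)\<bar> \<le> Ma * (b - a)"
        by (rule partials_Lipschitz_snd[OF D1 J(1) _ that(2)])
          (use that s Ma(2) in \<open>auto simp: mem_lower_triangle intro!: lower_triangle_interior\<close>)
      also have "\<dots> \<le> M * (b - a)" using M that by (intro mult_right_mono) auto
      finally show ?thesis using that s by (simp add: \<kappa>1 lower_triangle_def)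
    qed
    have up: "\<bar>\<kappa> (s, b) - \<kappa> (s, a)\<bar> \<le> M * (b - a)" if "s \<le> a" "a \<le> b" "b \<le> 1" for a b
    proof -
      have "\<bar>D2 0 0 (s, b) - D2 0 0 (s, a)\<bar> \<le> Ma * (b - a)"
        by (rule partials_Lipschitz_snd[OF D2 J(1) _ that(2)])
          (use that s Ma(3) in \<open>auto simp: mem_upper_triangle intro!: upper_triangle_interior\<close>)
      also have "\<dots> \<le> M * (b - a)" using M that by (intro mult_right_mono) auto
      finally show ?thesis using that s by (simp add: \<kappa>2 upper_triangle_def)
    qed
    consider "t' \<le> s" | "s \<le> t" | "t \<le> s" "s \<le> t'" using t by linarith
    thus ?thesis
    proof cases
      case 3
      have "\<bar>\<kappa> (s, t') - \<kappa> (s, t)\<bar> \<le> \<bar>\<kappa> (s, t') - \<kappa> (s, s)\<bar> + \<bar>\<kappa> (s, s) - \<kappa> (s, t)\<bar>" by linarith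
      also have "\<dots> \<le> M * (t' - s) + M * (s - t)" using low[of t s] up[of s t'] 3 t by (intro add_mono) auto
      finally show ?thesis by (simp add: algebra_simps)
    qed (use low[of t t'] up[of t t'] t in auto)
  qed
  have lip_s: "\<bar>\<kappa> (s', t) - \<kappa> (s, t)\<bar> \<le> M * (s' - s)" if t: "0 < t" "t < 1" and s: "0 \<le> s" "s \<le> s'" "s' \<le> 1" for s s' t
  proof -
    have low: "\<bar>\<kappa> (b, t) - \<kappa> (a, t)\<bar> \<le> M * (b - a)" if "t \<le> a" "a \<le> b" "b \<le> 1" for a b
    proof -
      have "\<bar>D1 0 0 (b, t) - D1 0 0 (a, t)\<bar> \<le> Mb * (b - a)"
        by (rule partials_Lipschitz_fst[OF D1 J(1) _ that(2)])
          (use that t Mb(2) in \<open>auto simp: mem_lower_triangle intro!: lower_triangle_interior\<close>)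
      also have "\<dots> \<le> M * (b - a)" using M that by (intro mult_right_mono) auto
      finally show ?thesis using that t by (simp add: \<kappa>1 lower_triangle_def)
    qed
    have up: "\<bar>\<kappa> (b, t) - \<kappa> (a, t)\<bar> \<le> M * (b - a)" if "0 \<le> a" "a \<le> b" "b \<le> t" for a b
    proof -
      have "\<bar>D2 0 0 (b, t) - D2 0 0 (a, t)\<bar> \<le> Mb * (b - a)"
        by (rule partials_Lipschitz_fst[OF D2 J(1) _ that(2)])
          (use that t Mb(3) in \<open>auto simp: mem_upper_triangle intro!: upper_triangle_interior\<close>)
      also have "\<dots> \<le> M * (b - a)" using M that by (intro mult_right_mono) auto
      finally show ?thesis using that t by (simp add: \<kappa>2 upper_triangle_def)
    qed
    consider "s' \<le> t" | "t \<le> s" | "s \<le> t" "t \<le> s'" using s by linarith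
    thus ?thesis
    proof cases
      case 3
      have "\<bar>\<kappa> (s', t) - \<kappa> (s, t)\<bar> \<le> \<bar>\<kappa> (s', t) - \<kappa> (t, t)\<bar> + \<bar>\<kappa> (t, t) - \<kappa> (s, t)\<bar>" by linarith
      also have "\<dots> \<le> M * (s' - t) + M * (t - s)" using up[of s t] low[of t s'] 3 s by (intro add_mono) auto
      finally show ?thesis by (simp add: algebra_simps)
    qed (use low[of s s'] up[of s s'] s in auto)
  qed
  have poly: "\<exists>p. degree p \<le> 2 * r \<and> (\<forall>t\<in>cell n j. norm (complex_of_real (\<kappa> (s, t)) - poly p (of_real t)) \<le> M * (1 / real n) ^ (2 * r + 1))"
    if i: "i < n" and j: "j < n" and ij: "i \<noteq> j" and s: "s \<in> open_cell n i" for n i j s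
  proof -
    have n: "n \<ge> 1" using i by simp
    have mono: "Md * (1 / real n) ^ (2 * r + 1) \<le> M * (1 / real n) ^ (2 * r + 1)"
      using M by (intro mult_right_mono) auto
    note s01 = open_cell_unit[OF i s]
    note b = cell_bounds[OF i] cell_bounds[OF j]
    show ?thesis
    proof (cases "j < i")
      case True
      note o = cell_order[OF True n]
      have tri: "(s, t) \<in> lower_triangle" if "t \<in> cell n j" for t
        using that s b o s01 unfolding mem_lower_triangle cell_def atLeastAtMost_iff greaterThanLessThan_iff by linarith
      have "\<exists>p. degree p \<le> 2 * r \<and> (\<forall>t\<in>{real j / real n..real (Suc j) / real n}.
          norm (complex_of_real (D1 0 0 (s, t)) - poly p (of_real t)) \<le> Md * (real (Suc j) / real n - real j / real n) ^ Suc (2 * r))"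
      proof (rule partials_poly_approx[OF D1 J(5)])
        show "(s, t) \<in> interior lower_triangle" if "real j / real n < t" "t < real (Suc j) / real n" for t
          using that s b o s01 unfolding greaterThanLessThan_iff by (intro lower_triangle_interior) linarith+
      qed (use b Md(2) tri in \<open>auto simp: cell_def\<close>)
      then obtain p where p: "degree p \<le> 2 * r" "\<forall>t\<in>cell n j. norm (complex_of_real (D1 0 0 (s, t)) - poly p (of_real t)) \<le> Md * (1 / real n) ^ (2 * r + 1)"
        unfolding cell_width[OF n] cell_def by auto
      have "norm (complex_of_real (\<kappa> (s, t)) - poly p (of_real t)) \<le> M * (1 / real n) ^ (2 * r + 1)"
        if t: "t \<in> cell n j" for t
        unfolding \<kappa>1[OF tri[OF t]] by (rule order_trans[OF p(2)[rule_format, OF t] mono])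
      thus ?thesis using p(1) by blast
    next
      case False
      hence "i < j" using ij by simp
      note o = cell_order[OF this n]
      have tri: "(s, t) \<in> upper_triangle" if "t \<in> cell n j" for t
        using that s b o s01 unfolding mem_upper_triangle cell_def atLeastAtMost_iff greaterThanLessThan_iff by linarith
      have "\<exists>p. degree p \<le> 2 * r \<and> (\<forall>t\<in>{real j / real n..real (Suc j) / real n}.
          norm (complex_of_real (D2 0 0 (s, t)) - poly p (of_real t)) \<le> Md * (real (Suc j) / real n - real j / real n) ^ Suc (2 * r))"
      proof (rule partials_poly_approx[OF D2 J(5)])
        show "(s, t) \<in> interior upper_triangle" if "real j / real n < t" "t < real (Suc j) / real n" for t
          using that s b o s01 unfolding greaterThanLessThan_iff by (intro upper_triangle_interior) linarith+
      qed (use b Md(3) tri in \<open>auto simp: cell_def\<close>)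
      then obtain p where p: "degree p \<le> 2 * r" "\<forall>t\<in>cell n j. norm (complex_of_real (D2 0 0 (s, t)) - poly p (of_real t)) \<le> Md * (1 / real n) ^ (2 * r + 1)"
        unfolding cell_width[OF n] cell_def by auto
      have "norm (complex_of_real (\<kappa> (s, t)) - poly p (of_real t)) \<le> M * (1 / real n) ^ (2 * r + 1)"
        if t: "t \<in> cell n j" for t
        unfolding \<kappa>2[OF tri[OF t]] by (rule order_trans[OF p(2)[rule_format, OF t] mono])
      thus ?thesis using p(1) by blast
    qed
  qed
  have mixed_le: "\<exists>c. \<forall>t\<in>cell n j. norm (complex_of_real (\<kappa> (s', t) - \<kappa> (s, t)) - c) \<le> M * (1 / real n) ^ 2"
    if i: "i < n" and j: "j < n" and ij: "i \<noteq> j" and s: "s \<in> open_cell n i" "s' \<in> open_cell n i" "s \<le> s'" for n i j s s'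
  proof -
    have n: "n \<ge> 1" using i by simp
    have "s' - s \<le> 1 / real n" using s cell_width[OF n, of i] by auto
    hence mono: "Mc * (s' - s) * (1 / real n) \<le> M * (1 / real n) ^ 2"
      using M Mc(1) s unfolding power2_eq_square mult.assoc by (intro mult_mono) auto
    have s01: "0 < u \<and> u < 1 \<and> real i / real n < u \<and> u < real (Suc i) / real n" if "u \<in> {s..s'}" for u
      using open_cell_unit[OF i s(1)] open_cell_unit[OF i s(2)] that s by auto
    note b = cell_bounds[OF i] cell_bounds[OF j]
    show ?thesis
    proof (cases "j < i")
      case True
      note o = cell_order[OF True n]
      have tri: "(u, t) \<in> lower_triangle" if "t \<in> cell n j" "u \<in> {s..s'}" for u t
        using that b o s01[OF that(2)] unfolding mem_lower_triangle cell_def atLeastAtMost_iff greaterThanLessThan_iff by linarith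
      have "\<exists>c. \<forall>t\<in>{real j / real n..real (Suc j) / real n}.
          norm (complex_of_real (D1 0 0 (s', t) - D1 0 0 (s, t)) - c) \<le> Mc * (s' - s) * (real (Suc j) / real n - real j / real n)"
      proof (rule partials_mixed_difference[OF D1 J(1,2,4) _ s(3)])
        show "(u, t) \<in> interior lower_triangle" if "u \<in> {s..s'}" "real j / real n < t" "t < real (Suc j) / real n" for u t
          using that b o s01[OF that(1)] unfolding greaterThanLessThan_iff by (intro lower_triangle_interior) linarith+
      qed (use b Mc(2) tri in \<open>auto simp: cell_def\<close>)
      then obtain c where c: "\<forall>t\<in>cell n j. norm (complex_of_real (D1 0 0 (s', t) - D1 0 0 (s, t)) - c) \<le> Mc * (s' - s) * (1 / real n)"
        unfolding cell_width[OF n] cell_def by auto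
      have "norm (complex_of_real (\<kappa> (s', t) - \<kappa> (s, t)) - c) \<le> M * (1 / real n) ^ 2"
        if t: "t \<in> cell n j" for t
      proof -
        have u: "s \<in> {s..s'}" "s' \<in> {s..s'}" using s(3) by simp_all
        show ?thesis unfolding \<kappa>1[OF tri[OF t u(1)]] \<kappa>1[OF tri[OF t u(2)]]
          by (rule order_trans[OF c[rule_format, OF t] mono])
      qed
      thus ?thesis by blast
    next
      case False
      hence "i < j" using ij by simp
      note o = cell_order[OF this n]
      have tri: "(u, t) \<in> upper_triangle" if "t \<in> cell n j" "u \<in> {s..s'}" for u t
        using that b o s01[OF that(2)] unfolding mem_upper_triangle cell_def atLeastAtMost_iff greaterThanLessThan_iff by linarith
      have "\<exists>c. \<forall>t\<in>{real j / real n..real (Suc j) / real n}.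
          norm (complex_of_real (D2 0 0 (s', t) - D2 0 0 (s, t)) - c) \<le> Mc * (s' - s) * (real (Suc j) / real n - real j / real n)"
      proof (rule partials_mixed_difference[OF D2 J(1,2,4) _ s(3)])
        show "(u, t) \<in> interior upper_triangle" if "u \<in> {s..s'}" "real j / real n < t" "t < real (Suc j) / real n" for u t
          using that b o s01[OF that(1)] unfolding greaterThanLessThan_iff by (intro upper_triangle_interior) linarith+
      qed (use b Mc(3) tri in \<open>auto simp: cell_def\<close>)
      then obtain c where c: "\<forall>t\<in>cell n j. norm (complex_of_real (D2 0 0 (s', t) - D2 0 0 (s, t)) - c) \<le> Mc * (s' - s) * (1 / real n)"
        unfolding cell_width[OF n] cell_def by auto
      have "norm (complex_of_real (\<kappa> (s', t) - \<kappa> (s, t)) - c) \<le> M * (1 / real n) ^ 2"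
        if t: "t \<in> cell n j" for t
      proof -
        have u: "s \<in> {s..s'}" "s' \<in> {s..s'}" using s(3) by simp_all
        show ?thesis unfolding \<kappa>2[OF tri[OF t u(1)]] \<kappa>2[OF tri[OF t u(2)]]
          by (rule order_trans[OF c[rule_format, OF t] mono])
      qed
      thus ?thesis by blast
    qed
  qed
  show thesis
  proof (rule that[OF M(1)])
    show "\<bar>\<kappa> (s, t) - \<kappa> (s, t')\<bar> \<le> M * \<bar>t - t'\<bar>" if "0 < s" "s < 1" "t \<in> {0..1}" "t' \<in> {0..1}" for s t t'
      using lip_t[of s t t'] lip_t[of s t' t] that by (cases "t \<le> t'") (auto simp: abs_minus_commute)
    show "\<bar>\<kappa> (s, t) - \<kappa> (s', t)\<bar> \<le> M * \<bar>s - s'\<bar>" if "0 < t" "t < 1" "s \<in> {0..1}" "s' \<in> {0..1}" for s s' t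
      using lip_s[of t s s'] lip_s[of t s' s] that by (cases "s \<le> s'") (auto simp: abs_minus_commute)
    show "\<exists>c. \<forall>t\<in>cell n j. norm (complex_of_real (\<kappa> (s, t) - \<kappa> (s', t)) - c) \<le> M * (1 / real n) ^ 2"
      if ij: "i < n" "j < n" "i \<noteq> j" "s \<in> open_cell n i" "s' \<in> open_cell n i" for n i j s s'
    proof (cases "s' \<le> s")
      case True
      thus ?thesis using mixed_le[OF ij(1,2,3,5,4)] by blast
    next
      case False
      then obtain c where "\<forall>t\<in>cell n j. norm (complex_of_real (\<kappa> (s', t) - \<kappa> (s, t)) - c) \<le> M * (1 / real n) ^ 2"
        using mixed_le[OF ij(1-5)] by auto
      moreover have "norm (complex_of_real (\<kappa> (s, t) - \<kappa> (s', t)) - (- c)) = norm (complex_of_real (\<kappa> (s', t) - \<kappa> (s, t)) - c)" for t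
        by (subst norm_minus_commute) (simp add: algebra_simps)
      ultimately show ?thesis by (intro exI[of _ "- c"]) simp
    qed
  qed (rule poly)
qed

section \<open>The integral operator on functions orthogonal to polynomials\<close>

definition cell_orthogonal :: "nat \<Rightarrow> nat \<Rightarrow> linf \<Rightarrow> bool" where
  "cell_orthogonal r n w \<longleftrightarrow> (\<forall>j<n. \<forall>p. degree p \<le> 2 * r \<longrightarrow>
     (LINT t|lebesgue_on (cell n j). poly p (complex_of_real t) * rep_linf w t) = 0)"

lemma cell_orthogonal_residual: "cell_orthogonal r n (x - (orth_projection r n) x)"
  unfolding cell_orthogonal_def using orth_projection_residual_orthogonal by blast

text \<open>
  Subtracting the polynomial \<open>p\<close> from \<open>g\<close> on a cell does not change the integral against \<open>w\<close>.
\<close>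
lemma pairing_bound:
  assumes w: "cell_orthogonal r n w" "norm w \<le> \<delta>" and n: "n \<ge> 1" and g: "continuous_on {0..1} g"
    and approx: "\<And>j. j < n \<Longrightarrow> \<exists>p. degree p \<le> 2 * r \<and> (AE t in lebesgue_on (cell n j). norm (g t - poly p (complex_of_real t)) \<le> \<epsilon> j)"
    and \<epsilon>: "\<And>j. j < n \<Longrightarrow> 0 \<le> \<epsilon> j"
  shows "norm (LINT t|unit_lebesgue. g t * rep_linf w t) \<le> (\<Sum>j<n. \<epsilon> j * \<delta> / real n)"
proof -
  have int: "integrable unit_lebesgue (\<lambda>t. g t * rep_linf w t)"
    by (intro ess_bounded_integrable ess_bounded_mult_continuous rep_linf_ess_bounded g)
  show ?thesis
    unfolding integral_cells[OF int n]
  proof (rule sum_norm_le)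
    fix j assume "j \<in> {..<n}"
    hence j: "j < n" by simp
    obtain p where p: "degree p \<le> 2 * r" "AE t in lebesgue_on (cell n j). norm (g t - poly p (complex_of_real t)) \<le> \<epsilon> j"
      using approx[OF j] by blast
    have cp: "continuous_on {0..1} (\<lambda>t. poly p (complex_of_real t))" by (intro continuous_intros)
    have i1: "integrable (lebesgue_on (cell n j)) (\<lambda>t. g t * rep_linf w t)"
      and i2: "integrable (lebesgue_on (cell n j)) (\<lambda>t. poly p (complex_of_real t) * rep_linf w t)"
      using integrable_cell_mult[OF rep_linf_ess_bounded g j] integrable_cell_mult[OF rep_linf_ess_bounded cp j] by auto
    have i3: "integrable (lebesgue_on (cell n j)) (\<lambda>t. (g t - poly p (complex_of_real t)) * rep_linf w t)"
      using Bochner_Integration.integrable_diff[OF i1 i2] by (simp add: left_diff_distrib)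
    have "(LINT t|lebesgue_on (cell n j). g t * rep_linf w t)
        = (LINT t|lebesgue_on (cell n j). (g t - poly p (complex_of_real t)) * rep_linf w t)
          + (LINT t|lebesgue_on (cell n j). poly p (complex_of_real t) * rep_linf w t)"
      using Bochner_Integration.integral_add[OF i3 i2] by (simp add: left_diff_distrib)
    also have "(LINT t|lebesgue_on (cell n j). poly p (complex_of_real t) * rep_linf w t) = 0"
      using w(1) j p(1) by (simp add: cell_orthogonal_def)
    finally have eq: "(LINT t|lebesgue_on (cell n j). g t * rep_linf w t)
        = (LINT t|lebesgue_on (cell n j). (g t - poly p (complex_of_real t)) * rep_linf w t)" by simp
    show "norm (LINT t|lebesgue_on (cell n j). g t * rep_linf w t) \<le> \<epsilon> j * \<delta> / real n"
      unfolding eq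
    proof (rule norm_LINT_cell_le[OF i3 n])
      show "AE t in lebesgue_on (cell n j). norm ((g t - poly p (complex_of_real t)) * rep_linf w t) \<le> \<epsilon> j * \<delta>"
        using p(2) AE_cell[OF rep_norm_AE[of w] j]
      proof eventually_elim
        case (elim t)
        show ?case unfolding norm_mult using elim w(2) \<epsilon>[OF j] by (intro mult_mono) auto
      qed
    qed
  qed
qed

text \<open>
  For a Green's kernel this is the continuous representative of the image of \<open>x\<close> under the integral
  operator.
\<close>
definition kernel_fun :: "(real \<times> real \<Rightarrow> real) \<Rightarrow> linf \<Rightarrow> real \<Rightarrow> complex" where
  "kernel_fun \<kappa> x s = (LINT t|unit_lebesgue. complex_of_real (\<kappa> (s, t)) * rep_linf x t)"

lemma continuous_on_kernel_section:
  assumes "continuous_on ({0..1} \<times> {0..1}) \<kappa>" "s \<in> {0..1}"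
  shows "continuous_on {0..1} (\<lambda>t. complex_of_real (\<kappa> (s, t)))"
  by (intro continuous_on_of_real continuous_on_compose2[OF assms(1)] continuous_intros) (use assms(2) in auto)

lemma AE_lebesgue_on_open_interval: "AE t in lebesgue_on {a..b}. a < t \<and> t < (b::real)"
proof -
  have "AE t in lebesgue_on {a..b}. t \<in> {a..b}" using AE_space[of "lebesgue_on {a..b}"] by simp
  moreover have "AE t in lebesgue_on {a..b}. t \<noteq> a" "AE t in lebesgue_on {a..b}. t \<noteq> b"
    by (rule AE_lebesgue_on_neq, simp)+
  ultimately show ?thesis by eventually_elim auto
qed

lemma kernel_fun_diff_le:
  assumes \<kappa>: "continuous_on ({0..1} \<times> {0..1}) \<kappa>" and s: "s \<in> {0..1}" "s' \<in> {0..1}"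
    and L: "\<And>t. 0 < t \<Longrightarrow> t < 1 \<Longrightarrow> \<bar>\<kappa> (s, t) - \<kappa> (s', t)\<bar> \<le> L"
  shows "norm (kernel_fun \<kappa> x s - kernel_fun \<kappa> x s') \<le> L * norm x"
proof -
  note c = continuous_on_kernel_section[OF \<kappa> s(1)] continuous_on_kernel_section[OF \<kappa> s(2)]
  note i = c[THEN ess_bounded_mult_continuous[OF rep_linf_ess_bounded[of x]], THEN ess_bounded_integrable]
  have L0: "0 \<le> L" using L[of "1/2"] by simp
  have i3: "integrable unit_lebesgue (\<lambda>t. complex_of_real (\<kappa> (s, t)) * rep_linf x t - complex_of_real (\<kappa> (s', t)) * rep_linf x t)"
    by (rule Bochner_Integration.integrable_diff[OF i])
  have "kernel_fun \<kappa> x s - kernel_fun \<kappa> x s'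
      = (LINT t|unit_lebesgue. complex_of_real (\<kappa> (s, t)) * rep_linf x t - complex_of_real (\<kappa> (s', t)) * rep_linf x t)"
    unfolding kernel_fun_def by (rule Bochner_Integration.integral_diff[OF i, symmetric])
  also have "norm \<dots> \<le> (LINT t|unit_lebesgue. norm (complex_of_real (\<kappa> (s, t)) * rep_linf x t - complex_of_real (\<kappa> (s', t)) * rep_linf x t))"
    by (rule integral_norm_bound)
  also have "\<dots> \<le> (LINT t|unit_lebesgue. L * norm x)"
  proof (rule integral_mono_AE[OF integrable_norm[OF i3] finite_measure.integrable_const[OF finite_measure_unit_lebesgue]])
    show "AE t in unit_lebesgue. norm (complex_of_real (\<kappa> (s, t)) * rep_linf x t - complex_of_real (\<kappa> (s', t)) * rep_linf x t) \<le> L * norm x"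
      using rep_norm_AE[of x] AE_lebesgue_on_open_interval[of 0 1]
    proof eventually_elim
      case (elim t)
      have "norm (complex_of_real (\<kappa> (s, t) - \<kappa> (s', t)) * rep_linf x t) \<le> L * norm x"
        unfolding norm_mult norm_of_real using L[of t] elim L0 by (intro mult_mono) auto
      thus ?case by (simp add: left_diff_distrib)
    qed
  qed
  also have "\<dots> = L * norm x" by (simp add: measure_restrict_space)
  finally show ?thesis .
qed

lemma continuous_on_kernel_fun:
  assumes \<kappa>: "continuous_on ({0..1} \<times> {0..1}) \<kappa>"
    and L: "\<And>s s' t. 0 < t \<Longrightarrow> t < 1 \<Longrightarrow> s \<in> {0..1} \<Longrightarrow> s' \<in> {0..1} \<Longrightarrow> \<bar>\<kappa> (s, t) - \<kappa> (s', t)\<bar> \<le> M * \<bar>s - s'\<bar>"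
    and M: "M \<ge> 0"
  shows "continuous_on {0..1} (kernel_fun \<kappa> x)"
proof -
  have "norm (kernel_fun \<kappa> x s - kernel_fun \<kappa> x s') \<le> (M * norm x) * \<bar>s - s'\<bar>" if "s \<in> {0..1}" "s' \<in> {0..1}" for s s'
    using kernel_fun_diff_le[OF \<kappa> that, of "M * \<bar>s - s'\<bar>" x] L that by (simp add: mult_ac)
  hence "(M * norm x)-lipschitz_on {0..1} (kernel_fun \<kappa> x)"
    using M by (intro lipschitz_onI) (auto simp: dist_norm)
  thus ?thesis by (rule lipschitz_on_continuous_on)
qed

text \<open>
  One exceptional cell with the weaker bound \<open>b\<close> costs only \<open>b/n\<close>, all others together cost \<open>a\<close>.
\<close>
lemma sum_cells_le:
  assumes i: "i < n" and a: "0 \<le> a" "0 \<le> \<delta>"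
  shows "(\<Sum>j<n. (if j = i then b else a) * \<delta> / real n) \<le> \<delta> * (a + b / real n)"
proof -
  have "(\<Sum>j<n. (if j = i then b else a) * \<delta> / real n) \<le> (\<Sum>j<n. a * \<delta> / real n + (if j = i then b * \<delta> / real n else 0))"
    using a by (intro sum_mono) auto
  also have "\<dots> = real n * (a * \<delta> / real n) + b * \<delta> / real n" using i by (simp add: sum.distrib)
  also have "\<dots> = \<delta> * (a + b / real n)" using i by (simp add: field_simps)
  finally show ?thesis .
qed

lemma AE_open_cell: "AE s in lebesgue_on (cell n i). s \<in> open_cell n i"
  unfolding cell_def greaterThanLessThan_iff by (rule AE_lebesgue_on_open_interval)

text \<open>
  The last three bounds come from three choices of polynomials in the pairing estimate. Constants
  on all cells give the factor \<open>h\<close>. Approximations of degree \<open>2r\<close> away from the cell of \<open>s\<close>, and a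
  constant on that cell, give \<open>h\<^sup>2\<^sup>r\<^sup>+\<^sup>1 + h\<^sup>2\<close>. Applied to the difference of two kernel sections from
  the same cell, constants (zero on that cell) bound the oscillation of the image by \<open>h\<^sup>2\<close>, and the
  projection error is controlled by the oscillation.
\<close>
lemma integral_operator_estimates:
  assumes green: "green_kernel r \<kappa>"
  obtains M where "M \<ge> 0"
    and "\<And>x. continuous_on {0..1} (kernel_fun \<kappa> x) \<and> (integral_operator \<kappa>) x = abs_linf (kernel_fun \<kappa> x)"
    and "\<And>n w. n \<ge> 1 \<Longrightarrow> cell_orthogonal r n w \<Longrightarrow> norm ((integral_operator \<kappa>) w) \<le> M * norm w * (1 / real n)"
    and "\<And>n w. n \<ge> 1 \<Longrightarrow> cell_orthogonal r n w \<Longrightarrow>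
        norm ((integral_operator \<kappa>) w) \<le> M * norm w * ((1 / real n) ^ (2 * r + 1) + (1 / real n) ^ 2)"
    and "\<And>n w. n \<ge> 1 \<Longrightarrow> cell_orthogonal r n w \<Longrightarrow>
        norm ((integral_operator \<kappa>) w - (orth_projection r n) ((integral_operator \<kappa>) w))
          \<le> M * norm w * (1 / real n) ^ 2"
proof (rule green_kernel_estimates[OF green])
  let ?K = "(integral_operator \<kappa>)"
  have \<kappa>: "continuous_on ({0..1} \<times> {0..1}) \<kappa>" using green by (simp add: green_kernel_def)
  fix M0 assume M0: "M0 \<ge> 0"
    and lip_t: "\<And>s t t'. 0 < s \<Longrightarrow> s < 1 \<Longrightarrow> t \<in> {0..1} \<Longrightarrow> t' \<in> {0..1} \<Longrightarrow> \<bar>\<kappa> (s, t) - \<kappa> (s, t')\<bar> \<le> M0 * \<bar>t - t'\<bar>"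
    and lip_s: "\<And>s s' t. 0 < t \<Longrightarrow> t < 1 \<Longrightarrow> s \<in> {0..1} \<Longrightarrow> s' \<in> {0..1} \<Longrightarrow> \<bar>\<kappa> (s, t) - \<kappa> (s', t)\<bar> \<le> M0 * \<bar>s - s'\<bar>"
    and poly: "\<And>n i j s. i < n \<Longrightarrow> j < n \<Longrightarrow> i \<noteq> j \<Longrightarrow> s \<in> open_cell n i \<Longrightarrow>
      \<exists>p. degree p \<le> 2 * r \<and> (\<forall>t\<in>cell n j. norm (complex_of_real (\<kappa> (s, t)) - poly p (of_real t)) \<le> M0 * (1 / real n) ^ (2 * r + 1))"
    and mixed: "\<And>n i j s s'. i < n \<Longrightarrow> j < n \<Longrightarrow> i \<noteq> j \<Longrightarrow> s \<in> open_cell n i \<Longrightarrow> s' \<in> open_cell n i \<Longrightarrow>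
      \<exists>c. \<forall>t\<in>cell n j. norm (complex_of_real (\<kappa> (s, t) - \<kappa> (s', t)) - c) \<le> M0 * (1 / real n) ^ 2"
  have cont: "continuous_on {0..1} (kernel_fun \<kappa> x)" for x
    by (rule continuous_on_kernel_fun[OF \<kappa> lip_s M0])
  have K: "?K x = abs_linf (kernel_fun \<kappa> x)" for x
    unfolding integral_operator_apply[OF \<kappa>] kernel_fun_def[abs_def] ..
  have repK: "AE s in unit_lebesgue. rep_linf (?K x) s = kernel_fun \<kappa> x s" for x
    unfolding K by (rule rep_abs_AE[OF ess_bounded_continuous[OF cont]])
  have const_approx: "\<exists>p. degree p \<le> 2 * r \<and> (\<forall>t\<in>cell n j. norm (complex_of_real (\<kappa> (s, t)) - poly p (of_real t)) \<le> M0 / real n)"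
    if s: "0 < s" "s < 1" and j: "j < n" for s n j
  proof (intro exI conjI ballI)
    let ?a = "real j / real n"
    fix t assume t: "t \<in> cell n j"
    have n: "n \<ge> 1" using j by simp
    have a: "?a \<in> {0..1}" "t \<in> {0..1}" using cell_bounds[OF j] cell_subset[OF j] t by auto
    have "\<bar>t - ?a\<bar> \<le> 1 / real n" using t cell_width[OF n, of j] by (auto simp: cell_def)
    hence "M0 * \<bar>t - ?a\<bar> \<le> M0 / real n" using mult_left_mono[OF _ M0] by fastforce
    hence "\<bar>\<kappa> (s, t) - \<kappa> (s, ?a)\<bar> \<le> M0 / real n"
      using lip_t[OF s a(2,1)] by linarith
    thus "norm (complex_of_real (\<kappa> (s, t)) - poly [:complex_of_real (\<kappa> (s, ?a)):] (of_real t)) \<le> M0 / real n"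
      by (simp add: of_real_diff[symmetric] del: of_real_diff)
  qed simp
  have AEcell: "AE t in lebesgue_on (cell n j). P t" if "\<forall>t\<in>cell n j. P t" for n j P
    using AE_cell_mem by eventually_elim (use that in auto)
  have e1: "norm (?K w) \<le> M0 * norm w * (1 / real n)" if n: "n \<ge> 1" and w: "cell_orthogonal r n w" for n w
  proof (rule norm_linf_leI, use repK[of w] AE_lebesgue_on_open_interval[of 0 1] in eventually_elim)
    fix s assume "rep_linf (?K w) s = kernel_fun \<kappa> w s" and s: "0 < s \<and> s < 1"
    hence "norm (rep_linf (?K w) s) = norm (kernel_fun \<kappa> w s)" by simp
    also have "\<dots> \<le> (\<Sum>j<n. (M0 / real n) * norm w / real n)"
      unfolding kernel_fun_def
    proof (rule pairing_bound[OF w order_refl n continuous_on_kernel_section[OF \<kappa>]])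
      show "\<exists>p. degree p \<le> 2 * r \<and> (AE t in lebesgue_on (cell n j). norm (complex_of_real (\<kappa> (s, t)) - poly p (complex_of_real t)) \<le> M0 / real n)"
        if "j < n" for j using const_approx[OF _ _ that, of s] s AEcell by blast
    qed (use s M0 in auto)
    also have "\<dots> = M0 * norm w * (1 / real n)" using n by simp
    finally show "norm (rep_linf (?K w) s) \<le> M0 * norm w * (1 / real n)" .
  qed
  have e2: "norm (?K w) \<le> M0 * norm w * ((1 / real n) ^ (2 * r + 1) + (1 / real n) ^ 2)"
    if n: "n \<ge> 1" and w: "cell_orthogonal r n w" for n w
  proof (rule norm_linf_leI, rule AE_unit_of_cells[OF n])
    fix i assume i: "i < n"
    show "AE s in lebesgue_on (cell n i). norm (rep_linf (?K w) s) \<le> M0 * norm w * ((1 / real n) ^ (2 * r + 1) + (1 / real n) ^ 2)"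
      using AE_cell[OF repK[of w] i] AE_open_cell
    proof eventually_elim
      case (elim s)
      note s = open_cell_unit[OF i elim(2)]
      have "norm (rep_linf (?K w) s) = norm (kernel_fun \<kappa> w s)" using elim by simp
      also have "\<dots> \<le> (\<Sum>j<n. (if j = i then M0 / real n else M0 * (1 / real n) ^ (2 * r + 1)) * norm w / real n)"
        unfolding kernel_fun_def
      proof (rule pairing_bound[OF w order_refl n continuous_on_kernel_section[OF \<kappa>]])
        show "\<exists>p. degree p \<le> 2 * r \<and> (AE t in lebesgue_on (cell n j). norm (complex_of_real (\<kappa> (s, t)) - poly p (complex_of_real t))
            \<le> (if j = i then M0 / real n else M0 * (1 / real n) ^ (2 * r + 1)))" if j: "j < n" for j
        proof (cases "j = i")
          case True
          thus ?thesis using const_approx[OF _ _ j, of s] s AEcell by auto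
        next
          case False
          thus ?thesis using poly[OF i j _ elim(2)] AEcell by (simp only: if_False) blast
        qed
      qed (use s M0 in auto)
      also have "\<dots> \<le> norm w * (M0 * (1 / real n) ^ (2 * r + 1) + M0 / real n / real n)"
        using M0 by (intro sum_cells_le i) auto
      also have "\<dots> = M0 * norm w * ((1 / real n) ^ (2 * r + 1) + (1 / real n) ^ 2)"
        by (simp add: algebra_simps power2_eq_square)
      finally show ?case .
    qed
  qed
  have osc: "norm (kernel_fun \<kappa> w s - kernel_fun \<kappa> w s') \<le> 2 * M0 * norm w * (1 / real n) ^ 2"
    if n: "n \<ge> 1" and w: "cell_orthogonal r n w" and i: "i < n" and s: "s \<in> open_cell n i" "s' \<in> open_cell n i" for n w i s s'
  proof -
    have s01: "s \<in> {0..1}" "s' \<in> {0..1}" using open_cell_unit[OF i s(1)] open_cell_unit[OF i s(2)] by auto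
    note c = continuous_on_kernel_section[OF \<kappa> s01(1)] continuous_on_kernel_section[OF \<kappa> s01(2)]
    note int = c[THEN ess_bounded_mult_continuous[OF rep_linf_ess_bounded[of w]], THEN ess_bounded_integrable]
    have "kernel_fun \<kappa> w s - kernel_fun \<kappa> w s' = (LINT t|unit_lebesgue. complex_of_real (\<kappa> (s, t) - \<kappa> (s', t)) * rep_linf w t)"
      unfolding kernel_fun_def by (subst Bochner_Integration.integral_diff[OF int, symmetric]) (simp add: left_diff_distrib)
    also have "norm \<dots> \<le> (\<Sum>j<n. (if j = i then M0 / real n else M0 * (1 / real n) ^ 2) * norm w / real n)"
    proof (rule pairing_bound[OF w order_refl n])
      show "continuous_on {0..1} (\<lambda>t. complex_of_real (\<kappa> (s, t) - \<kappa> (s', t)))"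
        using continuous_on_diff[OF c] by simp
      show "\<exists>p. degree p \<le> 2 * r \<and> (AE t in lebesgue_on (cell n j). norm (complex_of_real (\<kappa> (s, t) - \<kappa> (s', t)) - poly p (complex_of_real t))
            \<le> (if j = i then M0 / real n else M0 * (1 / real n) ^ 2))" if j: "j < n" for j
      proof (cases "j = i")
        case True
        have "\<bar>s - s'\<bar> \<le> 1 / real n" using s cell_width[OF n, of i] by auto
        hence le: "M0 * \<bar>s - s'\<bar> \<le> M0 / real n" using mult_left_mono[OF _ M0] by fastforce
        have "AE t in lebesgue_on (cell n j). norm (complex_of_real (\<kappa> (s, t) - \<kappa> (s', t)) - poly 0 (complex_of_real t)) \<le> M0 / real n"
          using AE_cell[OF AE_lebesgue_on_open_interval[of 0 1] j]
        proof eventually_elim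
          case (elim t)
          show ?case using lip_s[of t s s'] elim s01 le by (simp del: of_real_diff)
        qed
        thus ?thesis using True by (intro exI[of _ 0]) simp
      next
        case False
        then obtain c where "\<forall>t\<in>cell n j. norm (complex_of_real (\<kappa> (s, t) - \<kappa> (s', t)) - c) \<le> M0 * (1 / real n) ^ 2"
          using mixed[OF i j _ s] by auto
        thus ?thesis using False AEcell[of n j "\<lambda>t. norm (complex_of_real (\<kappa> (s, t) - \<kappa> (s', t)) - c) \<le> M0 * (1 / real n) ^ 2"]
          by (intro exI[of _ "[:c:]"]) simp
      qed
    qed (use M0 in auto)
    also have "\<dots> \<le> norm w * (M0 * (1 / real n) ^ 2 + M0 / real n / real n)"
      using M0 by (intro sum_cells_le i) auto
    also have "\<dots> = 2 * M0 * norm w * (1 / real n) ^ 2" by (simp add: algebra_simps power2_eq_square)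
    finally show ?thesis .
  qed
  define B where "B = proj_const (2 * r)"
  have B: "B \<ge> 1" by (simp add: B_def proj_const_ge_1)
  have e3: "norm (?K w - (orth_projection r n) (?K w)) \<le> B * (2 * M0 * norm w * (1 / real n) ^ 2)"
    if n: "n \<ge> 1" and w: "cell_orthogonal r n w" for n w
  proof (rule norm_linf_leI, rule AE_unit_of_cells[OF n])
    fix i assume i: "i < n"
    have mid: "a < (a + b) / 2 \<and> (a + b) / 2 < b" if "a < b" for a b :: real using that by auto
    \<comment> \<open>The midpoint of the cell; the value there serves as the approximating constant.\<close>
    define s' where "s' = (real i / real n + real (Suc i) / real n) / 2"
    have s': "s' \<in> open_cell n i" using cell_bounds[OF i] mid unfolding s'_def greaterThanLessThan_iff by blast
    show "AE s in lebesgue_on (cell n i). norm (rep_linf (?K w - (orth_projection r n) (?K w)) s)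
        \<le> B * (2 * M0 * norm w * (1 / real n) ^ 2)"
      unfolding B_def
    proof (rule orth_projection_residual_le[OF i])
      show "AE s in lebesgue_on (cell n i). norm (rep_linf (?K w) s - poly [:kernel_fun \<kappa> w s':] (complex_of_real s)) \<le> 2 * M0 * norm w * (1 / real n) ^ 2"
        using AE_cell[OF repK[of w] i] AE_open_cell
      proof eventually_elim
        case (elim s)
        show ?case using osc[OF n w i elim(2) s'] elim(1) by simp
      qed
    qed (use M0 in auto)
  qed
  define M where "M = 2 * B * M0"
  have M: "M \<ge> 0" "M0 \<le> M" "B * (2 * M0 * a * b) = M * a * b" for a b
    using M0 B mult_right_mono[OF B M0] by (auto simp: M_def algebra_simps)
  show thesis
  proof (rule that[OF M(1)])
    show "norm (?K w) \<le> M * norm w * (1 / real n)" if "n \<ge> 1" "cell_orthogonal r n w" for n w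
      by (rule order_trans[OF e1[OF that]]) (intro mult_right_mono M, auto)
    show "norm (?K w) \<le> M * norm w * ((1 / real n) ^ (2 * r + 1) + (1 / real n) ^ 2)" if "n \<ge> 1" "cell_orthogonal r n w" for n w
      by (rule order_trans[OF e2[OF that]]) (intro mult_right_mono M, auto)
    show "norm (?K w - (orth_projection r n) (?K w)) \<le> M * norm w * (1 / real n) ^ 2"
      if "n \<ge> 1" "cell_orthogonal r n w" for n w
      using e3[OF that] unfolding M(3) .
  qed (use cont K in auto)
qed

section \<open>Smoothness of eigenfunctions\<close>

text \<open>
  \<open>m\<close> derivatives in the open interval, each with a continuous extension to \<open>[0,1]\<close>; at the
  endpoints only the extension is asked for, since a kernel has derivatives in the interior of the
  triangles only.
\<close>
fun smooth :: "nat \<Rightarrow> (real \<Rightarrow> complex) \<Rightarrow> bool" where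
  "smooth 0 f \<longleftrightarrow> continuous_on {0..1} f"
| "smooth (Suc m) f \<longleftrightarrow> continuous_on {0..1} f \<and>
     (\<exists>f'. (\<forall>s. 0 < s \<and> s < 1 \<longrightarrow> (f has_vector_derivative f' s) (at s)) \<and> smooth m f')"

lemma smooth_continuous: "smooth m f \<Longrightarrow> continuous_on {0..1} f"
  by (cases m) auto

lemma smooth_SucI:
  assumes "continuous_on {0..1} f" "\<And>s. 0 < s \<Longrightarrow> s < 1 \<Longrightarrow> (f has_vector_derivative f' s) (at s)" "smooth m f'"
  shows "smooth (Suc m) f"
  using assms by auto

lemma smooth_Suc_D: "smooth (Suc m) f \<Longrightarrow> smooth m f"
proof (induction m arbitrary: f)
  case (Suc m)
  then obtain f' where "continuous_on {0..1} f" "\<forall>s. 0 < s \<and> s < 1 \<longrightarrow> (f has_vector_derivative f' s) (at s)" "smooth (Suc m) f'"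
    by (metis smooth.simps(2))
  thus ?case using Suc.IH[of f'] by (intro smooth_SucI[of f f']) auto
qed simp

lemma smooth_add:
  assumes "smooth m f" "smooth m g" shows "smooth m (\<lambda>s. f s + g s)"
  using assms
proof (induction m arbitrary: f g)
  case 0 thus ?case by (auto intro: continuous_intros)
next
  case (Suc m)
  obtain f' where f: "continuous_on {0..1} f" "\<forall>s. 0 < s \<and> s < 1 \<longrightarrow> (f has_vector_derivative f' s) (at s)" "smooth m f'"
    using Suc.prems(1) by auto
  obtain g' where g: "continuous_on {0..1} g" "\<forall>s. 0 < s \<and> s < 1 \<longrightarrow> (g has_vector_derivative g' s) (at s)" "smooth m g'"
    using Suc.prems(2) by auto
  show ?case
    by (rule smooth_SucI[where f' = "\<lambda>s. f' s + g' s"])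
      (use f g Suc.IH[OF f(3) g(3)] in \<open>auto intro!: continuous_on_add has_vector_derivative_add\<close>)
qed

lemma smooth_mult:
  assumes "smooth m f" "smooth m g" shows "smooth m (\<lambda>s. f s * g s)"
  using assms
proof (induction m arbitrary: f g)
  case 0 thus ?case by (auto intro: continuous_intros)
next
  case (Suc m)
  obtain f' where f: "continuous_on {0..1} f" "\<forall>s. 0 < s \<and> s < 1 \<longrightarrow> (f has_vector_derivative f' s) (at s)" "smooth m f'"
    using Suc.prems(1) by auto
  obtain g' where g: "continuous_on {0..1} g" "\<forall>s. 0 < s \<and> s < 1 \<longrightarrow> (g has_vector_derivative g' s) (at s)" "smooth m g'"
    using Suc.prems(2) by auto
  have "smooth m (\<lambda>s. f s * g' s + f' s * g s)"
    by (intro smooth_add Suc.IH f(3) g(3) smooth_Suc_D[OF Suc.prems(1)] smooth_Suc_D[OF Suc.prems(2)])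
  thus ?case
    by (intro smooth_SucI[where f' = "\<lambda>s. f s * g' s + f' s * g s"])
      (use f g in \<open>auto intro!: continuous_on_mult has_vector_derivative_mult\<close>)
qed

lemma smooth_const: "smooth m (\<lambda>_. c)"
proof (induction m arbitrary: c)
  case (Suc m)
  show ?case by (rule smooth_SucI[where f' = "\<lambda>_. 0"]) (auto intro: Suc.IH)
qed simp

lemma smooth_reflect: "smooth m f \<Longrightarrow> smooth m (\<lambda>s. f (1 - s))"
proof (induction m arbitrary: f)
  case 0 thus ?case by (auto intro!: continuous_on_compose2[of "{0..1}" f] continuous_intros)
next
  case (Suc m)
  obtain f' where f: "continuous_on {0..1} f" "\<forall>s. 0 < s \<and> s < 1 \<longrightarrow> (f has_vector_derivative f' s) (at s)" "smooth m f'"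
    using Suc.prems(1) by auto
  show ?case
  proof (rule smooth_SucI[where f' = "\<lambda>s. (- 1) * f' (1 - s)"])
    show "continuous_on {0..1} (\<lambda>s. f (1 - s))"
      by (intro continuous_on_compose2[OF f(1)] continuous_intros) auto
    show "((\<lambda>s. f (1 - s)) has_vector_derivative (- 1) * f' (1 - s)) (at s)" if "0 < s" "s < 1" for s
    proof -
      have "((\<lambda>s. 1 - s) has_vector_derivative (- 1 :: real)) (at s)" by (auto intro!: derivative_eq_intros)
      moreover have "(f has_vector_derivative f' (1 - s)) (at (1 - s))" using f(2) that by simp
      ultimately show ?thesis using vector_diff_chain_at[of "\<lambda>s. 1 - s" "- 1" s f "f' (1 - s)"] by (simp add: o_def)
    qed
    show "smooth m (\<lambda>s. (- 1) * f' (1 - s))" by (intro smooth_mult smooth_const Suc.IH f(3))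
  qed
qed

lemma smooth_derivatives:
  assumes "smooth m f"
  shows "\<exists>G. G 0 = f \<and> (\<forall>k\<le>m. continuous_on {0..1} (G k)) \<and>
     (\<forall>k<m. \<forall>s. 0 < s \<and> s < 1 \<longrightarrow> (G k has_vector_derivative G (Suc k) s) (at s))"
  using assms
proof (induction m arbitrary: f)
  case 0 thus ?case by (intro exI[of _ "\<lambda>_. f"]) auto
next
  case (Suc m)
  obtain f' where f: "continuous_on {0..1} f" "\<forall>s. 0 < s \<and> s < 1 \<longrightarrow> (f has_vector_derivative f' s) (at s)" "smooth m f'"
    using Suc.prems(1) by auto
  obtain G where G: "G 0 = f'" "\<forall>k\<le>m. continuous_on {0..1} (G k)"
     "\<forall>k<m. \<forall>s. 0 < s \<and> s < 1 \<longrightarrow> (G k has_vector_derivative G (Suc k) s) (at s)"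
    using Suc.IH[OF f(3)] by blast
  define H where "H k = (case k of 0 \<Rightarrow> f | Suc k \<Rightarrow> G k)" for k
  have "continuous_on {0..1} (H k)" if "k \<le> Suc m" for k using f(1) G(2) that by (cases k) (auto simp: H_def)
  moreover have "(H k has_vector_derivative H (Suc k) s) (at s)" if "k < Suc m" "0 < s" "s < 1" for k s
    using f(2) G(1,3) that by (cases k) (auto simp: H_def)
  ultimately show ?case by (intro exI[of _ H]) (auto simp: H_def)
qed

lemma smooth_poly_approx:
  assumes "smooth (Suc m) f"
  obtains M where "M \<ge> 0" "\<And>a b. 0 \<le> a \<Longrightarrow> a \<le> b \<Longrightarrow> b \<le> 1 \<Longrightarrow>
     \<exists>p. degree p \<le> m \<and> (\<forall>t\<in>{a..b}. norm (f t - poly p (complex_of_real t)) \<le> M * (b - a) ^ Suc m)"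
proof -
  obtain G where G: "G 0 = f" "\<forall>k\<le>Suc m. continuous_on {0..1} (G k)"
     "\<forall>k<Suc m. \<forall>s. 0 < s \<and> s < 1 \<longrightarrow> (G k has_vector_derivative G (Suc k) s) (at s)"
    using smooth_derivatives[OF assms] by blast
  have "compact (G (Suc m) ` {0..1})" using G(2) by (intro compact_continuous_image) auto
  hence "bounded (G (Suc m) ` {0..1})" by (rule compact_imp_bounded)
  then obtain M where M: "\<forall>x\<in>G (Suc m) ` {0..1}. norm x \<le> M" unfolding bounded_iff ..
  show thesis
  proof (rule that[of "max M 0"])
    fix a b :: real assume ab: "0 \<le> a" "a \<le> b" "b \<le> 1"
    have "\<exists>p. degree p \<le> m \<and> (\<forall>t\<in>{a..b}. norm (G 0 t - poly p (complex_of_real t)) \<le> max M 0 * (b - a) ^ Suc m)"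
    proof (rule poly_approx[OF ab(2)])
      show "continuous_on {a..b} (G k)" if "k \<le> m" for k
        by (rule continuous_on_subset[of "{0..1}"]) (use G(2) that ab in auto)
      show "(G k has_vector_derivative G (Suc k) t) (at t)" if "k \<le> m" "a < t" "t < b" for k t
        using G(3) that ab by auto
      show "norm (G (Suc m) t) \<le> max M 0" if "a < t" "t < b" for t
        using M that ab by (auto simp: le_max_iff_disj)
    qed
    thus "\<exists>p. degree p \<le> m \<and> (\<forall>t\<in>{a..b}. norm (f t - poly p (complex_of_real t)) \<le> max M 0 * (b - a) ^ Suc m)"
      by (simp add: G(1))
  qed simp
qed

text \<open>
  A one-sided difference estimate that is uniform in the base point gives the two-sided
  derivative: for points to the left, exchange the roles of the two points and use continuity of \<open>G\<close>.
  It suits functions built from a kernel on the lower triangle: from \<open>s1\<close> to a larger \<open>s2\<close> one can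
  move inside the triangle, namely along \<open>(s2,s1)\<close>.
\<close>
lemma has_vector_derivative_if_uniform_right:
  fixes F G :: "real \<Rightarrow> complex"
  assumes G: "continuous_on {0..1} G"
    and F: "\<And>\<epsilon>. \<epsilon> > 0 \<Longrightarrow> \<exists>\<delta>>0. \<forall>s1 s2. 0 < s1 \<and> s1 < s2 \<and> s2 < 1 \<and> s2 - s1 < \<delta> \<longrightarrow>
        norm (F s2 - F s1 - of_real (s2 - s1) * G s1) \<le> \<epsilon> * (s2 - s1)"
    and s: "0 < s" "s < 1"
  shows "(F has_vector_derivative G s) (at s)"
  unfolding has_vector_derivative_def has_derivative_at_alt
proof (intro conjI allI impI)
  show "bounded_linear (\<lambda>x. x *\<^sub>R G s)" by (rule bounded_linear_scaleR_left)
  fix e :: real assume e: "0 < e"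
  hence e2: "e / 2 > 0" by simp
  obtain d1 where d1: "d1 > 0" "\<And>s1 s2. 0 < s1 \<Longrightarrow> s1 < s2 \<Longrightarrow> s2 < 1 \<Longrightarrow> s2 - s1 < d1 \<Longrightarrow>
        norm (F s2 - F s1 - of_real (s2 - s1) * G s1) \<le> e / 2 * (s2 - s1)"
    using F[OF e2] by blast
  obtain d2 where d2: "d2 > 0" "\<And>y. y \<in> {0..1} \<Longrightarrow> dist y s < d2 \<Longrightarrow> dist (G y) (G s) < e / 2"
    using G s e2 unfolding continuous_on_iff by (metis atLeastAtMost_iff less_eq_real_def)
  define d where "d = min (min d1 d2) (min s (1 - s))"
  have d: "d > 0" using d1(1) d2(1) s by (simp add: d_def)
  have "norm (F y - F s - (y - s) *\<^sub>R G s) \<le> e * norm (y - s)" if y: "norm (y - s) < d" for y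
  proof -
    have y01: "0 < y" "y < 1" "\<bar>y - s\<bar> < d1" "\<bar>y - s\<bar> < d2" using y by (auto simp: d_def)
    consider "s < y" | "y = s" | "y < s" by linarith
    thus ?thesis
    proof cases
      case 1
      have "norm (F y - F s - of_real (y - s) * G s) \<le> e / 2 * (y - s)" using d1(2)[of s y] s y01 1 by simp
      also have "\<dots> \<le> e * norm (y - s)" using 1 e by simp
      finally show ?thesis by (simp add: scaleR_conv_of_real)
    next
      case 3
      have a: "norm (F s - F y - of_real (s - y) * G y) \<le> e / 2 * (s - y)" using d1(2)[of y s] s y01 3 by simp
      have "norm (G y - G s) \<le> e / 2" using d2(2)[of y] y01 by (simp add: dist_norm dist_real_def)
      hence b: "norm (of_real (s - y) * (G y - G s)) \<le> e / 2 * (s - y)"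
        unfolding norm_mult norm_of_real using 3 by (simp add: mult.commute)
      have "F y - F s - (y - s) *\<^sub>R G s = - ((F s - F y - of_real (s - y) * G y) + of_real (s - y) * (G y - G s))"
        by (simp add: scaleR_conv_of_real algebra_simps)
      hence "norm (F y - F s - (y - s) *\<^sub>R G s) \<le> e / 2 * (s - y) + e / 2 * (s - y)"
        using norm_triangle_mono[OF a b] by (simp only: norm_minus_cancel)
      thus ?thesis using 3 by simp
    qed simp
  qed
  thus "\<exists>d>0. \<forall>y. norm (y - s) < d \<longrightarrow> norm (F y - F s - (y - s) *\<^sub>R G s) \<le> e * norm (y - s)" using d by blast
qed

lemma linearization:
  fixes f f' :: "real \<Rightarrow> complex"
  assumes "a \<le> b" "continuous_on {a..b} f"
    and f': "\<And>x. a < x \<Longrightarrow> x < b \<Longrightarrow> (f has_vector_derivative f' x) (at x)"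
    and M: "\<And>x. a < x \<Longrightarrow> x < b \<Longrightarrow> norm (f' x - c) \<le> \<epsilon>"
  shows "norm (f b - f a - of_real (b - a) * c) \<le> \<epsilon> * (b - a)"
proof -
  have "norm ((f b - of_real b * c) - (f a - of_real a * c)) \<le> \<epsilon> * (b - a)"
  proof (rule mean_value_norm_le[OF assms(1), of "\<lambda>x. f x - of_real x * c" "\<lambda>x. f' x - c"])
    show "continuous_on {a..b} (\<lambda>x. f x - of_real x * c)" by (intro continuous_intros assms(2))
    show "((\<lambda>x. f x - of_real x * c) has_vector_derivative f' x - c) (at x)" if "a < x" "x < b" for x
      using f'[OF that] by (auto intro!: derivative_eq_intros)
  qed (use M in auto)
  thus ?thesis by (simp add: algebra_simps)
qed

lemma compact_lower_triangle: "compact lower_triangle"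
proof -
  have "closed {x::real \<times> real. 0 \<le> snd x \<and> snd x \<le> fst x \<and> fst x \<le> 1}"
    by (intro closed_Collect_conj closed_Collect_le continuous_intros)
  moreover have "lower_triangle = {x. 0 \<le> snd x \<and> snd x \<le> fst x \<and> fst x \<le> 1}"
    by (auto simp: lower_triangle_def)
  moreover have "lower_triangle \<subseteq> {0..1} \<times> {0..1}" by (auto simp: lower_triangle_def)
  hence "bounded lower_triangle" by (rule bounded_subset[rotated]) (intro bounded_Times bounded_closed_interval)
  ultimately show ?thesis by (simp add: compact_eq_bounded_closed)
qed

lemma lower_triangle_uniform:
  fixes H :: "real \<times> real \<Rightarrow> complex"
  assumes "continuous_on lower_triangle H" "\<epsilon> > 0"
  obtains \<delta> where "\<delta> > 0" "\<And>s t s' t'. (s, t) \<in> lower_triangle \<Longrightarrow> (s', t') \<in> lower_triangle \<Longrightarrow>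
     \<bar>s - s'\<bar> < \<delta> \<Longrightarrow> \<bar>t - t'\<bar> < \<delta> \<Longrightarrow> norm (H (s, t) - H (s', t')) \<le> \<epsilon>"
proof -
  have "uniformly_continuous_on lower_triangle H"
    by (rule compact_uniformly_continuous[OF assms(1) compact_lower_triangle])
  then obtain d where d: "d > 0" "\<And>x y. x \<in> lower_triangle \<Longrightarrow> y \<in> lower_triangle \<Longrightarrow> dist y x < d \<Longrightarrow> dist (H y) (H x) < \<epsilon>"
    using assms(2) unfolding uniformly_continuous_on_def by metis
  show thesis
  proof (rule that[of "d / 2"])
    fix s t s' t' :: real assume st: "(s, t) \<in> lower_triangle" "(s', t') \<in> lower_triangle" "\<bar>s - s'\<bar> < d / 2" "\<bar>t - t'\<bar> < d / 2"
    have "dist (s, t) (s', t') \<le> dist s s' + dist t t'"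
      unfolding dist_Pair_Pair by (rule sqrt_sum_squares_le_sum) auto
    hence "dist (s, t) (s', t') < d" using st(3,4) by (simp add: dist_real_def)
    thus "norm (H (s, t) - H (s', t')) \<le> \<epsilon>" using d(2)[OF st(2,1)] by (simp add: dist_norm)
  qed (use d(1) in simp)
qed

lemma partials_continuous_complex:
  assumes "partials_on J \<Omega> D" "(j, k) \<in> J"
  shows "continuous_on \<Omega> (\<lambda>x. complex_of_real (D j k x))"
  by (intro continuous_on_of_real partials_onD(1)[OF assms])

text \<open>
  Going from \<open>(s1,s1)\<close> to \<open>(s2,s2)\<close> along \<open>(s2,s1)\<close> stays in the triangle, so the two partial
  derivatives add up to the derivative of the trace.
\<close>
lemma smooth_diagonal:
  assumes D: "partials_on ({0..N} \<times> {0..N}) lower_triangle D"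
  shows "j + m \<le> N \<Longrightarrow> k + m \<le> N \<Longrightarrow> smooth m (\<lambda>s. complex_of_real (D j k (s, s)))"
proof (induction m arbitrary: j k)
  case 0
  have "continuous_on {0..1} (\<lambda>s. complex_of_real (D j k (s, s)))"
    by (rule continuous_on_compose2[OF partials_continuous_complex[OF D, of j k], of "{0..1}" "\<lambda>s. (s, s)"])
      (use 0 in \<open>auto intro!: continuous_intros simp: lower_triangle_def\<close>)
  thus ?case by simp
next
  case (Suc m)
  let ?G = "\<lambda>s. complex_of_real (D (Suc j) k (s, s)) + of_real (D j (Suc k) (s, s))"
  have J: "(j, k) \<in> {0..N} \<times> {0..N}" "(Suc j, k) \<in> {0..N} \<times> {0..N}" "(j, Suc k) \<in> {0..N} \<times> {0..N}"
    using Suc.prems by auto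
  have cont: "continuous_on {0..1} (\<lambda>s. complex_of_real (D j k (s, s)))"
    by (rule continuous_on_compose2[OF partials_continuous_complex[OF D J(1)], of "{0..1}" "\<lambda>s. (s, s)"])
      (auto intro!: continuous_intros simp: lower_triangle_def)
  have smooth: "smooth m ?G" using Suc.prems by (intro smooth_add Suc.IH) auto
  show ?case
  proof (rule smooth_SucI[OF cont _ smooth], rule has_vector_derivative_if_uniform_right[OF smooth_continuous[OF smooth]])
    fix \<epsilon> :: real assume "\<epsilon> > 0"
    hence e2: "\<epsilon> / 2 > 0" by simp
    obtain d1 where d1: "d1 > 0" "\<And>s t s' t'. (s, t) \<in> lower_triangle \<Longrightarrow> (s', t') \<in> lower_triangle \<Longrightarrow>
       \<bar>s - s'\<bar> < d1 \<Longrightarrow> \<bar>t - t'\<bar> < d1 \<Longrightarrow> norm (complex_of_real (D (Suc j) k (s, t)) - of_real (D (Suc j) k (s', t'))) \<le> \<epsilon> / 2"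
      using lower_triangle_uniform[OF partials_continuous_complex[OF D J(2)] e2] by metis
    obtain d2 where d2: "d2 > 0" "\<And>s t s' t'. (s, t) \<in> lower_triangle \<Longrightarrow> (s', t') \<in> lower_triangle \<Longrightarrow>
       \<bar>s - s'\<bar> < d2 \<Longrightarrow> \<bar>t - t'\<bar> < d2 \<Longrightarrow> norm (complex_of_real (D j (Suc k) (s, t)) - of_real (D j (Suc k) (s', t'))) \<le> \<epsilon> / 2"
      using lower_triangle_uniform[OF partials_continuous_complex[OF D J(3)] e2] by metis
    have "norm (complex_of_real (D j k (s2, s2)) - of_real (D j k (s1, s1)) - of_real (s2 - s1) * ?G s1) \<le> \<epsilon> * (s2 - s1)"
      if s: "0 < s1" "s1 < s2" "s2 < 1" "s2 - s1 < min d1 d2" for s1 s2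
    proof -
      have A: "norm (complex_of_real (D j k (s2, s1)) - of_real (D j k (s1, s1)) - of_real (s2 - s1) * of_real (D (Suc j) k (s1, s1))) \<le> \<epsilon> / 2 * (s2 - s1)"
      proof (rule linearization[where f = "\<lambda>u. complex_of_real (D j k (u, s1))" and f' = "\<lambda>u. complex_of_real (D (Suc j) k (u, s1))"])
        show "continuous_on {s1..s2} (\<lambda>u. complex_of_real (D j k (u, s1)))"
          by (rule continuous_on_section_fst[OF D J(1)]) (use s in \<open>auto simp: mem_lower_triangle\<close>)
        show "((\<lambda>u. complex_of_real (D j k (u, s1))) has_vector_derivative complex_of_real (D (Suc j) k (x, s1))) (at x)" if "s1 < x" "x < s2" for x
          by (rule partial_fst_vector_derivative[OF D lower_triangle_interior J(2)]) (use s that in auto)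
        show "norm (complex_of_real (D (Suc j) k (x, s1)) - of_real (D (Suc j) k (s1, s1))) \<le> \<epsilon> / 2" if "s1 < x" "x < s2" for x
          by (rule d1(2)) (use s that in \<open>auto simp: mem_lower_triangle\<close>)
      qed (use s in simp)
      have B: "norm (complex_of_real (D j k (s2, s2)) - of_real (D j k (s2, s1)) - of_real (s2 - s1) * of_real (D j (Suc k) (s1, s1))) \<le> \<epsilon> / 2 * (s2 - s1)"
      proof (rule linearization[where f = "\<lambda>u. complex_of_real (D j k (s2, u))" and f' = "\<lambda>u. complex_of_real (D j (Suc k) (s2, u))"])
        show "continuous_on {s1..s2} (\<lambda>u. complex_of_real (D j k (s2, u)))"
          by (rule continuous_on_section_snd[OF D J(1)]) (use s in \<open>auto simp: mem_lower_triangle\<close>)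
        show "((\<lambda>u. complex_of_real (D j k (s2, u))) has_vector_derivative complex_of_real (D j (Suc k) (s2, x))) (at x)" if "s1 < x" "x < s2" for x
          by (rule partial_snd_vector_derivative[OF D lower_triangle_interior J(3)]) (use s that in auto)
        show "norm (complex_of_real (D j (Suc k) (s2, x)) - of_real (D j (Suc k) (s1, s1))) \<le> \<epsilon> / 2" if "s1 < x" "x < s2" for x
          by (rule d2(2)) (use s that in \<open>auto simp: mem_lower_triangle\<close>)
      qed (use s in simp)
      show ?thesis using norm_triangle_mono[OF A B] by (simp add: algebra_simps)
    qed
    thus "\<exists>\<delta>>0. \<forall>s1 s2. 0 < s1 \<and> s1 < s2 \<and> s2 < 1 \<and> s2 - s1 < \<delta> \<longrightarrow>
        norm (complex_of_real (D j k (s2, s2)) - of_real (D j k (s1, s1)) - of_real (s2 - s1) * ?G s1) \<le> \<epsilon> * (s2 - s1)"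
      using d1(1) d2(1) by (intro exI[of _ "min d1 d2"]) simp
  qed
qed

lemma continuous_on_volterra_integrand:
  assumes D: "partials_on J lower_triangle D" "(j, k) \<in> J" and \<phi>: "continuous_on {0..1} \<phi>"
    and s: "0 \<le> a" "b \<le> s" "s \<le> 1"
  shows "continuous_on {a..b} (\<lambda>t. complex_of_real (D j k (s, t)) * \<phi> t)"
  using s by (intro continuous_on_mult continuous_on_section_snd[OF D] continuous_on_subset[OF \<phi>])
    (auto simp: mem_lower_triangle)

lemma volterra_diff:
  assumes D: "partials_on J lower_triangle D" "(j, k) \<in> J" and \<phi>: "continuous_on {0..1} \<phi>"
    and s: "0 \<le> s1" "s1 \<le> s2" "s2 \<le> 1"
  shows "integral {0..s2} (\<lambda>t. complex_of_real (D j k (s2, t)) * \<phi> t) - integral {0..s1} (\<lambda>t. complex_of_real (D j k (s1, t)) * \<phi> t)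
    = integral {s1..s2} (\<lambda>t. complex_of_real (D j k (s2, t)) * \<phi> t)
      + integral {0..s1} (\<lambda>t. (complex_of_real (D j k (s2, t)) - of_real (D j k (s1, t))) * \<phi> t)"
proof -
  note c = continuous_on_volterra_integrand[OF D \<phi>]
  have "integral {0..s2} (\<lambda>t. complex_of_real (D j k (s2, t)) * \<phi> t)
     = integral {0..s1} (\<lambda>t. complex_of_real (D j k (s2, t)) * \<phi> t) + integral {s1..s2} (\<lambda>t. complex_of_real (D j k (s2, t)) * \<phi> t)"
    by (rule Henstock_Kurzweil_Integration.integral_combine[symmetric])
      (use s in \<open>auto intro!: integrable_continuous_real c\<close>)
  moreover have "integral {0..s1} (\<lambda>t. (complex_of_real (D j k (s2, t)) - of_real (D j k (s1, t))) * \<phi> t)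
     = integral {0..s1} (\<lambda>t. complex_of_real (D j k (s2, t)) * \<phi> t) - integral {0..s1} (\<lambda>t. complex_of_real (D j k (s1, t)) * \<phi> t)"
    unfolding left_diff_distrib
    by (rule Henstock_Kurzweil_Integration.integral_diff) (use s in \<open>auto intro!: integrable_continuous_real c\<close>)
  ultimately show ?thesis by simp
qed

lemma continuous_bounded:
  fixes f :: "real \<Rightarrow> complex"
  assumes "continuous_on {0..1} f" obtains M where "M > 0" "\<And>t. t \<in> {0..1} \<Longrightarrow> norm (f t) \<le> M"
proof -
  have "bounded (f ` {0..1})" by (intro compact_imp_bounded compact_continuous_image assms) simp
  then obtain M where "M > 0" "\<forall>x\<in>f ` {0..1}. norm x \<le> M" unfolding bounded_pos by blast
  thus thesis by (intro that[of M]) auto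
qed

lemma norm_le_closed_interval:
  fixes f :: "real \<Rightarrow> complex"
  assumes "continuous_on {a..b} f" "a < b" "\<And>t. a < t \<Longrightarrow> t < b \<Longrightarrow> norm (f t) \<le> B" "t \<in> {a..b}"
  shows "norm (f t) \<le> B"
proof (rule continuous_on_closure_norm_le[of "{a<..<b}" f])
  show "continuous_on (closure {a<..<b}) f" "t \<in> closure {a<..<b}"
    using assms by (simp_all add: closure_greaterThanLessThan)
qed (use assms in auto)

lemma continuous_on_volterra:
  assumes D: "partials_on J lower_triangle D" "(j, k) \<in> J" and \<phi>: "continuous_on {0..1} \<phi>"
  shows "continuous_on {0..1} (\<lambda>s. integral {0..s} (\<lambda>t. complex_of_real (D j k (s, t)) * \<phi> t))"
    (is "continuous_on _ ?F")
  unfolding continuous_on_iff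
proof (intro ballI allI impI)
  fix s e :: real assume s: "s \<in> {0..1}" and e: "e > 0"
  obtain \<Phi> where \<Phi>: "\<Phi> > 0" "\<And>t. t \<in> {0..1} \<Longrightarrow> norm (\<phi> t) \<le> \<Phi>" using continuous_bounded[OF \<phi>] by blast
  obtain M where M: "M \<ge> 0" "\<forall>x\<in>lower_triangle. \<bar>D j k x\<bar> \<le> M" using partials_onD(2)[OF D] by blast
  \<comment> \<open>The strip and the change of the kernel section each contribute at most \<open>e/4\<close>.\<close>
  define \<epsilon> where "\<epsilon> = e / (4 * \<Phi>)"
  have \<epsilon>: "\<epsilon> > 0" "\<epsilon> * \<Phi> = e / 4" using e \<Phi>(1) by (auto simp: \<epsilon>_def)
  obtain d1 where d1: "d1 > 0" "\<And>s t s' t'. (s, t) \<in> lower_triangle \<Longrightarrow> (s', t') \<in> lower_triangle \<Longrightarrow>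
       \<bar>s - s'\<bar> < d1 \<Longrightarrow> \<bar>t - t'\<bar> < d1 \<Longrightarrow> norm (complex_of_real (D j k (s, t)) - of_real (D j k (s', t'))) \<le> \<epsilon>"
    using lower_triangle_uniform[OF partials_continuous_complex[OF D] \<epsilon>(1)] by metis
  define d where "d = min d1 (e / (4 * (M * \<Phi> + 1)))"
  have MP: "M * \<Phi> + 1 > 0" using M(1) \<Phi>(1) by (simp add: add_nonneg_pos)
  have d: "d > 0" using d1(1) e MP by (simp add: d_def)
  have cancel: "c * (e / (4 * c)) = e / 4" if "c > 0" for c :: real using that by simp
  have main: "norm (?F s2 - ?F s1) < e" if s: "0 \<le> s1" "s1 \<le> s2" "s2 \<le> 1" "s2 - s1 < d" for s1 s2
  proof -
    have "norm (integral {s1..s2} (\<lambda>t. complex_of_real (D j k (s2, t)) * \<phi> t)) \<le> M * \<Phi> * (s2 - s1)"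
    proof (rule integral_bound[OF s(2) continuous_on_volterra_integrand[OF D \<phi>]])
      fix t assume "t \<in> {s1..s2}"
      thus "norm (complex_of_real (D j k (s2, t)) * \<phi> t) \<le> M * \<Phi>"
        unfolding norm_mult norm_of_real using s M \<Phi> by (intro mult_mono) (auto simp: mem_lower_triangle)
    qed (use s in auto)
    also have "\<dots> \<le> e / 4"
    proof -
      have "M * \<Phi> * (s2 - s1) \<le> (M * \<Phi> + 1) * (s2 - s1)" using s by (intro mult_right_mono) auto
      also have "\<dots> \<le> (M * \<Phi> + 1) * (e / (4 * (M * \<Phi> + 1)))" using s MP by (intro mult_left_mono) (auto simp: d_def)
      also have "\<dots> = e / 4" using cancel[OF MP] .
      finally show ?thesis .
    qed
    finally have A: "norm (integral {s1..s2} (\<lambda>t. complex_of_real (D j k (s2, t)) * \<phi> t)) \<le> e / 4" .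
    have "norm (integral {0..s1} (\<lambda>t. (complex_of_real (D j k (s2, t)) - of_real (D j k (s1, t))) * \<phi> t)) \<le> \<epsilon> * \<Phi> * (s1 - 0)"
    proof (rule integral_bound[OF s(1)])
      show "continuous_on {0..s1} (\<lambda>t. (complex_of_real (D j k (s2, t)) - of_real (D j k (s1, t))) * \<phi> t)"
        unfolding left_diff_distrib by (intro continuous_on_diff continuous_on_volterra_integrand[OF D \<phi>]) (use s in auto)
      fix t assume "t \<in> {0..s1}"
      thus "norm ((complex_of_real (D j k (s2, t)) - of_real (D j k (s1, t))) * \<phi> t) \<le> \<epsilon> * \<Phi>"
        unfolding norm_mult using s \<Phi> \<epsilon>(1) d1(1)
        by (intro mult_mono d1(2)) (auto simp: mem_lower_triangle d_def)
    qed
    also have "\<dots> \<le> e / 4" unfolding \<epsilon>(2) using e s mult_left_mono[of s1 1 "e / 4"] by simp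
    finally have B: "norm (integral {0..s1} (\<lambda>t. (complex_of_real (D j k (s2, t)) - of_real (D j k (s1, t))) * \<phi> t)) \<le> e / 4" .
    show ?thesis unfolding volterra_diff[OF D \<phi> s(1-3)] using norm_triangle_mono[OF A B] e by simp
  qed
  have "dist (?F s') (?F s) < e" if "s' \<in> {0..1}" "dist s' s < d" for s'
    using main[of s s'] main[of s' s] s that
    by (cases "s \<le> s'") (auto simp: dist_norm norm_minus_commute dist_real_def)
  thus "\<exists>d>0. \<forall>s'\<in>{0..1}. dist s' s < d \<longrightarrow> dist (?F s') (?F s) < e" using d by blast
qed

text \<open>
  The boundary term comes from the strip \<open>[s1,s2]\<close>; on \<open>[0,s1]\<close> the kernel can be
  differentiated, and uniform continuity of its derivative makes the error uniform in \<open>t\<close>.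
\<close>
lemma volterra_derivative:
  assumes D: "partials_on J lower_triangle D" and J: "(j, 0) \<in> J" "(Suc j, 0) \<in> J" and \<phi>: "continuous_on {0..1} \<phi>"
    and s: "0 < s" "s < 1"
  shows "((\<lambda>s. integral {0..s} (\<lambda>t. complex_of_real (D j 0 (s, t)) * \<phi> t)) has_vector_derivative
     complex_of_real (D j 0 (s, s)) * \<phi> s + integral {0..s} (\<lambda>t. complex_of_real (D (Suc j) 0 (s, t)) * \<phi> t)) (at s)"
    (is "(?F has_vector_derivative ?g s + ?F' s) _")
proof (rule has_vector_derivative_if_uniform_right[OF _ _ s])
  have diag: "continuous_on {0..1} (\<lambda>s. complex_of_real (D j 0 (s, s)))"
    by (rule continuous_on_compose2[OF partials_continuous_complex[OF D J(1)], of "{0..1}" "\<lambda>s. (s, s)"])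
      (auto intro!: continuous_intros simp: lower_triangle_def)
  show "continuous_on {0..1} (\<lambda>s. ?g s + ?F' s)"
    by (intro continuous_on_add continuous_on_mult diag \<phi> continuous_on_volterra[OF D J(2) \<phi>])
  fix \<epsilon> :: real assume e: "\<epsilon> > 0"
  obtain \<Phi> where \<Phi>: "\<Phi> > 0" "\<And>t. t \<in> {0..1} \<Longrightarrow> norm (\<phi> t) \<le> \<Phi>" using continuous_bounded[OF \<phi>] by blast
  have e2: "\<epsilon> / 2 > 0" "\<epsilon> / (2 * \<Phi>) > 0" using e \<Phi>(1) by auto
  have "continuous_on lower_triangle (\<lambda>x. \<phi> (snd x))"
    by (intro continuous_on_compose2[OF \<phi>] continuous_intros) (auto simp: lower_triangle_def)
  hence cH: "continuous_on lower_triangle (\<lambda>x. complex_of_real (D j 0 x) * \<phi> (snd x))"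
    by (intro continuous_on_mult partials_continuous_complex[OF D J(1)])
  obtain d1 where d1: "d1 > 0" "\<And>s t s' t'. (s, t) \<in> lower_triangle \<Longrightarrow> (s', t') \<in> lower_triangle \<Longrightarrow>
       \<bar>s - s'\<bar> < d1 \<Longrightarrow> \<bar>t - t'\<bar> < d1 \<Longrightarrow> norm (complex_of_real (D j 0 (s, t)) * \<phi> t - of_real (D j 0 (s', t')) * \<phi> t') \<le> \<epsilon> / 2"
    using lower_triangle_uniform[OF cH e2(1)] by (metis snd_conv)
  obtain d2 where d2: "d2 > 0" "\<And>s t s' t'. (s, t) \<in> lower_triangle \<Longrightarrow> (s', t') \<in> lower_triangle \<Longrightarrow>
       \<bar>s - s'\<bar> < d2 \<Longrightarrow> \<bar>t - t'\<bar> < d2 \<Longrightarrow> norm (complex_of_real (D (Suc j) 0 (s, t)) - of_real (D (Suc j) 0 (s', t'))) \<le> \<epsilon> / (2 * \<Phi>)"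
    using lower_triangle_uniform[OF partials_continuous_complex[OF D J(2)] e2(2)] by metis
  have "norm (?F s2 - ?F s1 - of_real (s2 - s1) * (?g s1 + ?F' s1)) \<le> \<epsilon> * (s2 - s1)"
    if s: "0 < s1" "s1 < s2" "s2 < 1" "s2 - s1 < min d1 d2" for s1 s2
  proof -
    have c2: "continuous_on {s1..s2} (\<lambda>t. complex_of_real (D j 0 (s2, t)) * \<phi> t)"
      by (rule continuous_on_volterra_integrand[OF D J(1) \<phi>]) (use s in auto)
    have "norm (integral {s1..s2} (\<lambda>t. complex_of_real (D j 0 (s2, t)) * \<phi> t - ?g s1)) \<le> \<epsilon> / 2 * (s2 - s1)"
    proof (rule integral_bound)
      show "continuous_on {s1..s2} (\<lambda>t. complex_of_real (D j 0 (s2, t)) * \<phi> t - ?g s1)"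
        by (intro continuous_on_diff c2 continuous_on_const)
      fix t assume "t \<in> {s1..s2}"
      thus "norm (complex_of_real (D j 0 (s2, t)) * \<phi> t - ?g s1) \<le> \<epsilon> / 2"
        by (intro d1(2)) (use s in \<open>auto simp: mem_lower_triangle\<close>)
    qed (use s in simp)
    also have "integral {s1..s2} (\<lambda>t. complex_of_real (D j 0 (s2, t)) * \<phi> t - ?g s1)
        = integral {s1..s2} (\<lambda>t. complex_of_real (D j 0 (s2, t)) * \<phi> t) - of_real (s2 - s1) * ?g s1"
      using s by (subst Henstock_Kurzweil_Integration.integral_diff)
        (auto intro!: integrable_continuous_real c2 simp: scaleR_conv_of_real)
    finally have A: "norm (integral {s1..s2} (\<lambda>t. complex_of_real (D j 0 (s2, t)) * \<phi> t) - of_real (s2 - s1) * ?g s1) \<le> \<epsilon> / 2 * (s2 - s1)" .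
    let ?r = "\<lambda>t. complex_of_real (D j 0 (s2, t)) - of_real (D j 0 (s1, t)) - of_real (s2 - s1) * of_real (D (Suc j) 0 (s1, t))"
    have cr: "continuous_on {0..s1} ?r"
      by (intro continuous_on_diff continuous_on_mult continuous_on_const
          continuous_on_section_snd[OF D J(1)] continuous_on_section_snd[OF D J(2)])
        (use s in \<open>auto simp: mem_lower_triangle\<close>)
    have r_open: "norm (?r t) \<le> \<epsilon> / (2 * \<Phi>) * (s2 - s1)" if t: "0 < t" "t < s1" for t
    proof (rule linearization[where f = "\<lambda>u. complex_of_real (D j 0 (u, t))" and f' = "\<lambda>u. complex_of_real (D (Suc j) 0 (u, t))"])
      show "continuous_on {s1..s2} (\<lambda>u. complex_of_real (D j 0 (u, t)))"
        by (rule continuous_on_section_fst[OF D J(1)]) (use s t in \<open>auto simp: mem_lower_triangle\<close>)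
      show "((\<lambda>u. complex_of_real (D j 0 (u, t))) has_vector_derivative complex_of_real (D (Suc j) 0 (x, t))) (at x)" if "s1 < x" "x < s2" for x
        by (rule partial_fst_vector_derivative[OF D lower_triangle_interior J(2)]) (use s t that in auto)
      show "norm (complex_of_real (D (Suc j) 0 (x, t)) - of_real (D (Suc j) 0 (s1, t))) \<le> \<epsilon> / (2 * \<Phi>)" if "s1 < x" "x < s2" for x
        by (rule d2(2)) (use s t that d2(1) in \<open>auto simp: mem_lower_triangle\<close>)
    qed (use s in simp)
    have r: "norm (?r t) \<le> \<epsilon> / (2 * \<Phi>) * (s2 - s1)" if t: "t \<in> {0..s1}" for t
      by (rule norm_le_closed_interval[OF cr s(1) r_open t])
    have "norm (integral {0..s1} (\<lambda>t. ?r t * \<phi> t)) \<le> \<epsilon> / (2 * \<Phi>) * (s2 - s1) * \<Phi> * (s1 - 0)"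
    proof (rule integral_bound)
      show "continuous_on {0..s1} (\<lambda>t. ?r t * \<phi> t)"
        by (intro continuous_on_mult cr continuous_on_subset[OF \<phi>]) (use s in auto)
      fix t assume t: "t \<in> {0..s1}"
      show "norm (?r t * \<phi> t) \<le> \<epsilon> / (2 * \<Phi>) * (s2 - s1) * \<Phi>"
      proof -
        have "0 \<le> \<epsilon> / (2 * \<Phi>) * (s2 - s1)" using s e2(2) by (intro mult_nonneg_nonneg) auto
        moreover have "norm (\<phi> t) \<le> \<Phi>" using t s by (intro \<Phi>(2)) auto
        ultimately show ?thesis unfolding norm_mult by (intro mult_mono r[OF t] norm_ge_zero)
      qed
    qed (use s in simp)
    also have "\<dots> = \<epsilon> / 2 * (s2 - s1) * s1" using \<Phi>(1) by simp
    also have "\<dots> \<le> \<epsilon> / 2 * (s2 - s1)" using s e by (intro mult_left_le) auto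
    finally have "norm (integral {0..s1} (\<lambda>t. ?r t * \<phi> t)) \<le> \<epsilon> / 2 * (s2 - s1)" .
    moreover have "integral {0..s1} (\<lambda>t. ?r t * \<phi> t)
       = integral {0..s1} (\<lambda>t. (complex_of_real (D j 0 (s2, t)) - of_real (D j 0 (s1, t))) * \<phi> t) - of_real (s2 - s1) * ?F' s1"
    proof -
      have "integral {0..s1} (\<lambda>t. ?r t * \<phi> t) = integral {0..s1} (\<lambda>t. (complex_of_real (D j 0 (s2, t)) - of_real (D j 0 (s1, t))) * \<phi> t
          - of_real (s2 - s1) * (of_real (D (Suc j) 0 (s1, t)) * \<phi> t))"
        by (rule integral_cong) (simp add: algebra_simps)
      also have "\<dots> = integral {0..s1} (\<lambda>t. (complex_of_real (D j 0 (s2, t)) - of_real (D j 0 (s1, t))) * \<phi> t)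
          - integral {0..s1} (\<lambda>t. of_real (s2 - s1) * (of_real (D (Suc j) 0 (s1, t)) * \<phi> t))"
      proof (rule Henstock_Kurzweil_Integration.integral_diff)
        show "(\<lambda>t. (complex_of_real (D j 0 (s2, t)) - of_real (D j 0 (s1, t))) * \<phi> t) integrable_on {0..s1}"
          unfolding left_diff_distrib
          by (intro integrable_continuous_real continuous_on_diff continuous_on_volterra_integrand[OF D J(1) \<phi>]) (use s in auto)
        show "(\<lambda>t. of_real (s2 - s1) * (of_real (D (Suc j) 0 (s1, t)) * \<phi> t)) integrable_on {0..s1}"
          by (intro integrable_continuous_real continuous_on_mult continuous_on_const continuous_on_volterra_integrand[OF D J(2) \<phi>]) (use s in auto)
      qed
      finally show ?thesis by simp
    qed
    ultimately have B: "norm (integral {0..s1} (\<lambda>t. (complex_of_real (D j 0 (s2, t)) - of_real (D j 0 (s1, t))) * \<phi> t) - of_real (s2 - s1) * ?F' s1) \<le> \<epsilon> / 2 * (s2 - s1)"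
      by simp
    have "?F s2 - ?F s1 - of_real (s2 - s1) * (?g s1 + ?F' s1)
       = (integral {s1..s2} (\<lambda>t. complex_of_real (D j 0 (s2, t)) * \<phi> t) - of_real (s2 - s1) * ?g s1)
         + (integral {0..s1} (\<lambda>t. (complex_of_real (D j 0 (s2, t)) - of_real (D j 0 (s1, t))) * \<phi> t) - of_real (s2 - s1) * ?F' s1)"
      using volterra_diff[OF D J(1) \<phi>, of s1 s2] s by (simp add: distrib_left)
    also have "norm \<dots> \<le> \<epsilon> / 2 * (s2 - s1) + \<epsilon> / 2 * (s2 - s1)" by (rule norm_triangle_mono[OF A B])
    finally show ?thesis by simp
  qed
  thus "\<exists>\<delta>>0. \<forall>s1 s2. 0 < s1 \<and> s1 < s2 \<and> s2 < 1 \<and> s2 - s1 < \<delta> \<longrightarrow>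
     norm (?F s2 - ?F s1 - of_real (s2 - s1) * (?g s1 + ?F' s1)) \<le> \<epsilon> * (s2 - s1)"
    using d1(1) d2(1) by (intro exI[of _ "min d1 d2"]) simp
qed

text \<open>
  An integral over \<open>[0,s]\<close> is one order smoother than \<open>\<phi>\<close>: its derivative is a product with \<open>\<phi>\<close> plus
  an integral of the same kind. This gain drives the bootstrapping of eigenfunctions.
\<close>
lemma smooth_volterra:
  assumes D: "partials_on ({0..N} \<times> {0..N}) lower_triangle D"
  shows "smooth m \<phi> \<Longrightarrow> j + Suc m \<le> N \<Longrightarrow>
     smooth (Suc m) (\<lambda>s. integral {0..s} (\<lambda>t. complex_of_real (D j 0 (s, t)) * \<phi> t))"
proof (induction m arbitrary: j)
  case 0
  have J: "(j, 0) \<in> {0..N} \<times> {0..N}" "(Suc j, 0) \<in> {0..N} \<times> {0..N}" using 0 by auto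
  have \<phi>: "continuous_on {0..1} \<phi>" using 0 by simp
  have g: "continuous_on {0..1} (\<lambda>s. complex_of_real (D j 0 (s, s)))"
    using smooth_diagonal[OF D, of j 0 0] 0 by simp
  show ?case
    by (rule smooth_SucI[OF continuous_on_volterra[OF D J(1) \<phi>] volterra_derivative[OF D J \<phi>]])
      (auto intro!: continuous_on_add continuous_on_mult g \<phi> continuous_on_volterra[OF D J(2) \<phi>])
next
  case (Suc m)
  have J: "(j, 0) \<in> {0..N} \<times> {0..N}" "(Suc j, 0) \<in> {0..N} \<times> {0..N}" using Suc.prems by auto
  note \<phi> = smooth_continuous[OF Suc.prems(1)]
  have "smooth (Suc m) (\<lambda>s. complex_of_real (D j 0 (s, s)))"
    using Suc.prems by (intro smooth_diagonal[OF D]) auto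
  hence A: "smooth (Suc m) (\<lambda>s. complex_of_real (D j 0 (s, s)) * \<phi> s)"
    using Suc.prems(1) by (rule smooth_mult)
  have B: "smooth (Suc m) (\<lambda>s. integral {0..s} (\<lambda>t. complex_of_real (D (Suc j) 0 (s, t)) * \<phi> t))"
    by (rule Suc.IH[OF smooth_Suc_D[OF Suc.prems(1)]]) (use Suc.prems(2) in simp)
  show ?case
    by (rule smooth_SucI[OF continuous_on_volterra[OF D J(1) \<phi>] volterra_derivative[OF D J \<phi>] smooth_add[OF A B]])
qed

lemma smooth_cong:
  assumes "smooth m f" "\<And>s. s \<in> {0..1} \<Longrightarrow> f s = g s"
  shows "smooth m g"
proof (cases m)
  case 0
  thus ?thesis using assms continuous_on_cong[of "{0..1}" "{0..1}" f g] by simp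
next
  case (Suc l)
  obtain f' where f: "continuous_on {0..1} f" "\<forall>s. 0 < s \<and> s < 1 \<longrightarrow> (f has_vector_derivative f' s) (at s)" "smooth l f'"
    using assms(1) unfolding Suc by auto
  have "(g has_vector_derivative f' s) (at s)" if "0 < s" "s < 1" for s
    by (rule has_vector_derivative_transform_within_open[of f _ _ "{0<..<1}"]) (use f(2) assms(2) that in auto)
  moreover have "continuous_on {0..1} g"
    using f(1) assms(2) continuous_on_cong[of "{0..1}" "{0..1}" f g] by simp
  ultimately show ?thesis unfolding Suc using f(3) by (intro smooth_SucI) auto
qed

text \<open>
  The point reflection of the square exchanges the triangles; integrals over \<open>[s,1]\<close> become integrals
  over \<open>[0,1-s]\<close>, so the lower triangle suffices.
\<close>
lemma partials_reflect:
  assumes D: "partials_on J upper_triangle D"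
  shows "partials_on J lower_triangle (\<lambda>j k x. (-1) ^ (j + k) * D j k (1 - fst x, 1 - snd x))"
proof -
  have mem: "(1 - fst x, 1 - snd x) \<in> upper_triangle" if "x \<in> lower_triangle" for x :: "real \<times> real"
    using that by (auto simp: lower_triangle_def upper_triangle_def)
  have int: "(1 - s, 1 - t) \<in> interior upper_triangle" if st: "(s, t) \<in> interior lower_triangle" for s t :: real
  proof -
    let ?U = "(\<lambda>x::real \<times> real. (1 - fst x, 1 - snd x)) -` interior lower_triangle"
    have "open ?U" by (intro open_vimage continuous_intros) simp
    moreover have "?U \<subseteq> upper_triangle"
    proof
      fix x :: "real \<times> real" assume "x \<in> ?U"
      hence "(1 - fst x, 1 - snd x) \<in> lower_triangle" using interior_subset by auto
      thus "x \<in> upper_triangle" by (auto simp: lower_triangle_def upper_triangle_def)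
    qed
    ultimately have "?U \<subseteq> interior upper_triangle" by (rule interior_maximal[rotated])
    thus ?thesis using st by auto
  qed
  have cont: "continuous_on lower_triangle (\<lambda>x. (-1) ^ (j + k) * D j k (1 - fst x, 1 - snd x))" if "(j, k) \<in> J" for j k
    by (intro continuous_on_mult continuous_on_const continuous_on_compose2[OF partials_onD(1)[OF D that]] continuous_intros)
      (use mem in auto)
  have bdd: "bounded ((\<lambda>x. (-1) ^ (j + k) * D j k (1 - fst x, 1 - snd x)) ` lower_triangle)" if "(j, k) \<in> J" for j k
    by (intro compact_imp_bounded compact_continuous_image cont that compact_lower_triangle)
  have refl: "((\<lambda>u. 1 - u) has_real_derivative - 1) (at a)" for a :: real
    by (auto intro!: derivative_eq_intros)
  have d1: "((\<lambda>u. (-1) ^ (j + k) * D j k (1 - u, 1 - t)) has_real_derivative (-1) ^ (Suc j + k) * D (Suc j) k (1 - s, 1 - t)) (at s)"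
    if "(s, t) \<in> interior lower_triangle" "(Suc j, k) \<in> J" for j k s t
    using DERIV_cmult[OF DERIV_chain2[OF partials_onD(3)[OF D int[OF that(1)] that(2)] refl], of "(-1) ^ (j + k)"] by simp
  have d2: "((\<lambda>u. (-1) ^ (j + k) * D j k (1 - s, 1 - u)) has_real_derivative (-1) ^ (j + Suc k) * D j (Suc k) (1 - s, 1 - t)) (at t)"
    if "(s, t) \<in> interior lower_triangle" "(j, Suc k) \<in> J" for j k s t
    using DERIV_cmult[OF DERIV_chain2[OF partials_onD(4)[OF D int[OF that(1)] that(2)] refl], of "(-1) ^ (j + k)"] by simp
  show ?thesis
    unfolding partials_on_def using cont bdd d1 d2 by auto
qed

lemma integral_reflect_unit:
  fixes h :: "real \<Rightarrow> complex"
  assumes "continuous_on {s..1} h"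
  shows "integral {0..1 - s} (\<lambda>t. h (1 - t)) = integral {s..1} h"
proof -
  have "(h has_integral integral {s..1} h) (cbox s 1)"
    using assms by (simp add: integrable_integral integrable_continuous_real)
  from has_integral_affinity[OF this, of "- 1" 1]
  have "((\<lambda>t. h (1 - t)) has_integral integral {s..1} h) ((\<lambda>x. 1 - x) ` {s..1})" by simp
  thus ?thesis by (simp add: image_diff_atLeastAtMost integral_unique)
qed

text \<open>
  Splitting the integral at \<open>s\<close> expresses \<open>f\<close> by two Volterra integrals of itself, so each order of
  smoothness implies the next one.
\<close>
lemma eigenfunction_smooth:
  assumes green: "green_kernel r \<kappa>" and f: "continuous_on {0..1} f"
    and eq: "\<And>s. s \<in> {0..1} \<Longrightarrow> f s = c * integral {0..1} (\<lambda>t. complex_of_real (\<kappa> (s, t)) * f t)"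
  shows "smooth (Suc (2 * r)) f"
proof -
  let ?J = "{0..2*r+2} \<times> {0..2*r+2}"
  obtain D1 D2 where D1: "partials_on ?J lower_triangle D1" and D2: "partials_on ?J upper_triangle D2"
    and \<kappa>1: "\<And>x. x \<in> lower_triangle \<Longrightarrow> \<kappa> x = D1 0 0 x" and \<kappa>2: "\<And>x. x \<in> upper_triangle \<Longrightarrow> \<kappa> x = D2 0 0 x"
    and \<kappa>: "continuous_on ({0..1} \<times> {0..1}) \<kappa>"
    using green_kernelE[OF green] by metis
  define D' where "D' = (\<lambda>j k x. (-1) ^ (j + k) * D2 j k (1 - fst x, 1 - snd x))"
  have D': "partials_on ?J lower_triangle D'" unfolding D'_def by (rule partials_reflect[OF D2])
  define F1 where "F1 = (\<lambda>s. integral {0..s} (\<lambda>t. complex_of_real (D1 0 0 (s, t)) * f t))"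
  define F2 where "F2 = (\<lambda>s. integral {0..s} (\<lambda>t. complex_of_real (D' 0 0 (s, t)) * f (1 - t)))"
  have rep: "f s = c * (F1 s + F2 (1 - s))" if s: "s \<in> {0..1}" for s
  proof -
    have cont: "continuous_on {a..b} (\<lambda>t. complex_of_real (\<kappa> (s, t)) * f t)" if "0 \<le> a" "b \<le> 1" for a b
      by (rule continuous_on_subset[of "{0..1}"])
        (use that in \<open>auto intro!: continuous_on_mult continuous_on_kernel_section[OF \<kappa> s] f\<close>)
    have "integral {0..1} (\<lambda>t. complex_of_real (\<kappa> (s, t)) * f t)
       = integral {0..s} (\<lambda>t. complex_of_real (\<kappa> (s, t)) * f t) + integral {s..1} (\<lambda>t. complex_of_real (\<kappa> (s, t)) * f t)"
      by (rule Henstock_Kurzweil_Integration.integral_combine[symmetric])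
        (use s in \<open>auto intro!: integrable_continuous_real cont\<close>)
    also have "integral {0..s} (\<lambda>t. complex_of_real (\<kappa> (s, t)) * f t) = F1 s"
      unfolding F1_def by (rule integral_cong) (use s in \<open>auto simp: \<kappa>1 mem_lower_triangle\<close>)
    also have "integral {s..1} (\<lambda>t. complex_of_real (\<kappa> (s, t)) * f t) = integral {0..1 - s} (\<lambda>t. complex_of_real (\<kappa> (s, 1 - t)) * f (1 - t))"
      by (rule integral_reflect_unit[symmetric]) (use s in \<open>auto intro!: cont\<close>)
    also have "\<dots> = F2 (1 - s)"
      unfolding F2_def by (rule integral_cong) (use s in \<open>auto simp: \<kappa>2 mem_upper_triangle D'_def\<close>)
    finally show ?thesis using eq[OF s] by simp
  qed
  have "smooth m f" if "m \<le> Suc (2 * r)" for m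
    using that
  proof (induction m)
    case 0 thus ?case using f by simp
  next
    case (Suc m)
    have IH: "smooth m f" using Suc by simp
    have s1: "smooth (Suc m) F1"
      unfolding F1_def by (rule smooth_volterra[OF D1 IH]) (use Suc.prems in simp)
    have s2: "smooth (Suc m) F2"
      unfolding F2_def by (rule smooth_volterra[OF D' smooth_reflect[OF IH]]) (use Suc.prems in simp)
    have "smooth (Suc m) (\<lambda>s. c * (F1 s + F2 (1 - s)))"
      by (rule smooth_mult[OF smooth_const smooth_add[OF s1 smooth_reflect[OF s2]]])
    thus ?case by (rule smooth_cong) (use rep in simp)
  qed
  from this[OF order_refl] show ?thesis .
qed

text \<open>
  The representative \<open>kernel_fun \<kappa> \<psi> / lam\<close> satisfies the eigenvalue equation pointwise and is
  therefore smooth. The estimate covers all complex multiples of \<open>\<psi>\<close>, since the projection enters as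
  a real linear operator.
\<close>
lemma eigenvector_approx:
  assumes green: "green_kernel r \<kappa>"
    and eig: "(integral_operator \<kappa>) \<psi> = cscale lam \<psi>" and lam: "lam \<noteq> 0"
    and cont: "continuous_on {0..1} (kernel_fun \<kappa> \<psi>)" and K: "(integral_operator \<kappa>) \<psi> = abs_linf (kernel_fun \<kappa> \<psi>)"
  obtains C where "C \<ge> 0" "\<And>n c. n \<ge> 1 \<Longrightarrow>
     norm (cscale c \<psi> - (orth_projection r n) (cscale c \<psi>)) \<le> C * norm c * (1 / real n) ^ (2 * r + 1)"
proof -
  have \<kappa>: "continuous_on ({0..1} \<times> {0..1}) \<kappa>" using green by (simp add: green_kernel_def)
  define f where "f s = (1 / lam) * kernel_fun \<kappa> \<psi> s" for s
  have f: "continuous_on {0..1} f" unfolding f_def by (intro continuous_on_mult continuous_on_const cont)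
  have "cscale (1 / lam) (abs_linf (kernel_fun \<kappa> \<psi>)) = \<psi>"
    unfolding K[symmetric] eig using lam by simp
  hence \<psi>f: "AE t in unit_lebesgue. rep_linf \<psi> t = f t"
    using rep_abs_AE[OF ess_bounded_continuous[OF f]] abs_linf_cmult[OF ess_bounded_continuous[OF cont], of "1 / lam"]
    by (simp add: f_def[abs_def])
  have "f s = (1 / lam) * integral {0..1} (\<lambda>t. complex_of_real (\<kappa> (s, t)) * f t)" if s: "s \<in> {0..1}" for s
  proof -
    note c = continuous_on_kernel_section[OF \<kappa> s]
    have "kernel_fun \<kappa> \<psi> s = (LINT t|unit_lebesgue. complex_of_real (\<kappa> (s, t)) * f t)"
      unfolding kernel_fun_def
    proof (rule integral_cong_AE)
      show "AE t in unit_lebesgue. complex_of_real (\<kappa> (s, t)) * rep_linf \<psi> t = complex_of_real (\<kappa> (s, t)) * f t"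
        using \<psi>f by eventually_elim simp
    qed (use ess_bounded_mult_continuous[OF _ c] rep_linf_ess_bounded ess_bounded_continuous[OF f] in \<open>auto simp: ess_bounded_def\<close>)
    also have "\<dots> = integral {0..1} (\<lambda>t. complex_of_real (\<kappa> (s, t)) * f t)"
      by (intro lebesgue_integral_eq_integral ess_bounded_integrable ess_bounded_continuous continuous_on_mult c f) simp
    finally show ?thesis by (simp add: f_def)
  qed
  hence sm: "smooth (Suc (2 * r)) f" by (rule eigenfunction_smooth[OF green f])
  show thesis
  proof (rule smooth_poly_approx[OF sm])
    fix C assume C: "C \<ge> 0" and ap: "\<And>a b. 0 \<le> a \<Longrightarrow> a \<le> b \<Longrightarrow> b \<le> 1 \<Longrightarrow>
     \<exists>p. degree p \<le> 2 * r \<and> (\<forall>t\<in>{a..b}. norm (f t - poly p (complex_of_real t)) \<le> C * (b - a) ^ Suc (2 * r))"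
    show thesis
    proof (rule that[of "proj_const (2 * r) * C"])
      show "proj_const (2 * r) * C \<ge> 0" using C proj_const_ge_1[of "2 * r"] by simp
      fix n :: nat and c :: complex assume n: "n \<ge> 1"
      show "norm (cscale c \<psi> - (orth_projection r n) (cscale c \<psi>)) \<le> proj_const (2 * r) * C * norm c * (1 / real n) ^ (2 * r + 1)"
      proof (rule norm_linf_leI, rule AE_unit_of_cells[OF n])
        fix j assume j: "j < n"
        obtain p where p: "degree p \<le> 2 * r" "\<forall>t\<in>cell n j. norm (f t - poly p (complex_of_real t)) \<le> C * (1 / real n) ^ Suc (2 * r)"
          using ap[of "real j / real n" "real (Suc j) / real n"] cell_bounds[OF j] unfolding cell_width[OF n] cell_def by auto
        have "AE t in lebesgue_on (cell n j). norm (rep_linf (cscale c \<psi> - (orth_projection r n) (cscale c \<psi>)) t)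
            \<le> proj_const (2 * r) * (norm c * (C * (1 / real n) ^ Suc (2 * r)))"
        proof (rule orth_projection_residual_le[OF j, of "smult c p"])
          show "AE t in lebesgue_on (cell n j). norm (rep_linf (cscale c \<psi>) t - poly (smult c p) (complex_of_real t)) \<le> norm c * (C * (1 / real n) ^ Suc (2 * r))"
            using AE_cell[OF rep_cscale_AE[of c \<psi>] j] AE_cell[OF \<psi>f j] AE_cell_mem
          proof eventually_elim
            case (elim t)
            have "norm (c * (f t - poly p (complex_of_real t))) \<le> norm c * (C * (1 / real n) ^ Suc (2 * r))"
              unfolding norm_mult by (rule mult_left_mono[OF p(2)[rule_format, OF elim(3)] norm_ge_zero])
            thus ?case using elim(1,2) by (simp add: right_diff_distrib)
          qed
        qed (use p(1) C order_trans[OF degree_smult_le p(1)] in auto)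
        thus "AE t in lebesgue_on (cell n j). norm (rep_linf (cscale c \<psi> - (orth_projection r n) (cscale c \<psi>)) t)
            \<le> proj_const (2 * r) * C * norm c * (1 / real n) ^ (2 * r + 1)"
          by (simp only: Suc_eq_plus1 mult.assoc mult.left_commute[of "norm c"])
      qed
    qed
  qed
qed

lemma complex_linear_integral_operator:
  assumes \<kappa>: "continuous_on ({0..1} \<times> {0..1}) \<kappa>"
    and K: "\<And>x. continuous_on {0..1} (kernel_fun \<kappa> x) \<and> (integral_operator \<kappa>) x = abs_linf (kernel_fun \<kappa> x)"
  shows "(integral_operator \<kappa>) (cscale c x) = cscale c ((integral_operator \<kappa>) x)"
proof -
  have eb: "ess_bounded (kernel_fun \<kappa> x)" for x using K ess_bounded_continuous by blast
  have "kernel_fun \<kappa> (cscale c x) s = c * kernel_fun \<kappa> x s" if s: "s \<in> {0..1}" for s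
  proof -
    note m = ess_bounded_mult_continuous[OF rep_linf_ess_bounded continuous_on_kernel_section[OF \<kappa> s]]
    have "kernel_fun \<kappa> (cscale c x) s = (LINT t|unit_lebesgue. c * (complex_of_real (\<kappa> (s, t)) * rep_linf x t))"
      unfolding kernel_fun_def
    proof (rule integral_cong_AE)
      show "AE t in unit_lebesgue. complex_of_real (\<kappa> (s, t)) * rep_linf (cscale c x) t = c * (complex_of_real (\<kappa> (s, t)) * rep_linf x t)"
        using rep_cscale_AE[of c x] by eventually_elim simp
      show "(\<lambda>t. complex_of_real (\<kappa> (s, t)) * rep_linf (cscale c x) t) \<in> borel_measurable unit_lebesgue"
        using m[of "cscale c x"] by (simp add: ess_bounded_def)
      show "(\<lambda>t. c * (complex_of_real (\<kappa> (s, t)) * rep_linf x t)) \<in> borel_measurable unit_lebesgue"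
        using ess_bounded_cmult[OF m[of x], of c] by (simp add: ess_bounded_def)
    qed
    thus ?thesis by (simp add: kernel_fun_def)
  qed
  hence "AE s in unit_lebesgue. kernel_fun \<kappa> (cscale c x) s = c * kernel_fun \<kappa> x s"
    using AE_unit_mem by (auto elim: eventually_mono)
  hence "abs_linf (kernel_fun \<kappa> (cscale c x)) = abs_linf (\<lambda>s. c * kernel_fun \<kappa> x s)"
    by (rule abs_linf_cong_AE[OF eb ess_bounded_cmult[OF eb]])
  thus ?thesis using K abs_linf_cmult[OF eb] by simp
qed

section \<open>The defect of the modified operator\<close>

lemma modified_defect:
  "(K - modified_operator K P) x =
     K (x - P x) - P (K (x - P x))"
  by (simp add: modified_operator_def blinfun.bilinear_simps algebra_simps)

text \<open>
  Here \<open>K - KM = QKQ\<close>, so each image of the defect is again a projection residual and the estimates for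
  residuals can be applied twice. The exponent of the last bound is \<open>(2r+3) + min (2r+1) 2\<close>.
\<close>
lemma modified_defect_estimates:
  assumes green: "green_kernel r \<kappa>" and K: "K = integral_operator \<kappa>"
    and \<psi>: "K \<psi> = cscale lam \<psi>" "lam \<noteq> 0"
  obtains C where "C \<ge> 1"
    and "complex_linear_op K"
    and "\<And>n x. n \<ge> 1 \<Longrightarrow> norm ((K - modified_operator K (orth_projection r n)) x) \<le> C * norm x * (1 / real n) ^ 2"
    and "\<And>n c. n \<ge> 1 \<Longrightarrow> norm ((K - modified_operator K (orth_projection r n)) (cscale c \<psi>))
          \<le> C * norm c * (1 / real n) ^ (2 * r + 3)"
    and "\<And>n x. n \<ge> 1 \<Longrightarrow> norm (K ((K - modified_operator K (orth_projection r n)) x)) \<le> C * norm x * (1 / real n) ^ 3"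
    and "\<And>n c. n \<ge> 1 \<Longrightarrow> norm (K ((K - modified_operator K (orth_projection r n)) (cscale c \<psi>)))
          \<le> C * norm c * (1 / real n) ^ (if r \<ge> 1 then 2 * r + 5 else 4)"
proof (rule integral_operator_estimates[OF green])
  fix M assume M: "M \<ge> 0"
    and Kf: "\<And>x. continuous_on {0..1} (kernel_fun \<kappa> x) \<and> (integral_operator \<kappa>) x = abs_linf (kernel_fun \<kappa> x)"
    and e1: "\<And>n w. n \<ge> 1 \<Longrightarrow> cell_orthogonal r n w \<Longrightarrow> norm ((integral_operator \<kappa>) w) \<le> M * norm w * (1 / real n)"
    and e2: "\<And>n w. n \<ge> 1 \<Longrightarrow> cell_orthogonal r n w \<Longrightarrow>
        norm ((integral_operator \<kappa>) w) \<le> M * norm w * ((1 / real n) ^ (2 * r + 1) + (1 / real n) ^ 2)"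
    and e3: "\<And>n w. n \<ge> 1 \<Longrightarrow> cell_orthogonal r n w \<Longrightarrow>
        norm ((integral_operator \<kappa>) w - (orth_projection r n) ((integral_operator \<kappa>) w))
          \<le> M * norm w * (1 / real n) ^ 2"
  note e1 = e1[folded K] and e2 = e2[folded K] and e3 = e3[folded K]
  have \<kappa>: "continuous_on ({0..1} \<times> {0..1}) \<kappa>" using green by (simp add: green_kernel_def)
  obtain B where B: "B \<ge> 0" "\<And>n c. n \<ge> 1 \<Longrightarrow>
     norm (cscale c \<psi> - (orth_projection r n) (cscale c \<psi>)) \<le> B * norm c * (1 / real n) ^ (2 * r + 1)"
    using eigenvector_approx[OF green \<psi>(1)[unfolded K] \<psi>(2)] Kf by metis
  define q where "q = proj_const (2 * r)"
  have q: "q \<ge> 1" by (simp add: q_def proj_const_ge_1)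
  let ?P = "\<lambda>n. (orth_projection r n)"
  let ?T = "\<lambda>n. (K - modified_operator K (orth_projection r n))"
  have orthT: "cell_orthogonal r n (?T n x)" for n x
    unfolding modified_defect by (rule cell_orthogonal_residual)
  have T_le: "norm (?T n x) \<le> M * norm (x - ?P n x) * (1 / real n) ^ 2" if n: "n \<ge> 1" for n x
    unfolding modified_defect by (rule e3[OF n cell_orthogonal_residual])
  have t1: "norm (?T n x) \<le> (M * q) * norm x * (1 / real n) ^ 2" if n: "n \<ge> 1" for n x
  proof -
    have "M * norm (x - ?P n x) * (1 / real n) ^ 2 \<le> M * (q * norm x) * (1 / real n) ^ 2"
      unfolding q_def using M norm_orth_projection_residual_le[OF n, of x r]
      by (intro mult_right_mono mult_left_mono) auto
    thus ?thesis using T_le[OF n, of x] by (simp add: mult.assoc)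
  qed
  have t2: "norm (?T n (cscale c \<psi>)) \<le> (M * B) * norm c * (1 / real n) ^ (2 * r + 3)" if n: "n \<ge> 1" for n c
  proof -
    have "M * norm (cscale c \<psi> - ?P n (cscale c \<psi>)) * (1 / real n) ^ 2 \<le> M * (B * norm c * (1 / real n) ^ (2 * r + 1)) * (1 / real n) ^ 2"
      using M B(2)[OF n, of c] by (intro mult_right_mono mult_left_mono) auto
    also have "\<dots> = (M * B) * norm c * ((1 / real n) ^ (2 * r + 1) * (1 / real n) ^ 2)" by (simp add: mult_ac)
    also have "\<dots> = (M * B) * norm c * (1 / real n) ^ (2 * r + 3)"
      unfolding power_add[symmetric] by (simp add: eval_nat_numeral)
    finally show ?thesis using T_le[OF n, of "cscale c \<psi>"] by linarith
  qed
  have t3: "norm (K (?T n x)) \<le> (M * (M * q)) * norm x * (1 / real n) ^ 3" if n: "n \<ge> 1" for n x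
  proof -
    have "norm (K (?T n x)) \<le> M * norm (?T n x) * (1 / real n)" by (rule e1[OF n orthT])
    also have "\<dots> \<le> M * ((M * q) * norm x * (1 / real n) ^ 2) * (1 / real n)"
      using M t1[OF n, of x] by (intro mult_right_mono mult_left_mono) auto
    finally show ?thesis by (simp add: power3_eq_cube power2_eq_square mult_ac)
  qed
  have t4: "norm (K (?T n (cscale c \<psi>))) \<le> (2 * M * (M * B)) * norm c * (1 / real n) ^ (if r \<ge> 1 then 2 * r + 5 else 4)"
    if n: "n \<ge> 1" for n c
  proof -
    define h where "h = 1 / real n"
    have h: "0 \<le> h" "h \<le> 1" using n by (auto simp: h_def)
    have hp: "h ^ (2 * r + 3) * (h ^ (2 * r + 1) + h ^ 2) \<le> 2 * h ^ (if r \<ge> 1 then 2 * r + 5 else 4)"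
    proof (cases "r \<ge> 1")
      case True
      have "h ^ (2 * r + 1) \<le> h ^ 2" by (rule power_decreasing) (use True h in auto)
      hence "h ^ (2 * r + 3) * (h ^ (2 * r + 1) + h ^ 2) \<le> h ^ (2 * r + 3) * (2 * h ^ 2)"
        using h by (intro mult_left_mono) auto
      also have "\<dots> = 2 * h ^ (2 * r + 5)" by (simp add: eval_nat_numeral mult_ac)
      finally show ?thesis using True by simp
    next
      case False
      hence "r = 0" by simp
      moreover have "h ^ 2 \<le> h ^ 1" by (rule power_decreasing) (use h in auto)
      hence "h ^ 3 * (h ^ 1 + h ^ 2) \<le> h ^ 3 * (2 * h)" using h by (intro mult_left_mono) auto
      ultimately show ?thesis by (simp add: eval_nat_numeral mult_ac)
    qed
    have "norm (K (?T n (cscale c \<psi>))) \<le> M * norm (?T n (cscale c \<psi>)) * (h ^ (2 * r + 1) + h ^ 2)"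
      unfolding h_def by (rule e2[OF n orthT])
    also have "\<dots> \<le> M * ((M * B) * norm c * h ^ (2 * r + 3)) * (h ^ (2 * r + 1) + h ^ 2)"
      using M t2[OF n, of c] h unfolding h_def by (intro mult_right_mono mult_left_mono add_nonneg_nonneg) auto
    also have "\<dots> = (M * (M * B) * norm c) * (h ^ (2 * r + 3) * (h ^ (2 * r + 1) + h ^ 2))" by (simp only: mult_ac)
    also have "\<dots> \<le> (M * (M * B) * norm c) * (2 * h ^ (if r \<ge> 1 then 2 * r + 5 else 4))"
      using M B(1) hp by (intro mult_left_mono mult_nonneg_nonneg) auto
    finally show ?thesis by (simp only: h_def mult_ac)
  qed
  define C where "C = 1 + M * q + M * B + M * (M * q) + 2 * M * (M * B)"
  have C: "C \<ge> 1" "M * q \<le> C" "M * B \<le> C" "M * (M * q) \<le> C" "2 * M * (M * B) \<le> C"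
    using M B(1) q by (auto simp: C_def intro!: add_nonneg_nonneg)
  have up: "y \<le> C * a * b" if "y \<le> D * a * b" "D \<le> C" "a \<ge> 0" "b \<ge> 0" for y D a b
    using that mult_right_mono[OF mult_right_mono[OF that(2,3)] that(4)] by linarith
  show thesis
  proof (rule that[OF C(1)])
    show "complex_linear_op K"
      unfolding complex_linear_op_def using complex_linear_integral_operator[OF \<kappa> Kf] K
      by (auto intro!: blinfun_eqI)
    show "norm (?T n x) \<le> C * norm x * (1 / real n) ^ 2" if "n \<ge> 1" for n x
      by (rule up[OF t1[OF that] C(2)]) auto
    show "norm (?T n (cscale c \<psi>)) \<le> C * norm c * (1 / real n) ^ (2 * r + 3)" if "n \<ge> 1" for n c
      by (rule up[OF t2[OF that] C(3)]) auto
    show "norm (K (?T n x)) \<le> C * norm x * (1 / real n) ^ 3" if "n \<ge> 1" for n x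
      by (rule up[OF t3[OF that] C(4)]) auto
    show "norm (K (?T n (cscale c \<psi>))) \<le> C * norm c * (1 / real n) ^ (if r \<ge> 1 then 2 * r + 5 else 4)" if "n \<ge> 1" for n c
      by (rule up[OF t4[OF that] C(5)]) auto
  qed
qed

lemma range_rank_one:
  assumes dim: "linf.dim S = 1" and \<psi>: "\<psi> \<in> S" "\<psi> \<noteq> 0" and y: "y \<in> S"
  obtains c where "y = cscale c \<psi>"
proof -
  obtain B where B: "S \<subseteq> linf.span B" "card B = linf.dim S"
    using linf.basis_exists[of S] by metis
  then obtain v where "B = {v}" using dim by (auto simp: card_1_singleton_iff)
  hence sub: "S \<subseteq> range (\<lambda>k. cscale k v)" using B(1) by (simp add: linf.span_singleton)
  then obtain a b where a: "\<psi> = cscale a v" and b: "y = cscale b v" using \<psi>(1) y by blast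
  have "a \<noteq> 0" using a \<psi>(2) by auto
  hence "y = cscale (b / a) \<psi>" by (simp add: a b)
  thus thesis by (rule that)
qed

section \<open>Spectral error bounds\<close>

text \<open>
  The abstract error analysis. The operator \<open>T\<close> is the defect, of size \<open>h\<^sup>2\<close> in general
  and smaller on multiples of \<open>\<psi>\<close>. Splitting \<open>\<phi>\<close> into \<open>E \<phi>\<close> and the error \<open>\<phi> - E \<phi>\<close> yields an inequality
  for the error in which it also occurs on the right, with a factor at most \<open>1/2\<close>. The smallness
  assumptions ensure this, and that \<open>E \<phi>\<close> has norm at least \<open>1/2\<close>, so that the eigenvalue error can be
  read off from \<open>\<lambda> (\<lambda> - z) E \<phi> = E K T \<phi>\<close>.
\<close>
lemma rank_one_spectral_error:
  fixes K E A T :: "linf \<Rightarrow>\<^sub>L linf"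
  assumes lin: "complex_linear_op K" "complex_linear_op E"
    and \<psi>: "K \<psi> = cscale lam \<psi>" "\<psi> \<noteq> 0" "lam \<noteq> 0"
    and rank: "\<And>x. \<exists>c. E x = cscale c \<psi>"
    and A: "A o\<^sub>L (K - cmul z) = id_blinfun - E" "(K - cmul z) o\<^sub>L A = id_blinfun - E" "norm A \<le> a"
    and T: "(K - cmul z) \<phi> = T \<phi>" and \<phi>: "norm \<phi> = 1"
    and C: "C \<ge> 1" and h: "0 \<le> h" "h \<le> 1"
    and T1: "\<And>x. norm (T x) \<le> C * norm x * h ^ 2"
    and T2: "\<And>c. norm (T (cscale c \<psi>)) \<le> C * norm c * h ^ (2 * r + 3)"
    and T3: "\<And>x. norm (K (T x)) \<le> C * norm x * h ^ 3"
    and T4: "\<And>c. norm (K (T (cscale c \<psi>))) \<le> C * norm c * h ^ e"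
    and e: "e \<le> 2 * r + 5"
    and small: "a * C * h ^ 2 \<le> 1 / 2" "2 * a * C * (norm E / norm \<psi>) * h ^ 2 \<le> 1 / 2"
    and z: "\<rho> > 0" "\<rho> \<le> norm z" and \<phi>': "\<phi>' = cscale (1 / z) (K \<phi>)"
  shows "norm (\<phi> - E \<phi>) \<le> 2 * a * C * (norm E / norm \<psi>) * h ^ (2 * r + 3)"
    and "norm (\<phi>' - E \<phi>') \<le> a / \<rho> * (C * (norm E / norm \<psi>) * (1 + 2 * a * C)) * h ^ e"
    and "norm (lam - z) \<le> 2 * norm E / norm lam * (C * (norm E / norm \<psi>) * (1 + 2 * a * C)) * h ^ e"
proof -
  define G where "G = norm E / norm \<psi>"
  have G: "G \<ge> 0" by (simp add: G_def)
  have a0: "a \<ge> 0" using A(3) norm_ge_zero order_trans by blast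
  define y where "y = E \<phi>"
  define d where "d = norm (\<phi> - y)"
  obtain c where c: "y = cscale c \<psi>" using rank[of \<phi>] by (auto simp: y_def)
  have "norm c * norm \<psi> \<le> norm E"
    using norm_blinfun[of E \<phi>] \<phi> by (simp add: y_def[symmetric] c norm_cscale)
  hence cG: "norm c \<le> G" using \<psi>(2) by (simp add: G_def field_simps)
  have res: "A ((K - cmul z) x) = x - E x" for x
    using arg_cong[OF A(1), of "\<lambda>S. blinfun_apply S x"] by (simp add: blinfun.diff_left)
  have normA: "norm (A x) \<le> a * norm x" for x
    using norm_blinfun[of A x] mult_right_mono[OF A(3) norm_ge_zero[of x]] by linarith
  have split: "\<phi> = y + (\<phi> - y)" by simp
  have T\<phi>: "norm (T \<phi>) \<le> C * G * h ^ (2 * r + 3) + C * d * h ^ 2"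
  proof -
    have "norm (T \<phi>) \<le> norm (T y) + norm (T (\<phi> - y))"
      by (subst split, subst blinfun.add_right) (rule norm_triangle_ineq)
    also have "norm (T y) \<le> C * norm c * h ^ (2 * r + 3)" unfolding c by (rule T2)
    also have "\<dots> \<le> C * G * h ^ (2 * r + 3)" using cG C h by (intro mult_right_mono mult_left_mono) auto
    finally show ?thesis using T1[of "\<phi> - y"] by (simp add: d_def)
  qed
  have "d \<le> a * norm (T \<phi>)"
    using normA[of "T \<phi>"] res[of \<phi>] by (simp add: T d_def y_def)
  also have "\<dots> \<le> a * (C * G * h ^ (2 * r + 3) + C * d * h ^ 2)" by (rule mult_left_mono[OF T\<phi> a0])
  also have "\<dots> = a * C * G * h ^ (2 * r + 3) + (a * C * h ^ 2) * d" by (simp add: algebra_simps)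
  also have "(a * C * h ^ 2) * d \<le> 1 / 2 * d" by (rule mult_right_mono[OF small(1)]) (simp add: d_def)
  finally have d: "d \<le> 2 * a * C * G * h ^ (2 * r + 3)" by simp
  thus "norm (\<phi> - E \<phi>) \<le> 2 * a * C * (norm E / norm \<psi>) * h ^ (2 * r + 3)"
    by (simp add: d_def y_def G_def)
  have KT: "norm (K (T \<phi>)) \<le> C * G * (1 + 2 * a * C) * h ^ e"
  proof -
    have "norm (K (T \<phi>)) \<le> norm (K (T y)) + norm (K (T (\<phi> - y)))"
      by (subst split, subst blinfun.add_right, subst blinfun.add_right) (rule norm_triangle_ineq)
    also have "norm (K (T y)) \<le> C * norm c * h ^ e" unfolding c by (rule T4)
    also have "\<dots> \<le> C * G * h ^ e" using cG C h by (intro mult_right_mono mult_left_mono) auto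
    also have "norm (K (T (\<phi> - y))) \<le> C * d * h ^ 3" using T3[of "\<phi> - y"] by (simp add: d_def)
    also have "\<dots> \<le> C * (2 * a * C * G * h ^ (2 * r + 3)) * h ^ 3" using d C h by (intro mult_right_mono mult_left_mono) auto
    also have "\<dots> = C * G * (2 * a * C) * (h ^ (2 * r + 3) * h ^ 3)" by (simp only: mult_ac)
    also have "\<dots> \<le> C * G * (2 * a * C) * h ^ e"
    proof (rule mult_left_mono)
      show "h ^ (2 * r + 3) * h ^ 3 \<le> h ^ e"
        unfolding power_add[symmetric] by (rule power_decreasing) (use e h in auto)
      show "0 \<le> C * G * (2 * a * C)" using C G a0 by (intro mult_nonneg_nonneg) auto
    qed
    finally show ?thesis by (simp add: algebra_simps)
  qed
  have Kc: "K (cscale b x) = cscale b (K x)" and Ec: "E (cscale b x) = cscale b (E x)" for b x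
    using lin[unfolded complex_linear_op_def, rule_format, of b, THEN arg_cong, of "\<lambda>S. blinfun_apply S x"] by simp_all
  have T': "K \<phi> - cscale z \<phi> = T \<phi>" using T by (simp add: blinfun.diff_left)
  have "(K - cmul z) \<phi>' = cscale (1 / z) (K (T \<phi>))"
    unfolding T'[symmetric] \<phi>' by (simp add: blinfun.diff_left blinfun.diff_right Kc linf.scale_right_diff_distrib)
  hence "norm (\<phi>' - E \<phi>') \<le> a * (norm (1 / z) * norm (K (T \<phi>)))"
    using normA[of "(K - cmul z) \<phi>'"] res[of \<phi>'] by (simp add: norm_cscale)
  also have "\<dots> \<le> a * (1 / \<rho> * (C * G * (1 + 2 * a * C) * h ^ e))"
    using KT z a0 by (intro mult_left_mono mult_mono) (auto simp: norm_divide frac_le)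
  finally show "norm (\<phi>' - E \<phi>') \<le> a / \<rho> * (C * (norm E / norm \<psi>) * (1 + 2 * a * C)) * h ^ e"
    by (simp add: G_def mult.assoc)
  have comm_z: "E ((K - cmul z) x) = (K - cmul z) (E x)" for x
  proof -
    have "(id_blinfun - E) o\<^sub>L (K - cmul z) = ((K - cmul z) o\<^sub>L A) o\<^sub>L (K - cmul z)"
      by (simp only: A(2))
    also have "\<dots> = (K - cmul z) o\<^sub>L (A o\<^sub>L (K - cmul z))" by (rule blinfun_compose_assoc)
    also have "\<dots> = (K - cmul z) o\<^sub>L (id_blinfun - E)" by (simp only: A(1))
    finally have "E o\<^sub>L (K - cmul z) = (K - cmul z) o\<^sub>L E"
      unfolding bounded_bilinear.diff_left[OF bounded_bilinear_blinfun_compose, of id_blinfun]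
        bounded_bilinear.diff_right[OF bounded_bilinear_blinfun_compose, of _ id_blinfun] compose_id_blinfun by simp
    from arg_cong[OF this, of "\<lambda>S. blinfun_apply S x"] show ?thesis by simp
  qed
  have eigE: "K (E x) = cscale lam (E x)" for x
  proof -
    obtain b where "E x = cscale b \<psi>" using rank by blast
    thus ?thesis by (simp add: Kc \<psi>(1) mult.commute)
  qed
  have commK: "E (K x) = cscale lam (E x)" for x
    using comm_z[of x] by (simp add: blinfun.diff_left blinfun.diff_right Ec eigE)
  have "cscale (lam - z) y = E (T \<phi>)"
    unfolding T'[symmetric] y_def by (simp add: blinfun.diff_right commK Ec linf.scale_left_diff_distrib)
  hence "cscale lam (cscale (lam - z) y) = E (K (T \<phi>))"
    by (simp add: commK)
  hence "norm lam * (norm (lam - z) * norm y) = norm (E (K (T \<phi>)))"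
    by (metis norm_cscale)
  also have "\<dots> \<le> norm E * (C * G * (1 + 2 * a * C) * h ^ e)"
    using norm_blinfun[of E "K (T \<phi>)"] mult_left_mono[OF KT norm_ge_zero[of E]] by linarith
  finally have le: "norm lam * (norm (lam - z) * norm y) \<le> norm E * (C * G * (1 + 2 * a * C) * h ^ e)" .
  have "d \<le> 1 / 2"
  proof -
    have "2 * a * C * G * h ^ (2 * r + 3) \<le> 2 * a * C * G * h ^ 2"
      using a0 C G h by (intro mult_left_mono power_decreasing) auto
    thus ?thesis using d small(2) by (simp add: G_def)
  qed
  hence "norm y \<ge> 1 / 2" using norm_triangle_ineq2[of \<phi> "\<phi> - y"] \<phi> by (simp add: d_def)
  hence "norm lam * (norm (lam - z) * (1 / 2)) \<le> norm lam * (norm (lam - z) * norm y)"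
    by (intro mult_left_mono) auto
  with le have "norm lam * norm (lam - z) \<le> 2 * (norm E * (C * G * (1 + 2 * a * C) * h ^ e))" by simp
  hence "norm (lam - z) \<le> 2 * (norm E * (C * G * (1 + 2 * a * C) * h ^ e)) / norm lam"
    using \<psi>(3) by (simp only: pos_le_divide_eq zero_less_norm_iff mult.commute not_False_eq_True)
  also have "\<dots> = 2 * norm E / norm lam * (C * (norm E / norm \<psi>) * (1 + 2 * a * C)) * h ^ e"
    unfolding G_def[symmetric] by (simp only: times_divide_eq_left times_divide_eq_right mult.assoc)
  finally show "norm (lam - z) \<le> 2 * norm E / norm lam * (C * (norm E / norm \<psi>) * (1 + 2 * a * C)) * h ^ e"
    .
qed

text \<open>
  If \<open>z\<close> were close to a point \<open>w\<close> of the resolvent set, \<open>\<phi>\<close> would be an approximate eigenvector for \<open>w\<close>,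
  which the bound on the resolvent excludes.
\<close>
lemma far_from_curve:
  fixes K T :: "linf \<Rightarrow>\<^sub>L linf"
  assumes T: "(K - cmul z) \<phi> = T \<phi>" "norm (T \<phi>) \<le> b" and \<phi>: "norm \<phi> = 1"
    and w: "w \<in> resolvent_set K" and M: "norm (resolvent K w) \<le> M" "M > 0" and b: "M * b \<le> 1 / 2"
  shows "1 / (2 * M) \<le> norm (w - z)"
proof -
  have "\<phi> = (resolvent K w) ((K - cmul w) \<phi>)"
    using arg_cong[OF is_inverse_op_resolvent(2)[OF w], of "\<lambda>S. blinfun_apply S \<phi>"] by simp
  hence "1 \<le> M * norm ((K - cmul w) \<phi>)"
    using norm_blinfun[of "resolvent K w" "(K - cmul w) \<phi>"] \<phi>
      mult_right_mono[OF M(1) norm_ge_zero[of "(K - cmul w) \<phi>"]] by simp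
  also have "(K - cmul w) \<phi> = T \<phi> - cscale (w - z) \<phi>"
    using T(1) by (simp add: blinfun.diff_left linf.scale_left_diff_distrib algebra_simps)
  also have "norm \<dots> \<le> norm (T \<phi>) + norm (cscale (w - z) \<phi>)" by (rule norm_triangle_ineq4)
  also have "\<dots> \<le> b + norm (w - z)" using T(2) \<phi> by (simp add: norm_cscale)
  finally have "1 \<le> M * b + M * norm (w - z)" using M(2) by (simp add: distrib_left)
  hence "1 / 2 \<le> M * norm (w - z)" using b by simp
  thus ?thesis using M(2) by (simp add: field_simps)
qed

theorem theorem4p5:
  fixes r :: nat and \<kappa> :: "real \<times> real \<Rightarrow> real" and lam :: complex and \<Gamma> :: "real \<Rightarrow> complex"
    and K E :: "linf \<Rightarrow>\<^sub>L linf" and P KM EM :: "nat \<Rightarrow> linf \<Rightarrow>\<^sub>L linf"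
    and lamM :: "nat \<Rightarrow> complex" and \<phi> \<phi>' :: "nat \<Rightarrow> linf"
  assumes kernel: "green_kernel r \<kappa>"
    and K: "K = integral_operator \<kappa>"
    and P: "\<And>n. P n = orth_projection r n"
    and KM: "\<And>n. KM n = modified_operator K (P n)"
    and curve: "positively_oriented_jordan_curve \<Gamma>" "rectifiable_path \<Gamma>"
    and separates: "separates_spectrum \<Gamma> K lam"
    and E: "E = spectral_projection K \<Gamma>"
    and EM: "\<And>n. EM n = spectral_projection (KM n) \<Gamma>"
    and eigenvalue: "lam \<noteq> 0" "is_eigenvalue K lam"
    and simple: "linf.dim (range (blinfun_apply E)) = 1"
    and lamM: "eventually (\<lambda>n.
              lamM n \<in> inside (path_image \<Gamma>) \<and> is_eigenvalue (KM n) (lamM n)) sequentially"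
    and \<phi>: "eventually (\<lambda>n. \<phi> n \<in> range (blinfun_apply (EM n)) \<and> norm (\<phi> n) = 1 \<and>
              blinfun_apply (KM n) (\<phi> n) = cscale (lamM n) (\<phi> n)) sequentially"
    and \<phi>': "\<And>n. \<phi>' n = cscale (1 / lamM n) (blinfun_apply K (\<phi> n))"
  shows "(\<lambda>n. norm (\<phi> n - blinfun_apply E (\<phi> n)))
           \<in> O(\<lambda>n. (1 / real n) ^ (if r \<ge> 1 then 2 * r + 3 else 3)) \<and>
         (\<lambda>n. norm (\<phi>' n - blinfun_apply E (\<phi>' n)))
           \<in> O(\<lambda>n. (1 / real n) ^ (if r \<ge> 1 then 2 * r + 5 else 4)) \<and>
         (\<lambda>n. norm (lam - lamM n))
           \<in> O(\<lambda>n. (1 / real n) ^ (if r \<ge> 1 then 2 * r + 5 else 4))"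
proof -
  obtain \<psi> where \<psi>: "\<psi> \<noteq> 0" "K \<psi> = cscale lam \<psi>"
    using eigenvalue(2) by (auto simp: is_eigenvalue_def)
  have path: "path \<Gamma>" using curve(2) by (simp add: rectifiable_path_def)
  have closed: "closed (path_image \<Gamma>)" by (rule closed_path_image[OF path])
  have res: "path_image \<Gamma> \<subseteq> resolvent_set K" and lam_in: "lam \<in> inside (path_image \<Gamma>)"
    and zero_out: "0 \<in> outside (path_image \<Gamma>)"
    using separates eigenvalue(1) by (auto simp: separates_spectrum_def)
  have wind: "z \<notin> path_image \<Gamma>" "winding_number \<Gamma> z = 1" if "z \<in> inside (path_image \<Gamma>)" for z
  proof -
    show "z \<notin> path_image \<Gamma>" using that inside_no_overlap[of "path_image \<Gamma>"] by (meson disjoint_iff)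
    show "winding_number \<Gamma> z = 1" using that curve(1) by (simp add: positively_oriented_jordan_curve_def)
  qed
  obtain V where V: "\<And>d. d division_of {0..1} \<Longrightarrow> (\<Sum>k\<in>d. norm (\<Gamma> (Sup k) - \<Gamma> (Inf k))) \<le> V"
    using curve(2) by (auto simp: rectifiable_path_def)
  have "compact (resolvent K ` path_image \<Gamma>)"
    by (intro compact_continuous_image continuous_on_resolvent res compact_path_image path)
  hence "bounded (resolvent K ` path_image \<Gamma>)" by (rule compact_imp_bounded)
  then obtain R where R: "R > 0" "\<forall>x\<in>resolvent K ` path_image \<Gamma>. norm x \<le> R" unfolding bounded_pos by blast
  have R': "norm (resolvent K w) \<le> R" if "w \<in> path_image \<Gamma>" for w using R(2) that by blast
  let ?e = "if r \<ge> 1 then 2 * r + 5 else 4"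
  let ?T = "\<lambda>n. K - modified_operator K (orth_projection r n)"
  show ?thesis
  proof (rule modified_defect_estimates[OF kernel K \<psi>(2) eigenvalue(1)])
    fix C assume C: "C \<ge> 1" and lin: "complex_linear_op K"
      and T1: "\<And>n x. n \<ge> 1 \<Longrightarrow> norm ((?T n) x) \<le> C * norm x * (1 / real n) ^ 2"
      and T2: "\<And>n c. n \<ge> 1 \<Longrightarrow> norm ((?T n) (cscale c \<psi>)) \<le> C * norm c * (1 / real n) ^ (2 * r + 3)"
      and T3: "\<And>n x. n \<ge> 1 \<Longrightarrow> norm (K ((?T n) x)) \<le> C * norm x * (1 / real n) ^ 3"
      and T4: "\<And>n c. n \<ge> 1 \<Longrightarrow> norm (K ((?T n) (cscale c \<psi>))) \<le> C * norm c * (1 / real n) ^ ?e"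
    have linE: "complex_linear_op E"
      unfolding E by (rule complex_linear_spectral_projection[OF lin curve(2) res])
    have E\<psi>: "E \<psi> = \<psi>"
    proof -
      obtain \<delta> where \<delta>: "\<delta> > 0" "\<And>w. w \<in> path_image \<Gamma> \<Longrightarrow> \<delta> \<le> dist lam w"
        using separate_point_closed[OF closed wind(1)[OF lam_in]] by blast
      have \<delta>': "\<delta> \<le> norm (w - lam)" if "w \<in> path_image \<Gamma>" for w
        using \<delta>(2)[OF that] by (simp add: dist_norm norm_minus_commute)
      obtain A where "A o\<^sub>L (K - cmul lam) = id_blinfun - E"
        using contour_parametrix[OF lin curve(2) res wind[OF lam_in] V R' \<delta>(1) \<delta>'] unfolding E by blast
      from arg_cong[OF this, of "\<lambda>S. blinfun_apply S \<psi>"] show ?thesis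
        by (simp add: blinfun.diff_left \<psi>(2) blinfun.zero_right)
    qed
    have rank: "\<exists>c. E x = cscale c \<psi>" for x
    proof -
      have "\<psi> \<in> range (E)" using E\<psi> by (metis rangeI)
      from range_rank_one[OF simple this \<psi>(1) rangeI[of "E" x]] show ?thesis by metis
    qed
    obtain \<rho> where \<rho>: "\<rho> > 0" "ball 0 \<rho> \<subseteq> outside (path_image \<Gamma>)"
      using open_outside[OF closed] zero_out unfolding open_contains_ball by blast
    have \<rho>': "\<rho> \<le> norm z" if "z \<in> inside (path_image \<Gamma>)" for z
    proof (rule ccontr)
      assume "\<not> \<rho> \<le> norm z"
      hence "z \<in> outside (path_image \<Gamma>)" using \<rho>(2) by (auto simp: dist_norm)
      thus False using that inside_Int_outside[of "path_image \<Gamma>"] by blast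
    qed
    \<comment> \<open>The bound for the parametrix when the eigenvalue has distance at least \<open>1 / (2R)\<close> from the curve.\<close>
    define a where "a = R * V / (1 / (2 * R))"
    have small: "\<forall>\<^sub>F n in sequentially. X * (1 / real n) ^ 2 \<le> 1 / 2" for X :: real
    proof -
      have "(\<lambda>n. X * (1 / real n) ^ 2) \<longlonglongrightarrow> X * 0 ^ 2"
        by (intro tendsto_intros lim_1_over_n)
      hence "\<forall>\<^sub>F n in sequentially. X * (1 / real n) ^ 2 < 1 / 2"
        by (intro order_tendstoD(2)[of _ "X * 0 ^ 2"]) auto
      thus ?thesis by eventually_elim simp
    qed
    have main: "\<forall>\<^sub>F n in sequentially.
        norm (\<phi> n - E (\<phi> n)) \<le> 2 * a * C * (norm E / norm \<psi>) * (1 / real n) ^ (2 * r + 3) \<and>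
        norm (\<phi>' n - E (\<phi>' n)) \<le> a / \<rho> * (C * (norm E / norm \<psi>) * (1 + 2 * a * C)) * (1 / real n) ^ ?e \<and>
        norm (lam - lamM n) \<le> 2 * norm E / norm lam * (C * (norm E / norm \<psi>) * (1 + 2 * a * C)) * (1 / real n) ^ ?e"
      using lamM \<phi> eventually_ge_at_top[of 1] small[of "a * C"] small[of "2 * a * C * (norm E / norm \<psi>)"] small[of "R * C"]
    proof eventually_elim
      case (elim n)
      note n = elim(3)
      have zin: "lamM n \<in> inside (path_image \<Gamma>)" and n\<phi>: "norm (\<phi> n) = 1" using elim by auto
      have T: "(K - cmul (lamM n)) (\<phi> n) = (?T n) (\<phi> n)"
        using elim(2) by (simp add: blinfun.diff_left KM P)
      have T\<phi>: "norm ((?T n) (\<phi> n)) \<le> C * (1 / real n) ^ 2" using T1[OF n, of "\<phi> n"] n\<phi> by simp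
      have far: "1 / (2 * R) \<le> norm (w - lamM n)" if "w \<in> path_image \<Gamma>" for w
        by (rule far_from_curve[OF T T\<phi> n\<phi> _ R'[OF that] R(1)]) (use res that elim(6) in \<open>auto simp: mult.assoc\<close>)
      have R2: "1 / (2 * R) > 0" using R(1) by simp
      obtain A where A: "A o\<^sub>L (K - cmul (lamM n)) = id_blinfun - E" "(K - cmul (lamM n)) o\<^sub>L A = id_blinfun - E" "norm A \<le> a"
        using contour_parametrix[OF lin curve(2) res wind[OF zin] V R' R2 far] unfolding E a_def by blast
      have h: "0 \<le> 1 / real n" "1 / real n \<le> 1" using n by auto
      have e: "?e \<le> 2 * r + 5" by simp
      note est = rank_one_spectral_error[OF lin linE \<psi>(2,1) eigenvalue(1) rank A T n\<phi> C h T1[OF n] T2[OF n] T3[OF n] T4[OF n] e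
          elim(4,5) \<rho>(1) \<rho>'[OF zin] \<phi>']
      show ?case using est by blast
    qed
    have bigo: "(\<lambda>n. norm (f n)) \<in> O(\<lambda>n. (1 / real n) ^ k)" if "\<forall>\<^sub>F n in sequentially. norm (f n) \<le> X * (1 / real n) ^ k"
      for f :: "nat \<Rightarrow> 'z::real_normed_vector" and X k
      using that by (intro bigoI[of _ X]) (auto elim!: eventually_mono)
    have r3: "(if r \<ge> 1 then 2 * r + 3 else 3) = 2 * r + 3" by simp
    show ?thesis
      unfolding r3 using main
      by (intro conjI bigo; elim eventually_mono) blast+
  qed
qed

end
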